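(* Let $0<\alpha<\pi/2$, let $\Delta=\{z\in\mathbb{C}\setminus\{0\}: -\alpha<\arg(z)<\alpha\}$, and let $h\ge 0$. Let $f$ be analytic in $\Delta$ and of exponential type at most $h$ in $\Delta$, i.e. for every $\epsilon>0$ there is a constant $C_\epsilon\ge 0$ such that $|f(z)|\le C_\epsilon e^{(h+\epsilon)|z|}$ for all $z\in\Delta$. Extend $f$ to $\bar\Delta$ by non-tangential boundary values as described in the context. Let $p$ be a real number with $p\cos(\alpha)<-h$, and let $\Gamma$ be the oriented curve parameterized by $\gamma:\mathbb{R}\to\mathbb{C}$, $$\gamma(t)=p-ie^{i\alpha}|t|\ \text{ for } t\in(-\infty,0],\qquad \gamma(t)=p+ie^{-i\alpha}|t|\ \text{ for } t\in(0,+\infty),$$ oriented in the direction of increasing $t$. Let $g$ be the concatenated Laplace transform of $f$, defined on $\Omega$ (see the context). Then the following Fourier inversion formula holds: $$f(z)=\int_{\Gamma} g(\omega)e^{-\omega z}\,d\omega\qquad\text{for all } z\in\Delta.$$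
   Context: Boundary values: $f$ is bounded near each point of $\partial\Delta$, so by Fatou's theorem it has a non-tangential limit at almost every point of $\partial\Delta$. Extend $f$ to $\bar\Delta$ by letting $f(\zeta)$, $\zeta\in\partial\Delta$, be the non-tangential limit of $f$ at $\zeta$ (from within $\Delta$) if it exists, and $f(\zeta)=0$ otherwise. (The value at the single point $\zeta=0$ is immaterial.) Indicator: for $|\theta|\le\alpha$, $I_f(\theta):=\limsup_{s\to+\infty}\frac{\ln|f(se^{i\theta})|}{s}\in[-\infty,+\infty)$, with $\ln 0=-\infty$. Half-planes: for $|\theta|\le\alpha$, $\Omega_\theta:=\{\omega\in\mathbb{C}:\operatorname{Re}(\omega e^{i\theta})<-I_f(\theta)\}$ (which is all of $\mathbb{C}$ if $I_f(\theta)=-\infty$). Directional Laplace transform: for $|\theta|\le\alpha$ and $\omega\in\Omega_\theta$, $$g_\theta(\omega):=\frac{1}{2\pi i}\int_{e^{i\theta}[0,+\infty)}f(\zeta)e^{\omega\zeta}\,d\zeta,$$ the ray being oriented from $0$ to $\infty$. Concatenated Laplace transform: $\Omega:=\bigcup_{|\theta|\le\alpha}\Omega_\theta$, and $g:\Omega\to\mathbb{C}$ is defined by $g(\omega):=g_\theta(\omega)$ for $\omega\in\Omega_\theta$. (This is well-defined: $g_{\theta_1}=g_{\theta_2}$ on $\Omega_{\theta_1}\cap\Omega_{\theta_2}$.) *)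

theory Defs
  imports "HOL-Analysis.Analysis"
begin

definition sector :: "real \<Rightarrow> complex set" where
  "sector \<alpha> = {z. z \<noteq> 0 \<and> - \<alpha> < Arg z \<and> Arg z < \<alpha>}"

definition exp_type_at_most :: "real \<Rightarrow> (complex \<Rightarrow> complex) \<Rightarrow> complex set \<Rightarrow> bool" where
  "exp_type_at_most h f D \<longleftrightarrow>
     (\<forall>\<epsilon>>0. \<exists>C\<ge>0. \<forall>z\<in>D. cmod (f z) \<le> C * exp ((h + \<epsilon>) * cmod z))"

definition approach_region :: "complex set \<Rightarrow> complex \<Rightarrow> real \<Rightarrow> complex set" where
  "approach_region D \<zeta> M = {z \<in> D. dist z \<zeta> < M * infdist z (frontier D)}"

(* A region that does not accumulate at \<zeta> (for instance the empty one, for M \<le> 1)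
   imposes no condition, so M may range over all reals. *)
definition has_nontangential_limit ::
    "complex set \<Rightarrow> (complex \<Rightarrow> complex) \<Rightarrow> complex \<Rightarrow> complex \<Rightarrow> bool" where
  "has_nontangential_limit D f \<zeta> l \<longleftrightarrow>
     (\<forall>M. (f \<longlongrightarrow> l) (at \<zeta> within approach_region D \<zeta> M))"

(* Only the values on closure D matter. *)
definition boundary_ext :: "complex set \<Rightarrow> (complex \<Rightarrow> complex) \<Rightarrow> complex \<Rightarrow> complex" where
  "boundary_ext D f \<zeta> =
     (if \<zeta> \<in> D then f \<zeta>
      else if \<zeta> \<in> frontier D \<and> (\<exists>l. has_nontangential_limit D f \<zeta> l)
        then (THE l. has_nontangential_limit D f \<zeta> l)
      else 0)"

definition ln_ereal :: "real \<Rightarrow> ereal" where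
  "ln_ereal x = (if x = 0 then - \<infinity> else ereal (ln x))"

definition indicator_fun :: "real \<Rightarrow> (complex \<Rightarrow> complex) \<Rightarrow> real \<Rightarrow> ereal" where
  "indicator_fun \<alpha> f \<theta> =
     Limsup at_top (\<lambda>s::real.
       ln_ereal (cmod (boundary_ext (sector \<alpha>) f (of_real s * cis \<theta>))) / ereal s)"

definition laplace_halfplane :: "real \<Rightarrow> (complex \<Rightarrow> complex) \<Rightarrow> real \<Rightarrow> complex set" where
  "laplace_halfplane \<alpha> f \<theta> = {\<omega>. ereal (Re (\<omega> * cis \<theta>)) < - indicator_fun \<alpha> f \<theta>}"

(* Absolutely convergent line integral over a possibly unbounded, piecewise C1 curve \<gamma> with
   parameter set T. As with all Bochner integrals, line_integral is 0 if line_integrable fails. *)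
definition line_integrable :: "real set \<Rightarrow> (real \<Rightarrow> complex) \<Rightarrow> (complex \<Rightarrow> complex) \<Rightarrow> bool" where
  "line_integrable T \<gamma> F \<longleftrightarrow>
     set_integrable lebesgue T (\<lambda>t. F (\<gamma> t) * vector_derivative \<gamma> (at t))"

definition line_integral :: "real set \<Rightarrow> (real \<Rightarrow> complex) \<Rightarrow> (complex \<Rightarrow> complex) \<Rightarrow> complex" where
  "line_integral T \<gamma> F =
     (LINT t:T|lebesgue. F (\<gamma> t) * vector_derivative \<gamma> (at t))"

definition dir_laplace :: "real \<Rightarrow> (complex \<Rightarrow> complex) \<Rightarrow> real \<Rightarrow> complex \<Rightarrow> complex" where
  "dir_laplace \<alpha> f \<theta> \<omega> =
     1 / (2 * of_real pi * \<i>) *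
     line_integral {0..} (\<lambda>s. of_real s * cis \<theta>)
       (\<lambda>\<zeta>. boundary_ext (sector \<alpha>) f \<zeta> * exp (\<omega> * \<zeta>))"

definition laplace_domain :: "real \<Rightarrow> (complex \<Rightarrow> complex) \<Rightarrow> complex set" where
  "laplace_domain \<alpha> f = (\<Union>\<theta>\<in>{-\<alpha>..\<alpha>}. laplace_halfplane \<alpha> f \<theta>)"

(* The common value of all dir_laplace \<alpha> f \<theta> \<omega> with \<omega> in the half-plane of \<theta>;
   THE pins it down only where these values agree, and only for \<omega> in laplace_domain. *)
definition concat_laplace :: "real \<Rightarrow> (complex \<Rightarrow> complex) \<Rightarrow> complex \<Rightarrow> complex" where
  "concat_laplace \<alpha> f \<omega> =
     (THE w. \<exists>\<theta>\<in>{-\<alpha>..\<alpha>}. \<omega> \<in> laplace_halfplane \<alpha> f \<theta> \<and> w = dir_laplace \<alpha> f \<theta> \<omega>)"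

definition inversion_curve :: "real \<Rightarrow> real \<Rightarrow> real \<Rightarrow> complex" where
  "inversion_curve \<alpha> p t =
     (if t \<le> 0 then of_real p - \<i> * cis \<alpha> * of_real \<bar>t\<bar>
      else of_real p + \<i> * cis (- \<alpha>) * of_real \<bar>t\<bar>)"

end

theory Submission
  imports Defs "HOL-Complex_Analysis.Complex_Analysis"
begin

text \<open>
  On the two halves of the curve, \<open>g\<close> is the Laplace transform along one edge of the sector, so
  inserting its definition and applying Fubini's theorem turns the right-hand side into
  \<open>1 / (2 \<pi> i)\<close> times the integral of \<open>f(\<zeta>) exp (p (\<zeta> - z)) / (\<zeta> - z)\<close> along the boundary of the
  sector. Cauchy's formula evaluates this integral for slightly smaller sectors, and dominated
  convergence moves the rays to the edges, where \<open>f\<close> has boundary values almost everywhere.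

  For the latter (Fatou's theorem), \<open>f\<close> is made bounded by an exponential factor, so that a primitive
  \<open>F\<close> extends to a Lipschitz function on the closed sector. Its restriction to an edge is
  differentiable almost everywhere, and differentiability of \<open>F\<close> along the edge at a point forces
  \<open>F' = f\<close> to have a non-tangential limit there.

  Two Laplace transforms along different rays agree far to the left by rotation of the ray, hence
  on the whole (convex) intersection of their half-planes by analytic continuation.
\<close>

section \<open>Differentiability of Lipschitz functions almost everywhere\<close>

text \<open>The condition on \<open>p\<close> works in two ways. It forces \<open>p < 0\<close>, and
  \<open>Re z\<close> is at least \<open>|z| cos \<alpha>\<close> on the sector, so
  \<open>f(z) exp (p z)\<close> decays exponentially, uniformly in the direction of
  \<open>z\<close>; this makes whole rays usable as contours. It also places the curve: on each
  half, the real part of \<omega> times the unit vector of the corresponding edge keeps the value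
  \<open>p cos \<alpha>\<close>, to the left of \<open>-h\<close>, while
  \<open>exp (- \<omega> z)\<close> decays at a rate equal to the distance of \<open>z\<close> from
  the line through that edge. The obstacle is the edge itself, where \<open>f\<close> is known only
  almost everywhere and without continuity. Interior rays are compared with it along the arcs
  \<open>|z| = s\<close>, which meet the edge non-tangentially, so that dominated convergence
  applies with the radius as parameter. The half-planes come from the indicator and may be much
  larger than the region given by \<open>h\<close>. Membership in two of them provides decay on two
  rays only, not between these, so a direct rotation of the ray is justified only far to the
  left.\<close>

lemma indefinite_integral_deriv_AE:
  fixes g :: "real \<Rightarrow> 'b::euclidean_space"
  assumes int: "\<And>a b. g integrable_on {a..b}"
    and \<Phi>: "\<And>a b. a \<le> b \<Longrightarrow> \<Phi> b - \<Phi> a = integral {a..b} g"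
  obtains N where "negligible N" "\<And>x. x \<notin> N \<Longrightarrow> (\<Phi> has_vector_derivative g x) (at x)"
proof -
  \<comment> \<open>Lebesgue's differentiation theorem is used for averages over intervals to the
    right of the point. Averages to the left are right averages of the reflected function, which is
    why a second exceptional set appears in reflected form.\<close>
  have int': "(\<lambda>x. g (- x)) integrable_on cbox a b" for a b
    using int[of "-b" "-a"] integrable_reflect[where f = g and a = "- b" and b = "- a"] by simp
  obtain N1 where N1: "negligible N1"
    "\<And>x e. \<lbrakk>x \<notin> N1; 0 < e\<rbrakk> \<Longrightarrow> \<exists>d>0. \<forall>h. 0 < h \<and> h < d \<longrightarrow>
       norm (integral (cbox x (x + h *\<^sub>R One)) g /\<^sub>R h ^ DIM(real) - g x) < e"
    using integrable_ccontinuous_explicit[of g] int by auto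
  obtain N2 where N2: "negligible N2"
    "\<And>x e. \<lbrakk>x \<notin> N2; 0 < e\<rbrakk> \<Longrightarrow> \<exists>d>0. \<forall>h. 0 < h \<and> h < d \<longrightarrow>
       norm (integral (cbox x (x + h *\<^sub>R One)) (\<lambda>x. g (- x)) /\<^sub>R h ^ DIM(real) - g (- x)) < e"
    using integrable_ccontinuous_explicit[of "\<lambda>x. g (- x)"] int' by auto
  have "negligible (uminus ` N2)"
    using N2(1) by (intro negligible_differentiable_image_negligible differentiable_on_minus differentiable_on_ident) simp_all
  moreover have "(\<Phi> has_vector_derivative g x) (at x)" if x: "x \<notin> N1 \<union> uminus ` N2" for x
  proof -
    have nx: "- x \<notin> N2" using x by (metis UnCI image_eqI minus_minus)
    have "((\<lambda>h. norm (\<Phi> (x + h) - \<Phi> x - h *\<^sub>R g x) / norm h) \<longlongrightarrow> 0) (at 0)"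
    proof (rule LIM_I)
      fix e :: real assume e: "0 < e"
      obtain d1 where d1: "d1 > 0" "\<And>h. 0 < h \<Longrightarrow> h < d1 \<Longrightarrow> 
          norm (integral {x..x + h} g /\<^sub>R h - g x) < e"
        using N1(2)[of x e] x e by auto
      obtain d2 where d2: "d2 > 0" "\<And>h. 0 < h \<Longrightarrow> h < d2 \<Longrightarrow> 
          norm (integral {- x..- x + h} (\<lambda>x. g (- x)) /\<^sub>R h - g x) < e"
        using N2(2)[of "-x" e] nx e by auto
      have "norm (\<Phi> (x + h) - \<Phi> x - h *\<^sub>R g x) / norm h < e"
        if h: "h \<noteq> 0" "norm h < min d1 d2" for h
      proof (cases "h > 0")
        case True
        have "\<Phi> (x + h) - \<Phi> x - h *\<^sub>R g x = h *\<^sub>R (integral {x..x + h} g /\<^sub>R h - g x)"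
          using True by (simp add: \<Phi>[of x "x+h"] scaleR_diff_right)
        then show ?thesis using d1(2)[of h] True h by simp
      next
        case False
        define k where "k = - h"
        have k: "k > 0" "k < d2" "h = - k" using False h k_def by auto
        have "integral {- x..- x + k} (\<lambda>x. g (- x)) = integral {x - k..x} g"
          using Henstock_Kurzweil_Integration.integral_reflect_real[where f = g and a = "x - k" and b = x]
          by (simp add: algebra_simps)
        also have "\<dots> = \<Phi> x - \<Phi> (x - k)" using \<Phi>[of "x-k" x] k by simp
        finally have *: "integral {- x..- x + k} (\<lambda>x. g (- x)) = \<Phi> x - \<Phi> (x - k)" .
        have "\<Phi> (x + h) - \<Phi> x - h *\<^sub>R g x 
            = - (k *\<^sub>R (integral {- x..- x + k} (\<lambda>x. g (- x)) /\<^sub>R k - g x))"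
          using k unfolding * by (simp add: scaleR_diff_right)
        then show ?thesis using d2(2)[of k] k by simp
      qed
      then show "\<exists>s>0. \<forall>h. h \<noteq> 0 \<and> norm (h - 0) < s \<longrightarrow> 
          norm (norm (\<Phi> (x + h) - \<Phi> x - h *\<^sub>R g x) / norm h - 0) < e"
        using d1 d2 by (intro exI[of _ "min d1 d2"]) auto
    qed
    then show ?thesis
      unfolding has_vector_derivative_def has_derivative_at
      by (simp add: bounded_linear_scaleR_left)
  qed
  ultimately show ?thesis using that[of "N1 \<union> uminus ` N2"] N1(1) by auto
qed

text \<open>Both sides agree on half-open intervals, an intersection-stable generator of the Borel
  sets. The case of interest is a sum equal to the identity: each summand then has a Stieltjes
  measure dominated by Lebesgue measure.\<close>

lemma emeasure_interval_measure_add: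
  fixes F G :: "real \<Rightarrow> real"
  assumes F: "mono F" "continuous_on UNIV F" and G: "mono G" "continuous_on UNIV G"
    and A: "A \<in> sets borel"
  shows "emeasure (interval_measure F) A + emeasure (interval_measure G) A
    = emeasure (interval_measure (\<lambda>x. F x + G x)) A"
proof -
  let ?\<mu> = "\<lambda>A. emeasure (interval_measure F) A + emeasure (interval_measure G) A"
  let ?M = "measure_of UNIV (sets borel) ?\<mu>"
  let ?N = "interval_measure (\<lambda>x. F x + G x)"
  have cont: "continuous (at_right a) F" "continuous (at_right a) G" for a
    using F(2) G(2) by (auto simp: continuous_on_eq_continuous_within intro: continuous_within_subset)
  have M: "emeasure ?M A = ?\<mu> A" if "A \<in> sets borel" for A
  proof (rule emeasure_measure_of_sigma)
    show "sigma_algebra UNIV (sets (borel::real measure))"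
      using sets.sigma_algebra_axioms[of "borel::real measure"] by simp
    show "positive (sets borel) ?\<mu>" by (simp add: positive_def)
    show "countably_additive (sets borel) ?\<mu>"
    proof (rule countably_additiveI)
      fix B :: "nat \<Rightarrow> real set"
      assume B: "range B \<subseteq> sets borel" "disjoint_family B"
      show "(\<Sum>i. ?\<mu> (B i)) = ?\<mu> (\<Union> (range B))"
        using B by (subst suminf_add[symmetric]) (auto simp: suminf_emeasure)
    qed
  qed fact
  have "?M = ?N"
  proof (rule measure_eqI_generator_eq[where E = "range (\<lambda>(a, b). {a<..b::real})"
        and \<Omega> = UNIV and A = "\<lambda>n. {- real n<..real n}"])
    show "Int_stable (range (\<lambda>(a, b). {a<..b::real}))"
    proof (rule Int_stableI, clarify)
      fix a b c d :: real
      have "{a<..b} \<inter> {c<..d} = (\<lambda>(a, b). {a<..b}) (max a c, min b d)" by auto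
      then show "{a<..b} \<inter> {c<..d} \<in> range (\<lambda>(a, b). {a<..b})" by (rule image_eqI) simp
    qed
    fix X assume "X \<in> range (\<lambda>(a, b). {a<..b::real})"
    then obtain a b where X: "X = {a<..b}" by auto
    show "emeasure ?M X = emeasure ?N X"
    proof (cases "a \<le> b")
      case True
      then have *: "F a \<le> F b" "G a \<le> G b" using F(1) G(1) by (auto simp: mono_def)
      have "emeasure ?M X = ennreal (F b - F a) + ennreal (G b - G a)"
        unfolding X using F(1) G(1) cont True
        by (subst M) (auto simp: emeasure_interval_measure_Ioc mono_def)
      also have "\<dots> = ennreal (F b + G b - (F a + G a))"
        using * by (subst ennreal_plus[symmetric]) (auto simp: algebra_simps)
      also have "\<dots> = emeasure ?N X"
        unfolding X using F(1) G(1) cont True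
        by (subst emeasure_interval_measure_Ioc) (auto simp: mono_def continuous_add add_mono)
      finally show ?thesis .
    qed (auto simp: X)
  next
    show "sets ?M = sigma_sets UNIV (range (\<lambda>(a, b). {a<..b::real}))"
      "sets ?N = sigma_sets UNIV (range (\<lambda>(a, b). {a<..b::real}))"
      by (simp_all add: borel_sigma_sets_Ioc sigma_sets_sigma_sets_eq)
    show "range (\<lambda>n. {- real n<..real n}) \<subseteq> range (\<lambda>(a, b). {a<..b::real})"
    proof
      fix X assume "X \<in> range (\<lambda>n. {- real n<..real n})"
      then obtain n where "X = (\<lambda>(a, b). {a<..b}) (- real n, real n)" by auto
      then show "X \<in> range (\<lambda>(a, b). {a<..b::real})" by (rule image_eqI) simp
    qed
    show "(\<Union>n. {- real n<..real n}) = UNIV"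
    proof -
      have "\<exists>n. - real n < x \<and> x \<le> real n" for x
      proof -
        obtain n where "\<bar>x\<bar> < real n" using reals_Archimedean2 by blast
        then show ?thesis by (intro exI[of _ n]) auto
      qed
      then show ?thesis by (auto simp: set_eq_iff)
    qed
    fix n :: nat
    show "emeasure ?M {- real n<..real n} \<noteq> \<infinity>"
      using F(1) G(1) cont
      by (subst M) (auto simp: emeasure_interval_measure_Ioc mono_def)
  qed simp
  then show ?thesis using M[OF A] by simp
qed

text \<open>Adding and subtracting a multiple of the function from \<open>x / 2\<close> splits the
  identity into two nondecreasing functions \<Phi> and \<Psi>. Their Stieltjes measures add up to
  Lebesgue measure, so that of \<Phi> is absolutely continuous; its Radon-Nikodym density is the
  derivative of \<Phi> almost everywhere, and the given function is an affine combination of \<Phi>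
  and \<open>x\<close>.\<close>

lemma lipschitz_AE_differentiable_real:
  fixes \<phi> :: "real \<Rightarrow> real"
  assumes "L-lipschitz_on UNIV \<phi>"
  shows "AE x in lebesgue. \<exists>d. (\<phi> has_real_derivative d) (at x)"
proof -
  define K where "K = max L 1"
  have K: "K > 0" and lip: "K-lipschitz_on UNIV \<phi>"
    using lipschitz_on_le[OF assms, of K] by (auto simp: K_def)
  define \<Phi> where "\<Phi> = (\<lambda>x. x / 2 + \<phi> x / (2 * K))"
  define \<Psi> where "\<Psi> = (\<lambda>x. x / 2 - \<phi> x / (2 * K))"
  have *: "\<bar>\<phi> y - \<phi> x\<bar> / (2 * K) \<le> (y - x) / 2" if "x \<le> y" for x y
    using lipschitz_onD[OF lip, of y x] that K by (simp add: dist_real_def field_simps)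
  have mono: "mono \<Phi>" "mono \<Psi>"
  proof -
    have "\<bar>(\<phi> y - \<phi> x) / (2 * K)\<bar> \<le> (y - x) / 2" if "x \<le> y" for x y
      using *[OF that] K by simp
    then have "\<bar>\<phi> y / (2 * K) - \<phi> x / (2 * K)\<bar> \<le> y / 2 - x / 2" if "x \<le> y" for x y
      using that by (simp add: diff_divide_distrib)
    then have "\<Phi> x \<le> \<Phi> y \<and> \<Psi> x \<le> \<Psi> y" if "x \<le> y" for x y
    proof -
      have "X / 2 + u \<le> Y / 2 + v \<and> X / 2 - u \<le> Y / 2 - v"
        if "\<bar>v - u\<bar> \<le> Y / 2 - X / 2" for X Y u v :: real
        using that by linarith
      from this[OF \<open>\<And>x y. x \<le> y \<Longrightarrow> \<bar>\<phi> y / (2 * K) - \<phi> x / (2 * K)\<bar> \<le> y / 2 - x / 2\<close>[OF that]]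
      show ?thesis unfolding \<Phi>_def \<Psi>_def .
    qed
    then show "mono \<Phi>" "mono \<Psi>"
      by (simp_all add: mono_def)
  qed
  have cont: "continuous_on UNIV \<Phi>" "continuous_on UNIV \<Psi>"
    unfolding \<Phi>_def \<Psi>_def using K lipschitz_on_continuous_on[OF lip]
    by (auto intro!: continuous_intros)
  have "absolutely_continuous lborel (interval_measure \<Phi>)"
    unfolding absolutely_continuous_def
  proof
    fix A :: "real set" assume A: "A \<in> null_sets lborel"
    then have "emeasure (interval_measure \<Phi>) A + emeasure (interval_measure \<Psi>) A = emeasure lborel A"
      using emeasure_interval_measure_add[OF mono(1) cont(1) mono(2) cont(2), of A]
      by (auto simp: \<Phi>_def \<Psi>_def lborel_eq_real)
    then show "A \<in> null_sets (interval_measure \<Phi>)" using A by (auto simp: null_sets_def)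
  qed
  then obtain g where g [measurable]: "g \<in> borel_measurable borel" and dens: "density lborel g = interval_measure \<Phi>"
    using sigma_finite_measure.Radon_Nikodym[OF sigma_finite_lborel, of "interval_measure \<Phi>"] by auto
  have nn: "(\<integral>\<^sup>+ x. g x * indicator {a..b} x \<partial>lborel) = ennreal (\<Phi> b - \<Phi> a)" if "a \<le> b" for a b
  proof -
    have "(\<integral>\<^sup>+ x. g x * indicator {a..b} x \<partial>lborel) = emeasure (interval_measure \<Phi>) {a..b}"
      unfolding dens[symmetric] by (simp add: emeasure_density)
    also have "\<dots> = ennreal (\<Phi> b - \<Phi> a)"
      using that mono(1) cont(1) by (intro emeasure_interval_measure_Icc) (auto simp: mono_def)
    finally show ?thesis .
  qed
  \<comment> \<open>The density has finite integral over every bounded interval, hence is finite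
    almost everywhere. This matters because \<open>enn2real\<close> sends infinity to 0.\<close>
  have "AE x in lborel. \<forall>n::nat. g x * indicator {- real n..real n} x \<noteq> \<infinity>"
    unfolding AE_all_countable
  proof
    fix n :: nat
    show "AE x in lborel. g x * indicator {- real n..real n} x \<noteq> \<infinity>"
      by (rule nn_integral_PInf_AE) (auto simp: nn)
  qed
  then have fin: "AE x in lborel. g x \<noteq> \<infinity>"
  proof (rule AE_mp, intro AE_I2 impI)
    fix x :: real assume x: "\<forall>n::nat. g x * indicator {- real n..real n} x \<noteq> \<infinity>"
    obtain n where "\<bar>x\<bar> < real n" using reals_Archimedean2 by blast
    then have "x \<in> {- real n..real n}" by auto
    then show "g x \<noteq> \<infinity>" using x[rule_format, of n] by simp
  qed
  define G where "G = (\<lambda>x. enn2real (g x))"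
  have G: "(G has_integral (\<Phi> b - \<Phi> a)) {a..b}" if "a \<le> b" for a b
  proof -
    have "((\<lambda>x. G x * indicator {a..b} x) has_integral (\<Phi> b - \<Phi> a)) UNIV"
    proof (rule nn_integral_has_integral)
      show "(\<lambda>x. G x * indicator {a..b} x) \<in> borel_measurable borel"
        unfolding G_def by measurable
      show "0 \<le> G x * indicator {a..b} x" for x by (simp add: G_def)
      have "(\<integral>\<^sup>+ x. ennreal (G x * indicator {a..b} x) \<partial>lborel) = (\<integral>\<^sup>+ x. g x * indicator {a..b} x \<partial>lborel)"
        by (rule nn_integral_cong_AE, use fin in eventually_elim)
          (auto simp: G_def indicator_def less_top)
      then show "(\<integral>\<^sup>+ x. ennreal (G x * indicator {a..b} x) \<partial>lborel) = ennreal (\<Phi> b - \<Phi> a)"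
        using nn[OF that] by simp
      show "0 \<le> \<Phi> b - \<Phi> a" using mono(1) that by (simp add: mono_def)
    qed
    also have "(\<lambda>x. G x * indicator {a..b} x) = (\<lambda>x. if x \<in> {a..b} then G x else 0)"
      by auto
    finally show ?thesis
      by (subst has_integral_restrict_UNIV[symmetric])
  qed
  have Gint: "G integrable_on {a..b}" for a b
    using G[of a b] by (cases "a \<le> b") (auto simp: integrable_on_def)
  have "\<Phi> b - \<Phi> a = integral {a..b} G" if "a \<le> b" for a b
    using G[OF that] by (simp add: integral_unique)
  then obtain N where N: "negligible N" "\<And>x. x \<notin> N \<Longrightarrow> (\<Phi> has_vector_derivative G x) (at x)"
    using indefinite_integral_deriv_AE[OF Gint] by blast
  have "\<exists>d. (\<phi> has_real_derivative d) (at x)" if "x \<notin> N" for x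
  proof -
    have "((\<lambda>x. 2 * K * (\<Phi> x - x / 2)) has_real_derivative 2 * K * (G x - 1 / 2)) (at x)"
      using N(2)[OF that] unfolding has_real_derivative_iff_has_vector_derivative[symmetric]
      by (auto intro!: derivative_eq_intros)
    moreover have "(\<lambda>x. 2 * K * (\<Phi> x - x / 2)) = \<phi>" using K by (auto simp: \<Phi>_def field_simps)
    ultimately show ?thesis by auto
  qed
  moreover have "N \<in> null_sets lebesgue" using N(1) negligible_iff_null_sets by blast
  ultimately show ?thesis by (intro AE_I'[of N]) auto
qed

lemma lipschitz_AE_differentiable_complex:
  fixes \<phi> :: "real \<Rightarrow> complex"
  assumes "L-lipschitz_on UNIV \<phi>"
  shows "AE x in lebesgue. \<exists>d. (\<phi> has_vector_derivative d) (at x)"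
proof -
  have "L-lipschitz_on UNIV (\<lambda>x. Re (\<phi> x))" "L-lipschitz_on UNIV (\<lambda>x. Im (\<phi> x))"
    using assms order_trans[OF abs_Re_le_cmod[of "\<phi> x - \<phi> y" for x y]]
      order_trans[OF abs_Im_le_cmod[of "\<phi> x - \<phi> y" for x y]]
    unfolding lipschitz_on_def dist_norm real_norm_def by simp_all
  then have "AE x in lebesgue. (\<exists>d. ((\<lambda>x. Re (\<phi> x)) has_real_derivative d) (at x)) \<and> (\<exists>d. ((\<lambda>x. Im (\<phi> x)) has_real_derivative d) (at x))"
    by (intro AE_conjI lipschitz_AE_differentiable_real)
  then show ?thesis
  proof (rule AE_mp, intro AE_I2 impI)
    fix x assume "(\<exists>d. ((\<lambda>x. Re (\<phi> x)) has_real_derivative d) (at x)) \<and> (\<exists>d. ((\<lambda>x. Im (\<phi> x)) has_real_derivative d) (at x))"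
    then obtain d e where "((\<lambda>x. Re (\<phi> x)) has_real_derivative d) (at x)" "((\<lambda>x. Im (\<phi> x)) has_real_derivative e) (at x)"
      by blast
    then have "((\<lambda>x. complex_of_real (Re (\<phi> x)) + \<i> * complex_of_real (Im (\<phi> x)))
        has_vector_derivative complex_of_real d + \<i> * complex_of_real e) (at x)"
      by (intro has_vector_derivative_add has_vector_derivative_mult_right has_vector_derivative_of_real)
    moreover have "(\<lambda>x. complex_of_real (Re (\<phi> x)) + \<i> * complex_of_real (Im (\<phi> x))) = \<phi>"
      by (rule ext) (simp add: complex_eq_iff)
    ultimately have "(\<phi> has_vector_derivative complex_of_real d + \<i> * complex_of_real e) (at x)"
      by simp
    then show "\<exists>d. (\<phi> has_vector_derivative d) (at x)" by blast
  qed
qed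

section \<open>Non-tangential limits in a half-disc\<close>

text \<open>In both cases the imaginary part of \<open>w'\<close> has modulus at least
  \<open>Im z\<close>, so \<open>cmod z\<close> is at most \<open>M * cmod w'\<close>, and the
  triangle inequality controls \<open>w\<close>. Thus both factors \<open>w + z\<close> and
  \<open>w - z\<close> of a kernel are comparable to \<open>|w| + |z|\<close> for real
  \<open>w\<close>.\<close>

lemma norm_add_ge_in_cone:
  fixes z w :: complex
  assumes "0 < Im z" "cmod z < M * Im z" "0 \<le> Im w \<and> w' = w + z \<or> Im w = 0 \<and> w' = w - z" 
  shows "cmod w + cmod z \<le> (1 + 2 * M) * cmod w'"
proof -
  have M: "M > 0" using assms(1,2) by (smt (verit) norm_ge_zero zero_less_mult_pos2)
  have "Im z \<le> cmod w'" using assms(1,3) abs_Im_le_cmod[of w'] by auto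
  then have "cmod z \<le> M * cmod w'" using assms(2) M by (smt (verit) mult_left_mono)
  moreover have "cmod w \<le> cmod w' + cmod z"
    using assms(3) norm_triangle_ineq4[of w' z] norm_triangle_ineq[of w' z] by auto
  ultimately show ?thesis by (simp add: algebra_simps)
qed

text \<open>The value stays below \<open>pi\<close> whatever \<open>r\<close> and \<open>d\<close>
  are; this scale invariance keeps the contribution of the base in the next estimate proportional to
  \<epsilon>.\<close>

lemma integral_poisson:
  fixes r d :: real
  assumes "0 < r" "0 \<le> d"
  shows "((\<lambda>x. r / (x\<^sup>2 + r\<^sup>2)) has_integral (2 * arctan (d / r))) {-d..d}"
proof -
  have "((\<lambda>x. r / (x\<^sup>2 + r\<^sup>2)) has_integral (arctan (d / r) - arctan (- d / r))) {-d..d}"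
  proof (rule fundamental_theorem_of_calculus)
    show "- d \<le> d" using assms by simp
    fix x
    have "((\<lambda>x. arctan (x / r)) has_real_derivative (1 / r) * inverse (1 + (x / r)\<^sup>2)) (at x within {-d..d})"
      using assms by (auto intro!: derivative_eq_intros)
    moreover have "(1 / r) * inverse (1 + (x / r)\<^sup>2) = r / (x\<^sup>2 + r\<^sup>2)"
      using assms by (simp add: field_simps power2_eq_square)
    ultimately show "((\<lambda>x. arctan (x / r)) has_vector_derivative r / (x\<^sup>2 + r\<^sup>2)) (at x within {-d..d})"
      by (simp add: has_real_derivative_iff_has_vector_derivative)
  qed
  then show ?thesis by (simp add: arctan_minus)
qed

text \<open>Smallness on the real axis propagates into a cone, at the price of an error from the
  rest of the boundary that is quadratic in \<open>|z|\<close>. Cauchy's formula is applied on the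
  triangle with vertices \<open>-d\<close>, \<open>d\<close> and \<open>i d\<close>, whose sides are
  segments and whose winding number is known; only continuity is required up to the boundary. The
  base contributes the term with \<epsilon>, the two legs the term with \<open>L\<close>.\<close>

lemma half_disc_growth:
  fixes G :: "complex \<Rightarrow> complex"
  assumes R: "0 < d" and contG: "continuous_on {z. 0 \<le> Im z \<and> cmod z \<le> d} G"
    and der: "\<And>z. 0 < Im z \<Longrightarrow> cmod z < d \<Longrightarrow> G field_differentiable at z"
    and lip: "\<And>z. 0 \<le> Im z \<Longrightarrow> cmod z \<le> d \<Longrightarrow> cmod (G z) \<le> L * cmod z"
    and small: "\<And>x::real. \<bar>x\<bar> \<le> d \<Longrightarrow> cmod (G (of_real x)) \<le> \<epsilon> * \<bar>x\<bar>"
    and z: "0 < Im z" "cmod z < d / 4" "cmod z < M * Im z"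
  shows "cmod (G z) \<le> (2 * (1 + 2 * M) ^ 3 * \<epsilon> + 256 * cmod z * L / d) * cmod z"
proof -
  let ?a = "complex_of_real (- d)" and ?b = "complex_of_real d" and ?c = "\<i> * complex_of_real d"
  let ?S = "convex hull {?a, ?b, ?c}"
  let ?\<gamma> = "linepath ?a ?b +++ linepath ?b ?c +++ linepath ?c ?a"
  define K where "K = 1 + 2 * M"
  have M: "M > 0" using z by (smt (verit) norm_ge_zero zero_less_mult_pos2)
  then have K: "K > 0" by (simp add: K_def)
  have zn: "cmod z > 0" using z by auto
  have "d / 2 > 0" using R by simp
  have L: "L \<ge> 0" using lip[of "of_real d"] R by (simp add: zero_le_mult_iff) (smt (verit) norm_ge_zero zero_le_mult_iff)
  have eps: "\<epsilon> \<ge> 0" using small[of d] R by simp (smt (verit) norm_ge_zero zero_le_mult_iff)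
  have SI: "?S \<subseteq> {z. 0 \<le> Im z} \<inter> cball 0 d"
  proof (rule hull_minimal)
    show "{?a, ?b, ?c} \<subseteq> {z. 0 \<le> Im z} \<inter> cball 0 d" using R by (auto simp: norm_mult)
    show "convex ({z. 0 \<le> Im z} \<inter> cball 0 d)"
      by (intro convex_Int convex_cball) (simp add: convex_halfspace_Im_ge)
  qed
  have intS: "interior ?S \<subseteq> {z. 0 < Im z} \<inter> ball 0 d"
  proof -
    have "interior {z. 0 \<le> Im z} = {z. 0 < Im z}"
      using interior_halfspace_ge[of \<i> 0] by simp
    then show ?thesis using interior_mono[OF SI] by (simp add: interior_Int)
  qed
  have zint: "z \<in> interior ?S"
  proof (rule interiorI)
    \<comment> \<open>These three strict inequalities describe the open triangle; the coefficients
      below are the barycentric coordinates of \<open>w\<close>.\<close>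
    let ?U = "{w. 0 < Im w} \<inter> {w. Re w + Im w < d} \<inter> {w. Im w - Re w < d}"
    show "open ?U"
      by (intro open_Int open_Collect_less continuous_intros)
    show "z \<in> ?U" using z abs_Re_le_cmod[of z] abs_Im_le_cmod[of z] by auto
    show "?U \<subseteq> ?S"
    proof
      fix w assume w: "w \<in> ?U"
      have "w = ((1 - Re w / d - Im w / d) / 2) *\<^sub>R ?a + ((1 + Re w / d - Im w / d) / 2) *\<^sub>R ?b + (Im w / d) *\<^sub>R ?c"
        using R by (simp add: complex_eq_iff field_simps)
      moreover have "0 \<le> (1 - Re w / d - Im w / d) / 2" "0 \<le> (1 + Re w / d - Im w / d) / 2" "0 \<le> Im w / d"
      proof -
        have "0 \<le> (d - Re w - Im w) / d / 2" "0 \<le> (d + Re w - Im w) / d / 2"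
          using w R by auto
        then show "0 \<le> (1 - Re w / d - Im w / d) / 2" "0 \<le> (1 + Re w / d - Im w / d) / 2" "0 \<le> Im w / d"
          using R w by (auto simp: diff_divide_distrib add_divide_distrib)
      qed
      ultimately show "w \<in> ?S" unfolding convex_hull_3
        by (intro CollectI exI conjI) (assumption | simp add: field_simps)+
    qed
  qed
  text \<open>The factor \<open>(w + z)\<^sup>-\<^sup>2\<close>, whose pole lies outside the domain, improves the decay of the Cauchy kernel
    on the base to that of a Poisson kernel; with \<open>G(w) / (w - z)\<close> alone the bound would diverge
    logarithmically.\<close>
  define \<Phi> where "\<Phi> = (\<lambda>w. 2 * z * G w / (w + z)\<^sup>2)"
  have nz: "w + z \<noteq> 0" if "0 \<le> Im w" for w
    using that z by (metis add_pos_nonneg add.commute less_numeral_extra(3) plus_complex.simps(2) zero_complex.simps(2))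
  \<comment> \<open>Only the modulus is needed, so the orientation of the triangle need not be
    determined.\<close>
  have n1: "cmod (winding_number ?\<gamma> z) = 1"
    using winding_number_triangle[OF zint] by auto
  have seg: "path_image ?\<gamma> \<subseteq> ?S - {z}"
  proof -
    have ci: "z \<notin> closed_segment ?a ?b \<and> z \<notin> closed_segment ?b ?c \<and> z \<notin> closed_segment ?c ?a"
    proof -
      have "closed_segment ?a ?b \<subseteq> {w. Im w \<le> 0}" "closed_segment ?b ?c \<subseteq> {w. Re w + Im w = d}"
        "closed_segment ?c ?a \<subseteq> {w. Im w - Re w = d}"
        by (auto simp: closed_segment_def left_diff_distrib)
      then show ?thesis using z abs_Re_le_cmod[of z] abs_Im_le_cmod[of z] by fastforce
    qed
    moreover have "closed_segment ?a ?b \<subseteq> ?S" "closed_segment ?b ?c \<subseteq> ?S" "closed_segment ?c ?a \<subseteq> ?S"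
      by (intro closed_segment_subset hull_inc convex_convex_hull; simp)+
    moreover have "path_image ?\<gamma> = closed_segment ?a ?b \<union> (closed_segment ?b ?c \<union> closed_segment ?c ?a)"
      by (subst path_image_join; simp)+
    ultimately show ?thesis by blast
  qed
  have "continuous_on ?S G"
    using SI by (intro continuous_on_subset[OF contG]) auto
  then have cont\<Phi>: "continuous_on ?S \<Phi>"
    unfolding \<Phi>_def using SI nz by (auto intro!: continuous_intros)
  have CI: "((\<lambda>w. \<Phi> w / (w - z)) has_contour_integral (2 * pi * \<i> * winding_number ?\<gamma> z * \<Phi> z)) ?\<gamma>"
  proof (rule Cauchy_integral_formula_weak[where S = ?S and k = "{}"])
    show "continuous_on ?S \<Phi>" by fact
    show "\<Phi> field_differentiable at x" if "x \<in> interior ?S - {}" for x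
    proof -
      have "0 < Im x" "cmod x < d" using intS that by auto
      then show ?thesis
        unfolding \<Phi>_def using nz[of x] der[of x] by (auto intro!: derivative_intros)
    qed
  qed (use zint seg in auto)
  let ?f = "\<lambda>w. \<Phi> w / (w - z)"
  have cont_f: "continuous_on (closed_segment u v) ?f" if "closed_segment u v \<subseteq> path_image ?\<gamma>" for u v
  proof -
    have "closed_segment u v \<subseteq> ?S - {z}" using that seg by blast
    then show ?thesis
      using continuous_on_subset[OF cont\<Phi>] by (auto intro!: continuous_intros)
  qed
  have ints: "?f contour_integrable_on linepath ?a ?b" "?f contour_integrable_on linepath ?b ?c"
    "?f contour_integrable_on linepath ?c ?a"
    by (intro contour_integrable_continuous_linepath cont_f; auto simp: path_image_join)+
  have sum: "2 * pi * \<i> * winding_number ?\<gamma> z * \<Phi> z = contour_integral (linepath ?a ?b) ?f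
      + (contour_integral (linepath ?b ?c) ?f + contour_integral (linepath ?c ?a) ?f)"
    using contour_integral_unique[OF CI] ints by (simp add: contour_integrable_join)
  have base: "cmod (contour_integral (linepath ?a ?b) ?f) \<le> 2 * K ^ 3 * \<epsilon> * pi"
  proof -
    have I: "((\<lambda>x. ?f (of_real x)) has_integral contour_integral (linepath ?a ?b) ?f) {-d..d}"
      using has_contour_integral_integral[OF ints(1)] R
      by (subst (asm) has_contour_integral_linepath_Reals_iff) auto
    \<comment> \<open>With \<open>?s\<close> the sum of \<open>|x|\<close> and \<open>|z|\<close>,
      the numerator is at most \<open>2 * cmod z * \<epsilon> * ?s\<close> and each of the three
      factors of the denominator at least \<open>?s / K\<close>. What remains is
      \<open>cmod z / ?s\<^sup>2\<close>, which lies below the Poisson kernel.\<close>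
    have B: "cmod (?f (of_real x)) \<le> 2 * K ^ 3 * \<epsilon> * (cmod z / (x\<^sup>2 + (cmod z)\<^sup>2))" if x: "x \<in> {-d..d}" for x
    proof -
      let ?s = "\<bar>x\<bar> + cmod z"
      have s: "?s > 0" using zn by (intro add_nonneg_pos) auto
      have "\<epsilon> * \<bar>x\<bar> \<le> \<epsilon> * ?s" using eps by (intro mult_left_mono) auto
      then have Gs: "cmod (G (of_real x)) \<le> \<epsilon> * ?s" using small[of x] x by (simp add: abs_le_iff)
      have p1: "?s / K \<le> cmod (of_real x + z)" and p2: "?s / K \<le> cmod (of_real x - z)"
        using norm_add_ge_in_cone[OF z(1,3), of "of_real x" "of_real x + z"]
          norm_add_ge_in_cone[OF z(1,3), of "of_real x" "of_real x - z"] K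
        unfolding K_def by (auto simp: pos_divide_le_eq mult.commute)
      have "(?s / K)\<^sup>2 * (?s / K) \<le> (cmod (of_real x + z))\<^sup>2 * cmod (of_real x - z)"
        using p1 p2 s K by (intro mult_mono power_mono) auto
      then have p: "(?s / K) ^ 3 \<le> (cmod (of_real x + z))\<^sup>2 * cmod (of_real x - z)"
        by (simp add: power3_eq_cube power2_eq_square)
      have "cmod (?f (of_real x)) = 2 * cmod z * cmod (G (of_real x)) / ((cmod (of_real x + z))\<^sup>2 * cmod (of_real x - z))"
        by (simp add: \<Phi>_def norm_mult norm_divide norm_power)
      also have "\<dots> \<le> 2 * cmod z * (\<epsilon> * ?s) / (?s / K) ^ 3"
        using p s K Gs eps by (intro frac_le mult_left_mono mult_nonneg_nonneg zero_less_power divide_pos_pos) simp_all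
      also have "\<dots> = 2 * K ^ 3 * \<epsilon> * (cmod z / ?s\<^sup>2)"
      proof -
        have "2 * c * (\<epsilon> * s) / (s / K) ^ 3 = 2 * K ^ 3 * \<epsilon> * (c / s\<^sup>2)" if "s > 0" for s c :: real
          using that K by (simp add: field_simps power2_eq_square power3_eq_cube)
        from this[OF s] show ?thesis .
      qed
      also have "\<dots> \<le> 2 * K ^ 3 * \<epsilon> * (cmod z / (x\<^sup>2 + (cmod z)\<^sup>2))"
      proof (intro mult_left_mono divide_left_mono)
        have "?s\<^sup>2 = x\<^sup>2 + (cmod z)\<^sup>2 + 2 * (\<bar>x\<bar> * cmod z)" by (simp add: power2_sum)
        then show "x\<^sup>2 + (cmod z)\<^sup>2 \<le> ?s\<^sup>2" by simp
        show "0 < ?s\<^sup>2 * (x\<^sup>2 + (cmod z)\<^sup>2)" using s zn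
          by (intro mult_pos_pos add_nonneg_pos) auto
      qed (use eps K in auto)
      finally show ?thesis .
    qed
    have J: "((\<lambda>x. 2 * K ^ 3 * \<epsilon> * (cmod z / (x\<^sup>2 + (cmod z)\<^sup>2))) has_integral
        2 * K ^ 3 * \<epsilon> * (2 * arctan (d / cmod z))) {-d..d}"
      using zn R by (intro has_integral_mult_right integral_poisson) auto
    have "cmod (integral {-d..d} (\<lambda>x. ?f (of_real x))) \<le> integral {-d..d} (\<lambda>x. 2 * K ^ 3 * \<epsilon> * (cmod z / (x\<^sup>2 + (cmod z)\<^sup>2)))"
      using I J B by (intro Henstock_Kurzweil_Integration.integral_norm_bound_integral) (blast intro: has_integral_integrable)+
    then have "cmod (contour_integral (linepath ?a ?b) ?f) \<le> 2 * K ^ 3 * \<epsilon> * (2 * arctan (d / cmod z))"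
      using I J by (simp add: integral_unique)
    also have "\<dots> \<le> 2 * K ^ 3 * \<epsilon> * pi"
      using arctan_ubound[of "d / cmod z"] eps K by (intro mult_left_mono) auto
    finally show ?thesis .
  qed
  have leg: "cmod (contour_integral (linepath u v) ?f) \<le> 256 * cmod z * L / d"
    if uv: "closed_segment u v \<subseteq> path_image ?\<gamma>" "\<And>w. w \<in> closed_segment u v \<Longrightarrow> d \<le> \<bar>Re w\<bar> + \<bar>Im w\<bar>"
       "cmod (v - u) \<le> 2 * d" "?f contour_integrable_on linepath u v" for u v
  proof -
    \<comment> \<open>On the legs \<open>|w|\<close> is at least \<open>d / 2\<close>, while
      \<open>|z| < d / 4\<close>, so all three factors of the denominator are at least
      \<open>d / 4\<close>. This gives 2 times 64 here, and the length bound \<open>2 * d\<close> of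
      a leg doubles it to 256.\<close>
    have B: "cmod (?f w) \<le> 128 * cmod z * L / d\<^sup>2" if w: "w \<in> closed_segment u v" for w
    proof -
      have wd: "d / 2 \<le> cmod w" using uv(2)[OF w] abs_Re_le_cmod[of w] abs_Im_le_cmod[of w] by auto
      have "w \<in> {z. 0 \<le> Im z} \<inter> cball 0 d" using w uv(1) seg SI by blast
      then have wS: "0 \<le> Im w" "cmod w \<le> d" by auto
      have p1: "d / 4 \<le> cmod (w + z)" using wd z norm_diff_ineq[of w z] by auto
      have p2: "d / 4 \<le> cmod (w - z)" using wd z norm_triangle_ineq2[of w z] by auto
      have "cmod (?f w) = 2 * cmod z * cmod (G w) / ((cmod (w + z))\<^sup>2 * cmod (w - z))"
        by (simp add: \<Phi>_def norm_mult norm_divide norm_power)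
      also have "\<dots> \<le> 2 * cmod z * (L * d) / ((d/4)\<^sup>2 * (d/4))"
      proof (rule frac_le)
        have "L * cmod w \<le> L * d" using wS L by (intro mult_left_mono)
        then have "cmod (G w) \<le> L * d" using lip[OF wS] by simp
        then show "2 * cmod z * cmod (G w) \<le> 2 * cmod z * (L * d)" by (intro mult_left_mono) simp_all
        show "(d/4)\<^sup>2 * (d/4) \<le> (cmod (w + z))\<^sup>2 * cmod (w - z)"
          using p1 p2 R by (intro mult_mono power_mono) simp_all
      qed (use R L in simp_all)
      also have "\<dots> = 128 * cmod z * L / d\<^sup>2" using R by (simp add: field_simps power2_eq_square)
      finally show ?thesis .
    qed
    have "cmod (contour_integral (linepath u v) ?f) \<le> 128 * cmod z * L / d\<^sup>2 * cmod (v - u)"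
      using B L by (intro contour_integral_bound_linepath uv(4)) auto
    also have "\<dots> \<le> 128 * cmod z * L / d\<^sup>2 * (2 * d)"
      using uv(3) L by (intro mult_left_mono) auto
    also have "\<dots> = 256 * cmod z * L / d" using R by (simp add: field_simps power2_eq_square)
    finally show ?thesis .
  qed
  have legs: "cmod (contour_integral (linepath ?b ?c) ?f) \<le> 256 * cmod z * L / d"
    "cmod (contour_integral (linepath ?c ?a) ?f) \<le> 256 * cmod z * L / d"
  proof -
    have e: "cmod (?c - ?b) \<le> 2 * d" "cmod (?a - ?c) \<le> 2 * d"
      using norm_triangle_ineq4[of ?c ?b] norm_triangle_ineq4[of ?a ?c] R by (auto simp: norm_mult)
    have "closed_segment ?b ?c \<subseteq> {w. Re w + Im w = d}" "closed_segment ?c ?a \<subseteq> {w. Im w - Re w = d}"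
      by (auto simp: closed_segment_def left_diff_distrib)
    then show "cmod (contour_integral (linepath ?b ?c) ?f) \<le> 256 * cmod z * L / d"
      "cmod (contour_integral (linepath ?c ?a) ?f) \<le> 256 * cmod z * L / d"
      by (intro leg ints e; force simp: path_image_join)+
  qed
  have "2 * pi * (cmod (G z) / (2 * cmod z)) = cmod (2 * pi * \<i> * winding_number ?\<gamma> z * \<Phi> z)"
  proof -
    have "\<Phi> z = G z / (2 * z)" unfolding \<Phi>_def using zn by (simp add: field_simps power2_eq_square)
    then show ?thesis using n1 by (simp add: norm_mult norm_divide)
  qed
  also have "\<dots> \<le> 2 * K ^ 3 * \<epsilon> * pi + 2 * (256 * cmod z * L / d)"
    unfolding sum mult_2[of "256 * cmod z * L / d"]
    by (rule order_trans[OF norm_triangle_ineq add_mono[OF base order_trans[OF norm_triangle_ineq add_mono[OF legs]]]])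
  \<comment> \<open>The number 2 of legs is absorbed into \<open>pi\<close>, so that
    \<open>pi\<close> cancels from both sides.\<close>
  also have "\<dots> \<le> pi * (2 * K ^ 3 * \<epsilon> + 256 * cmod z * L / d)"
  proof -
    have "2 * (256 * cmod z * L / d) \<le> pi * (256 * cmod z * L / d)"
      using pi_ge_two L R by (intro mult_right_mono) auto
    then show ?thesis by (simp add: algebra_simps)
  qed
  finally have "pi * (cmod (G z) / cmod z) \<le> pi * (2 * K ^ 3 * \<epsilon> + 256 * cmod z * L / d)"
    by simp
  then have "cmod (G z) / cmod z \<le> 2 * K ^ 3 * \<epsilon> + 256 * cmod z * L / d"
    by (rule mult_left_le_imp_le) simp
  then show ?thesis using zn by (simp add: K_def field_simps)
qed

text \<open>Subtracting the linear function \<open>a * z\<close> reduces the claim to a primitive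
  \<open>G\<close> that is \<open>o(|x|)\<close> on the real axis. The growth lemma makes it
  \<open>o(|z|)\<close> in every cone, and Cauchy's inequality on a disc of radius comparable to
  \<open>|z|\<close> turns this into convergence of the derivative \<open>f - a\<close> to
  0.\<close>

lemma half_disc_fatou:
  fixes f F :: "complex \<Rightarrow> complex"
  assumes R: "0 < R" and contF: "continuous_on {z. 0 \<le> Im z \<and> cmod z \<le> R} F"
    and der: "\<And>z. 0 < Im z \<Longrightarrow> cmod z < R \<Longrightarrow> (F has_field_derivative f z) (at z)"
    and lip: "\<And>z. 0 \<le> Im z \<Longrightarrow> cmod z \<le> R \<Longrightarrow> cmod (F z - F 0) \<le> L * cmod z"
    and lim: "((\<lambda>x::real. (F (of_real x) - F 0) / of_real x) \<longlongrightarrow> a) (at 0)"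
  shows "(f \<longlongrightarrow> a) (at 0 within {z. 0 < Im z \<and> cmod z < M * Im z})"
proof -
  define G where "G = (\<lambda>z. F z - F 0 - a * z)"
  define L' where "L' = L + cmod a"
  have Glip: "cmod (G z) \<le> L' * cmod z" if "0 \<le> Im z" "cmod z \<le> R" for z
    using lip[OF that] norm_triangle_ineq4[of "F z - F 0" "a * z"]
    by (simp add: G_def L'_def norm_mult algebra_simps)
  have Gcont: "continuous_on {z. 0 \<le> Im z \<and> cmod z \<le> R} G"
    unfolding G_def by (intro continuous_intros contF)
  have Gder: "(G has_field_derivative (f z - a)) (at z)" if "0 < Im z" "cmod z < R" for z
    unfolding G_def using der[OF that] by (auto intro!: derivative_eq_intros)
  have growth: "\<exists>r>0. r \<le> R \<and> (\<forall>z. 0 < Im z \<longrightarrow> cmod z < r \<longrightarrow> cmod z < K * Im z \<longrightarrow> cmod (G z) \<le> \<epsilon> * cmod z)"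
    if K: "K > 0" and eps: "\<epsilon> > 0" for K \<epsilon>
  proof -
    \<comment> \<open>The choice makes the first term of the growth bound equal to
      \<open>\<epsilon> / 2\<close>; the radius \<open>r\<close> below is chosen so that the second
      term is at most \<open>\<epsilon> / 2\<close> too. The maximum with 1 in \<open>L2\<close>
      keeps the division in \<open>r\<close> meaningful.\<close>
    define \<eta> where "\<eta> = \<epsilon> / (4 * (1 + 2 * K) ^ 3)"
    have \<eta>: "\<eta> > 0" using K eps by (auto simp: \<eta>_def)
    obtain s where s: "s > 0" "\<And>x. x \<noteq> 0 \<Longrightarrow> \<bar>x\<bar> < s \<Longrightarrow> cmod ((F (of_real x) - F 0) / of_real x - a) < \<eta>"
      using LIM_D[OF lim \<eta>] by auto
    define d where "d = min (s / 2) R"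
    have d: "0 < d" "d \<le> R" "d < s" using s R by (auto simp: d_def)
    have small: "cmod (G (of_real x)) \<le> \<eta> * \<bar>x\<bar>" if "\<bar>x\<bar> \<le> d" for x
    proof (cases "x = 0")
      case False
      have "G (of_real x) = ((F (of_real x) - F 0) / of_real x - a) * of_real x"
        using False by (simp add: G_def field_simps)
      then have "cmod (G (of_real x)) = cmod ((F (of_real x) - F 0) / of_real x - a) * \<bar>x\<bar>"
        by (simp only: norm_mult norm_of_real)
      also have "\<dots> \<le> \<eta> * \<bar>x\<bar>"
        using s(2)[of x] False that d by (intro mult_right_mono) auto
      finally show ?thesis .
    qed (simp add: G_def)
    define L2 where "L2 = max L' 1"
    have L2: "L2 > 0" by (simp add: L2_def)
    define r where "r = min (d / 4) (\<epsilon> * d / (512 * L2))"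
    have r: "r > 0" "r \<le> d / 4" using d eps L2 by (auto simp: r_def)
    have "cmod (G z) \<le> \<epsilon> * cmod z" if z: "0 < Im z" "cmod z < r" "cmod z < K * Im z" for z
    proof -
      have "cmod (G z) \<le> (2 * (1 + 2 * K) ^ 3 * \<eta> + 256 * cmod z * L2 / d) * cmod z"
      proof (rule half_disc_growth[OF d(1)])
        show "continuous_on {z. 0 \<le> Im z \<and> cmod z \<le> d} G"
          using d by (intro continuous_on_subset[OF Gcont]) auto
        show "G field_differentiable at z" if "0 < Im z" "cmod z < d" for z
          using Gder[of z] that d by (auto simp: field_differentiable_def)
        show "cmod (G z) \<le> L2 * cmod z" if "0 \<le> Im z" "cmod z \<le> d" for z
        proof -
          have "L' * cmod z \<le> L2 * cmod z" by (intro mult_right_mono) (auto simp: L2_def)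
          then show ?thesis using Glip[of z] that d by auto
        qed
      qed (use small z r in auto)
      also have "\<dots> \<le> \<epsilon> * cmod z"
      proof (rule mult_right_mono)
        have "2 * (1 + 2 * K) ^ 3 * \<eta> = \<epsilon> / 2" using K by (simp add: \<eta>_def field_simps)
        moreover have "256 * cmod z * L2 / d \<le> \<epsilon> / 2"
        proof -
          have "cmod z \<le> \<epsilon> * d / (512 * L2)" using z(2) by (simp add: r_def)
          then have "cmod z * (512 * L2) \<le> \<epsilon> * d" using L2 by (simp add: field_simps)
          then show ?thesis using d by (simp add: field_simps)
        qed
        ultimately show "2 * (1 + 2 * K) ^ 3 * \<eta> + 256 * cmod z * L2 / d \<le> \<epsilon>" by simp
      qed simp
      finally show ?thesis .
    qed
    then show ?thesis using r d by (intro exI[of _ r]) auto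
  qed
  show ?thesis
  proof (cases "M > 0")
    case False
    have "\<not> (0 < Im z \<and> cmod z < M * Im z)" for z
      using False mult_nonpos_nonneg[of M "Im z"] norm_ge_zero[of z] by linarith
    then have "{z. 0 < Im z \<and> cmod z < M * Im z} = {}" by blast
    then show ?thesis by (simp only: at_within_empty tendsto_bot)
  next
    case M: True
    show ?thesis
    proof (rule tendstoI)
      fix e :: real assume e: "e > 0"
      \<comment> \<open>Cauchy's inequality will yield the bound \<open>3 * \<epsilon> * M\<close>,
        that is, three quarters of \<open>e\<close>.\<close>
      define \<epsilon> where "\<epsilon> = e / (4 * M)"
      have eps: "\<epsilon> > 0" using e M by (simp add: \<epsilon>_def)
      obtain r where r: "r > 0" "r \<le> R" "\<And>z. 0 < Im z \<Longrightarrow> cmod z < r \<Longrightarrow> cmod z < (3 * M) * Im z \<Longrightarrow> cmod (G z) \<le> \<epsilon> * cmod z"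
        using growth[of "3 * M" \<epsilon>] M eps by auto
      have "dist (f z) a < e" if z: "cmod z < M * Im z" "cmod z < r / 2" and Imz: "Im z > 0" for z
      proof -
        have Iz: "Im z \<le> cmod z" using abs_Im_le_cmod[of z] by simp
        define \<rho> where "\<rho> = Im z / 2"
        have \<rho>: "\<rho> > 0" using Imz by (simp add: \<rho>_def)
        \<comment> \<open>On the disc of radius \<open>Im z / 2\<close> the imaginary part is at
          least halved and the modulus grows by at most 3/2. Hence the disc around a point of the
          cone with constant \<open>M\<close> lies in the cone with constant \<open>3 * M\<close>,
          for which \<open>r\<close> was chosen.\<close>
        have ball: "Im z / 2 \<le> Im w" "cmod w \<le> 3 / 2 * cmod z" "cmod w < R" "0 < Im w" if "dist z w \<le> \<rho>" for w
        proof -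
          have "\<bar>Im (z - w)\<bar> \<le> \<rho>" using that abs_Im_le_cmod[of "z - w"] by (simp add: dist_norm)
          then show "Im z / 2 \<le> Im w" unfolding \<rho>_def minus_complex.sel by linarith
          then show "0 < Im w" using Imz by simp
          have "cmod w \<le> cmod z + \<rho>" using that norm_triangle_ineq2[of w z] by (simp add: dist_norm norm_minus_commute)
          then show "cmod w \<le> 3 / 2 * cmod z" using Iz by (simp add: \<rho>_def)
          then show "cmod w < R" using z r by simp
        qed
        have hol: "G holomorphic_on cball z \<rho>"
          unfolding holomorphic_on_def
        proof
          fix w assume "w \<in> cball z \<rho>"
          then show "G field_differentiable at w within cball z \<rho>"
            using Gder[of w] ball[of w] by (auto simp: field_differentiable_def intro: has_field_derivative_at_within)
        qed
        have "norm ((deriv ^^ 1) G z) \<le> fact 1 * (\<epsilon> * (3 / 2 * cmod z)) / \<rho> ^ 1"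
        proof (rule Cauchy_inequality)
          show "G holomorphic_on ball z \<rho>" using hol by (rule holomorphic_on_subset) auto
          show "continuous_on (cball z \<rho>) G" using hol by (rule holomorphic_on_imp_continuous_on)
          fix w assume "cmod (z - w) = \<rho>"
          then have w: "dist z w \<le> \<rho>" by (simp add: dist_norm)
          have "cmod w < 3 * M * Im w"
          proof -
            have "M * Im z \<le> M * (2 * Im w)" using ball(1)[OF w] M by (intro mult_left_mono) auto
            then show ?thesis using ball(2)[OF w] z(1) by simp
          qed
          moreover have "cmod w < r" using ball(2)[OF w] z(2) r(1) by simp
          ultimately have "cmod (G w) \<le> \<epsilon> * cmod w" using r(3)[of w] ball(4)[OF w] by blast
          also have "\<dots> \<le> \<epsilon> * (3 / 2 * cmod z)" using ball[OF w] eps by (intro mult_left_mono) auto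
          finally show "cmod (G w) \<le> \<epsilon> * (3 / 2 * cmod z)" .
        qed (use \<rho> in auto)
        also have "\<dots> = 3 * \<epsilon> * (cmod z / Im z)" by (simp add: \<rho>_def)
        also have "\<dots> \<le> 3 * \<epsilon> * M"
          using z(1) Imz eps by (intro mult_left_mono) (auto simp: field_simps)
        also have "\<dots> < e" using e M by (simp add: \<epsilon>_def)
        finally have "cmod (deriv G z) < e" by simp
        moreover have "deriv G z = f z - a"
          using Gder[of z] Imz z r by (intro DERIV_imp_deriv) (auto intro: Gder)
        ultimately show ?thesis by (simp add: dist_norm)
      qed
      then show "\<forall>\<^sub>F z in at 0 within {z. 0 < Im z \<and> cmod z < M * Im z}. dist (f z) a < e"
        unfolding eventually_at using r by (intro exI[of _ "r / 2"]) auto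
    qed
  qed
qed

section \<open>The sector and its approach regions\<close>

lemma Im_polar_cis: "Im (complex_of_real r * cis \<phi> * cis \<psi>) = r * sin (\<phi> + \<psi>)"
  by (simp add: mult.assoc cis_mult)

locale sector_angle =
  fixes \<alpha> :: real
  assumes \<alpha>_pos: "0 < \<alpha>" and \<alpha>_less: "\<alpha> < pi / 2"
begin

abbreviation "D \<equiv> sector \<alpha>"

lemma sin_cos_\<alpha>: "sin \<alpha> > 0" "cos \<alpha> > 0" "sin (2 * \<alpha>) > 0"
  using \<alpha>_pos \<alpha>_less by (auto intro: sin_gt_zero cos_gt_zero)

text \<open>Rotating by \<alpha> or its negative turns the line through one edge into the real axis.
  As the opening \<open>2 * \<alpha>\<close> is less than \<open>pi\<close>, the sector is the
  intersection of two half-planes, which gives openness, convexity and distance estimates without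
  \<open>Arg\<close>.\<close>

lemma in_sector_iff: "z \<in> D \<longleftrightarrow> Im (z * cis (- \<alpha>)) < 0 \<and> 0 < Im (z * cis \<alpha>)"
proof (cases "z = 0")
  case True
  then show ?thesis by (simp add: sector_def)
next
  case False
  define A where "A = Arg z"
  have z: "z = complex_of_real (cmod z) * cis A"
    using rcis_cmod_Arg[of z] by (simp add: rcis_def A_def)
  have A: "- pi < A" "A \<le> pi" using mpi_less_Arg[of z] Arg_le_pi[of z] by (auto simp: A_def)
  have I: "Im (z * cis (- \<alpha>)) = cmod z * sin (A - \<alpha>)" "Im (z * cis \<alpha>) = cmod z * sin (A + \<alpha>)"
    using Im_polar_cis[of "cmod z" A "- \<alpha>"] Im_polar_cis[of "cmod z" A "\<alpha>"] z by auto
  have "- \<alpha> < A \<and> A < \<alpha> \<longleftrightarrow> sin (A - \<alpha>) < 0 \<and> 0 < sin (A + \<alpha>)"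
  proof safe
    assume *: "- \<alpha> < A" "A < \<alpha>"
    have "0 < sin (\<alpha> - A)" using * \<alpha>_less by (intro sin_gt_zero) auto
    moreover have "sin (A - \<alpha>) = - sin (\<alpha> - A)" using sin_minus[of "\<alpha> - A"] by simp
    ultimately show "sin (A - \<alpha>) < 0" by simp
    show "0 < sin (A + \<alpha>)" using * \<alpha>_less by (intro sin_gt_zero) auto
  next
    assume *: "sin (A - \<alpha>) < 0" "0 < sin (A + \<alpha>)"
    show "A < \<alpha>"
    proof (rule ccontr)
      assume "\<not> A < \<alpha>"
      then have "0 \<le> sin (A - \<alpha>)" using A \<alpha>_pos by (intro sin_ge_zero) auto
      then show False using * by simp
    qed
    show "- \<alpha> < A"
    proof (rule ccontr)
      assume "\<not> - \<alpha> < A"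
      then have "0 \<le> sin (- (A + \<alpha>))" using A \<alpha>_pos by (intro sin_ge_zero) auto
      then show False using * sin_minus[of "A + \<alpha>"] by linarith
    qed
  qed
  then show ?thesis using False unfolding sector_def I
    by (simp add: mult_less_0_iff zero_less_mult_iff) (simp add: A_def)
qed

lemma polar_in_sector: "\<lbrakk>0 < s; \<bar>\<phi>\<bar> < \<alpha>\<rbrakk> \<Longrightarrow> of_real s * cis \<phi> \<in> D"
proof -
  assume *: "0 < s" "\<bar>\<phi>\<bar> < \<alpha>"
  have "0 < sin (\<alpha> - \<phi>)" "0 < sin (\<phi> + \<alpha>)" using * \<alpha>_less by (auto intro!: sin_gt_zero)
  moreover have "sin (\<phi> - \<alpha>) = - sin (\<alpha> - \<phi>)" using sin_minus[of "\<alpha> - \<phi>"] by simp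
  ultimately show ?thesis using * unfolding in_sector_iff Im_polar_cis by (simp add: mult_pos_neg)
qed

lemma sector_polarE:
  assumes "z \<in> D"
  obtains s \<phi> where "0 < s" "\<bar>\<phi>\<bar> < \<alpha>" "z = of_real s * cis \<phi>"
  using assms rcis_cmod_Arg[of z] by (intro that[of "cmod z" "Arg z"]) (auto simp: sector_def rcis_def)

lemma sector_eq_Int: "D = {z. Complex (- sin \<alpha>) (cos \<alpha>) \<bullet> z < 0} \<inter> {z. Complex (sin \<alpha>) (cos \<alpha>) \<bullet> z > 0}"
  by (auto simp: in_sector_iff inner_complex_def algebra_simps)

lemma open_sector: "open D" and convex_sector: "convex D"
  unfolding sector_eq_Int
  by (intro open_Int open_halfspace_lt open_halfspace_gt convex_Int convex_halfspace_lt convex_halfspace_gt)+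

text \<open>The cosine decreases on the interval from 0 to \<open>pi\<close>. This comparison
  converts a real exponential factor into decay in the modulus, uniformly over the sector.\<close>

lemma Re_sector:
  assumes "z \<in> D"
  shows "cmod z * cos \<alpha> \<le> Re z"
proof -
  obtain s \<phi> where *: "0 < s" "\<bar>\<phi>\<bar> < \<alpha>" "z = of_real s * cis \<phi>" using sector_polarE[OF assms] .
  have "cos \<alpha> \<le> cos \<bar>\<phi>\<bar>" using * \<alpha>_less by (intro cos_monotone_0_pi_le) auto
  then show ?thesis using * by (simp add: norm_mult)
qed

text \<open>The positive real direction points strictly into both half-planes, so a small positive
  shift moves a boundary point into the sector.\<close>

lemma in_closure_sector:
  assumes "Im (z * cis (- \<alpha>)) \<le> 0" "0 \<le> Im (z * cis \<alpha>)"
  shows "z \<in> closure D"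
  unfolding closure_sequential
proof (intro exI conjI allI)
  let ?x = "\<lambda>n. z + complex_of_real (inverse (real (Suc n)))"
  have *: "z + of_real t \<in> D" if "t > 0" for t
  proof -
    have "t * sin \<alpha> > 0" using sin_cos_\<alpha> that by simp
    then show ?thesis using assms unfolding in_sector_iff by (simp add: algebra_simps)
  qed
  show "?x n \<in> D" for n by (rule *) simp
  have "?x \<longlonglongrightarrow> z + complex_of_real 0"
    by (intro tendsto_intros LIMSEQ_inverse_real_of_nat)
  then show "?x \<longlonglongrightarrow> z" by simp
qed

text \<open>The sign \<sigma> selects the edge, 1 for the upper and -1 for the lower one, so that
  both are treated at once from here on.\<close>

lemma edge_Im:
  assumes "\<sigma> = 1 \<or> \<sigma> = -1"
  shows "Im (of_real s * cis (\<sigma> * \<alpha>) * cis (- \<alpha>)) = (if \<sigma> = 1 then 0 else - s * sin (2 * \<alpha>))"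
    "Im (of_real s * cis (\<sigma> * \<alpha>) * cis \<alpha>) = (if \<sigma> = 1 then s * sin (2 * \<alpha>) else 0)"
proof -
  have "- \<alpha> + - \<alpha> = - (2 * \<alpha>)" "\<alpha> + \<alpha> = 2 * \<alpha>" by auto
  then show "Im (of_real s * cis (\<sigma> * \<alpha>) * cis (- \<alpha>)) = (if \<sigma> = 1 then 0 else - s * sin (2 * \<alpha>))"
    "Im (of_real s * cis (\<sigma> * \<alpha>) * cis \<alpha>) = (if \<sigma> = 1 then s * sin (2 * \<alpha>) else 0)"
    using assms sin_minus[of "2 * \<alpha>"] unfolding Im_polar_cis by auto
qed

lemma edge_not_in_sector:
  assumes "\<sigma> = 1 \<or> \<sigma> = -1"
  shows "of_real s * cis (\<sigma> * \<alpha>) \<notin> D"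
  unfolding in_sector_iff edge_Im[OF assms] by auto

lemma edge_closure:
  assumes "\<sigma> = 1 \<or> \<sigma> = -1" "0 \<le> s"
  shows "of_real s * cis (\<sigma> * \<alpha>) \<in> closure D"
proof (rule in_closure_sector)
  have "0 \<le> s * sin (2 * \<alpha>)" using sin_cos_\<alpha> assms by simp
  then show "Im (of_real s * cis (\<sigma> * \<alpha>) * cis (- \<alpha>)) \<le> 0" "0 \<le> Im (of_real s * cis (\<sigma> * \<alpha>) * cis \<alpha>)"
    unfolding edge_Im[OF assms(1)] by auto
qed

lemma edge_frontier:
  assumes "\<sigma> = 1 \<or> \<sigma> = -1" "0 \<le> s"
  shows "of_real s * cis (\<sigma> * \<alpha>) \<in> frontier D"
  using edge_closure[OF assms] edge_not_in_sector[OF assms(1), of s] open_sector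
  by (auto simp: frontier_def interior_open)

text \<open>A frontier point fails one of the two strict half-plane conditions, so the segment from
  the given point to it meets the line through an edge. The distances to these two lines are
  \<open>s * sin (\<alpha> - \<phi>)\<close> and \<open>s * sin (\<alpha> + \<phi>)\<close>, and the
  claimed bound is the smaller one.\<close>

lemma infdist_frontier_ge:
  assumes s: "0 < s" and \<theta>: "0 \<le> \<theta>" "\<theta> < \<alpha>" and \<phi>: "\<phi> = \<theta> \<or> \<phi> = - \<theta>"
  shows "s * sin (\<alpha> - \<theta>) \<le> infdist (of_real s * cis \<phi>) (frontier D)"
proof -
  let ?z = "of_real s * cis \<phi>"
  have ne: "frontier D \<noteq> {}" using edge_frontier[of 1 1] by auto
  have "sin (\<alpha> - \<theta>) \<le> sin (\<alpha> + \<theta>)"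
    using \<theta> \<alpha>_less sin_cos_\<alpha> sin_ge_zero[of \<theta>] by (simp add: sin_add sin_diff)
  then have S: "sin (\<alpha> - \<theta>) \<le> sin (\<alpha> - \<phi>)" "sin (\<alpha> - \<theta>) \<le> sin (\<alpha> + \<phi>)" using \<phi> by auto
  show ?thesis unfolding infdist_notempty[OF ne]
  proof (rule cINF_greatest[OF ne])
    fix w assume "w \<in> frontier D"
    then have "w \<notin> D" using open_sector by (simp add: frontier_def interior_open)
    then have "Im (w * cis (- \<alpha>)) \<ge> 0 \<or> Im (w * cis \<alpha>) \<le> 0" by (auto simp: in_sector_iff)
    then show "s * sin (\<alpha> - \<theta>) \<le> dist ?z w"
    proof
      assume *: "Im (w * cis (- \<alpha>)) \<ge> 0"
      have "s * sin (\<alpha> - \<theta>) \<le> s * sin (\<alpha> - \<phi>)" using S s by simp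
      also have "\<dots> = - Im (?z * cis (- \<alpha>))"
        unfolding Im_polar_cis using sin_minus[of "\<alpha> - \<phi>"] by simp
      also have "\<dots> \<le> \<bar>Im ((?z - w) * cis (- \<alpha>))\<bar>" using * by (simp add: left_diff_distrib)
      also have "\<dots> \<le> cmod ((?z - w) * cis (- \<alpha>))" by (rule abs_Im_le_cmod)
      finally show ?thesis by (simp add: norm_mult dist_norm)
    next
      assume *: "Im (w * cis \<alpha>) \<le> 0"
      have "s * sin (\<alpha> - \<theta>) \<le> s * sin (\<alpha> + \<phi>)" using S s by simp
      also have "\<dots> = Im (?z * cis \<alpha>)"
        unfolding Im_polar_cis by (simp add: add.commute)
      also have "\<dots> \<le> \<bar>Im ((?z - w) * cis \<alpha>)\<bar>" using * by (simp add: left_diff_distrib)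
      also have "\<dots> \<le> cmod ((?z - w) * cis \<alpha>)" by (rule abs_Im_le_cmod)
      finally show ?thesis by (simp add: norm_mult dist_norm)
    qed
  qed
qed

text \<open>Moving along the arc \<open>|z| = s\<close> approaches the edge non-tangentially. With
  \<open>x\<close> the remaining angle, the squared chord is
  \<open>s\<^sup>2 * (2 - 2 * cos x)\<close> and the distance to the frontier at least
  \<open>s * sin x\<close>; aperture 2 suffices because \<open>(2 * sin x)\<^sup>2\<close> exceeds
  \<open>2 - 2 * cos x\<close> for \<open>0 < x < pi / 2\<close>.\<close>

lemma polar_in_approach_region:
  assumes "\<sigma> = 1 \<or> \<sigma> = -1" and s: "0 < s" and \<theta>: "0 \<le> \<theta>" "\<theta> < \<alpha>"
  shows "of_real s * cis (\<sigma> * \<theta>) \<in> approach_region D (of_real s * cis (\<sigma> * \<alpha>)) 2"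
proof -
  define x where "x = \<alpha> - \<theta>"
  have x: "0 < x" "x < pi / 2" using \<theta> \<alpha>_less by (auto simp: x_def)
  have c: "0 < cos x" "cos x < 1" "0 < sin x"
    using x cos_gt_zero[of x] cos_monotone_0_pi[of 0 x] sin_gt_zero[of x] by auto
  have "(cmod (cis (\<sigma> * \<theta>) - cis (\<sigma> * \<alpha>)))\<^sup>2 = 2 - 2 * cos x"
  proof -
    have "(cmod (cis (\<sigma> * \<theta>) - cis (\<sigma> * \<alpha>)))\<^sup>2
      = (cos (\<sigma> * \<theta>) - cos (\<sigma> * \<alpha>))\<^sup>2 + (sin (\<sigma> * \<theta>) - sin (\<sigma> * \<alpha>))\<^sup>2"
      by (simp add: cmod_power2)
    also have "\<dots> = 2 - 2 * (cos (\<sigma> * \<alpha>) * cos (\<sigma> * \<theta>) + sin (\<sigma> * \<alpha>) * sin (\<sigma> * \<theta>))"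
      using sin_cos_squared_add[of "\<sigma> * \<alpha>"] sin_cos_squared_add[of "\<sigma> * \<theta>"]
      by (simp add: power2_eq_square algebra_simps)
    also have "\<dots> = 2 - 2 * cos (\<sigma> * \<alpha> - \<sigma> * \<theta>)" by (simp add: cos_diff)
    also have "cos (\<sigma> * \<alpha> - \<sigma> * \<theta>) = cos x"
      using assms(1) cos_minus[of x] by (auto simp: x_def)
    finally show ?thesis .
  qed
  also have "\<dots> < (2 * sin x)\<^sup>2"
  proof -
    have "(2 * sin x)\<^sup>2 - (2 - 2 * cos x) = 2 * (1 - cos x) * (1 + 2 * cos x)"
    proof -
      have "(2 * sin x)\<^sup>2 = 4 * (1 - (cos x)\<^sup>2)" by (simp add: power_mult_distrib sin_squared_eq)
      then show ?thesis by (simp add: power2_eq_square algebra_simps)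
    qed
    also have "\<dots> > 0" using c by (intro mult_pos_pos) auto
    finally show ?thesis by simp
  qed
  finally have "cmod (cis (\<sigma> * \<theta>) - cis (\<sigma> * \<alpha>)) < 2 * sin x"
    by (rule power_less_imp_less_base) (use c in simp)
  then have "s * cmod (cis (\<sigma> * \<theta>) - cis (\<sigma> * \<alpha>)) < 2 * (s * sin x)" using s by simp
  moreover have "dist (of_real s * cis (\<sigma> * \<theta>)) (of_real s * cis (\<sigma> * \<alpha>)) = s * cmod (cis (\<sigma> * \<theta>) - cis (\<sigma> * \<alpha>))"
    using s by (simp add: dist_norm right_diff_distrib[symmetric] norm_mult)
  moreover have "s * sin x \<le> infdist (of_real s * cis (\<sigma> * \<theta>)) (frontier D)"
    unfolding x_def using assms by (intro infdist_frontier_ge) auto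
  moreover have "of_real s * cis (\<sigma> * \<theta>) \<in> D"
    using assms by (intro polar_in_sector) auto
  ultimately show ?thesis unfolding approach_region_def by auto
qed

section \<open>Boundary values as limits along arcs\<close>

definition angle_seq :: "nat \<Rightarrow> real" where
  "angle_seq n = \<alpha> * (1 - inverse (real (Suc (Suc n))))"

text \<open>The two successors in the definition make already the angle with index 0 positive. A
  sequence is used because dominated convergence and measurability of limits are statements about
  sequences.\<close>

lemma angle_seq: "0 < angle_seq n" "angle_seq n < \<alpha>"
proof -
  have "inverse (real (Suc (Suc n))) < 1" "0 < inverse (real (Suc (Suc n)))"
    by (auto simp: inverse_less_1_iff)
  then show "0 < angle_seq n" "angle_seq n < \<alpha>"
    using \<alpha>_pos mult_strict_left_mono[of "1 - inverse (real (Suc (Suc n)))" 1 \<alpha>]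
    unfolding angle_seq_def by (auto intro!: mult_pos_pos)
qed

lemma angle_seq_tendsto: "angle_seq \<longlonglongrightarrow> \<alpha>"
proof -
  have "(\<lambda>n. inverse (real (Suc (Suc n)))) \<longlonglongrightarrow> 0"
    using LIMSEQ_Suc[OF LIMSEQ_inverse_real_of_nat] .
  then have "(\<lambda>n. \<alpha> * (1 - inverse (real (Suc (Suc n))))) \<longlonglongrightarrow> \<alpha> * (1 - 0)"
    by (intro tendsto_intros)
  then show ?thesis unfolding angle_seq_def[abs_def] by simp
qed

lemma cis_angle_seq_tendsto: "(\<lambda>n. of_real s * cis (\<sigma> * angle_seq n)) \<longlonglongrightarrow> of_real s * cis (\<sigma> * \<alpha>)"
proof -
  have "isCont (\<lambda>t. of_real s * cis (\<sigma> * t)) \<alpha>" by (simp add: cis_conv_exp)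
  from isCont_tendsto_compose[OF this angle_seq_tendsto] show ?thesis .
qed

lemma filterlim_angle_seq:
  assumes "\<sigma> = 1 \<or> \<sigma> = -1" "0 < s"
  shows "filterlim (\<lambda>n. of_real s * cis (\<sigma> * angle_seq n))
    (at (of_real s * cis (\<sigma> * \<alpha>)) within approach_region D (of_real s * cis (\<sigma> * \<alpha>)) 2) sequentially"
  unfolding filterlim_at
proof (intro conjI always_eventually allI)
  fix n
  have *: "0 \<le> angle_seq n" "angle_seq n < \<alpha>" using angle_seq[of n] by auto
  from polar_in_approach_region[OF assms *]
  show "of_real s * cis (\<sigma> * angle_seq n) \<in> approach_region D (of_real s * cis (\<sigma> * \<alpha>)) 2" .
  have "of_real s * cis (\<sigma> * angle_seq n) \<in> D" 
    using assms * by (intro polar_in_sector) auto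
  moreover have "of_real s * cis (\<sigma> * \<alpha>) \<notin> D"
    by (rule edge_not_in_sector[OF assms(1)])
  ultimately show "of_real s * cis (\<sigma> * angle_seq n) \<noteq> of_real s * cis (\<sigma> * \<alpha>)" by metis
qed (rule cis_angle_seq_tendsto)

lemma boundary_ext_interior: "z \<in> D \<Longrightarrow> boundary_ext D f z = f z"
  by (simp add: boundary_ext_def)

lemma nontangential_limit_seq:
  assumes "\<sigma> = 1 \<or> \<sigma> = -1" "0 < s" "has_nontangential_limit D f (of_real s * cis (\<sigma> * \<alpha>)) l"
  shows "(\<lambda>n. f (of_real s * cis (\<sigma> * angle_seq n))) \<longlonglongrightarrow> l"
  using assms(3) filterlim_compose[OF _ filterlim_angle_seq[OF assms(1,2)]]
  unfolding has_nontangential_limit_def by blast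

text \<open>The description by \<open>THE\<close> is legitimate because the approach region of
  aperture 2 accumulates at the edge point: the sequence along the arc determines the limit.\<close>

lemma boundary_ext_eq:
  assumes "\<sigma> = 1 \<or> \<sigma> = -1" "0 < s" "has_nontangential_limit D f (of_real s * cis (\<sigma> * \<alpha>)) l"
  shows "boundary_ext D f (of_real s * cis (\<sigma> * \<alpha>)) = l"
proof -
  have "(THE l. has_nontangential_limit D f (of_real s * cis (\<sigma> * \<alpha>)) l) = l"
    using assms LIMSEQ_unique[OF nontangential_limit_seq[OF assms(1,2), of f] nontangential_limit_seq[OF assms(1,2), of f]]
    by (intro the_equality) auto
  moreover have "of_real s * cis (\<sigma> * \<alpha>) \<in> frontier D" "of_real s * cis (\<sigma> * \<alpha>) \<notin> D"
    using edge_frontier[of \<sigma> s] edge_not_in_sector[of \<sigma> s] assms by auto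
  ultimately show ?thesis using assms(3) unfolding boundary_ext_def by auto
qed

lemma boundary_ext_cases:
  assumes "\<sigma> = 1 \<or> \<sigma> = -1" "0 < s"
  shows "boundary_ext D f (of_real s * cis (\<sigma> * \<alpha>)) = 0
    \<or> (\<lambda>n. f (of_real s * cis (\<sigma> * angle_seq n))) \<longlonglongrightarrow> boundary_ext D f (of_real s * cis (\<sigma> * \<alpha>))"
proof (cases "\<exists>l. has_nontangential_limit D f (of_real s * cis (\<sigma> * \<alpha>)) l")
  case True
  then show ?thesis using boundary_ext_eq[OF assms] nontangential_limit_seq[OF assms] by metis
next
  case False
  moreover have "of_real s * cis (\<sigma> * \<alpha>) \<notin> D"
    by (rule edge_not_in_sector[OF assms(1)])
  ultimately show ?thesis by (auto simp: boundary_ext_def)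
qed

text \<open>The right-hand side is constant on the arc of radius \<open>s\<close>, so the bound
  passes to the limit on an edge. Where no limit exists the value is 0, which satisfies it because
  \<open>C\<close> is nonnegative.\<close>

lemma boundary_ext_bound:
  assumes "\<And>z. z \<in> D \<Longrightarrow> cmod (f z) \<le> C * exp (k * cmod z)" "0 \<le> C" "0 < s" "\<bar>\<theta>\<bar> \<le> \<alpha>"
  shows "cmod (boundary_ext D f (of_real s * cis \<theta>)) \<le> C * exp (k * s)"
proof (cases "\<bar>\<theta>\<bar> < \<alpha>")
  case True
  then show ?thesis using assms(1)[of "of_real s * cis \<theta>"] polar_in_sector[of s \<theta>] assms
    by (simp add: boundary_ext_interior norm_mult)
next
  case False
  then have "\<theta> = \<alpha> \<or> \<theta> = - \<alpha>" using assms(4) by linarith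
  then obtain \<sigma> :: real where \<sigma>: "\<sigma> = 1 \<or> \<sigma> = -1" "\<theta> = \<sigma> * \<alpha>"
    using that[of 1] that[of "-1"] by auto
  from boundary_ext_cases[OF \<sigma>(1) assms(3), of f] show ?thesis
  proof
    assume *: "(\<lambda>n. f (of_real s * cis (\<sigma> * angle_seq n))) \<longlonglongrightarrow> boundary_ext D f (of_real s * cis (\<sigma> * \<alpha>))"
    have "cmod (f (of_real s * cis (\<sigma> * angle_seq n))) \<le> C * exp (k * s)" for n
      using assms(1)[of "of_real s * cis (\<sigma> * angle_seq n)"] polar_in_sector[of s "\<sigma> * angle_seq n"]
        \<sigma> angle_seq[of n] assms(3) by (auto simp: norm_mult)
    then show ?thesis unfolding \<sigma>(2)
      by (intro tendsto_upperbound[OF tendsto_norm[OF *]]) auto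
  qed (use assms \<sigma> in auto)
qed

end

section \<open>Fatou's theorem in a sector\<close>

lemma has_vector_derivative_quotient:
  assumes "(f has_vector_derivative d) (at s)"
  shows "((\<lambda>h. (f (s + h) - f s) /\<^sub>R h) \<longlongrightarrow> d) (at 0)"
proof -
  have "((\<lambda>h. norm (f (s + h) - f s - h *\<^sub>R d) / norm h) \<longlongrightarrow> 0) (at 0)"
    using assms by (simp add: has_vector_derivative_def has_derivative_at)
  moreover have "\<forall>\<^sub>F h in at 0. norm (f (s + h) - f s - h *\<^sub>R d) / norm h = norm ((f (s + h) - f s) /\<^sub>R h - d)"
    unfolding eventually_at_filter
  proof (intro always_eventually allI impI)
    fix h :: real assume "h \<noteq> 0"
    then have "(f (s + h) - f s) /\<^sub>R h - d = (f (s + h) - f s - h *\<^sub>R d) /\<^sub>R h"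
      by (simp add: scaleR_diff_right)
    then show "norm (f (s + h) - f s - h *\<^sub>R d) / norm h = norm ((f (s + h) - f s) /\<^sub>R h - d)"
      by (simp add: divide_inverse mult.commute)
  qed
  ultimately have "((\<lambda>h. norm ((f (s + h) - f s) /\<^sub>R h - d)) \<longlongrightarrow> 0) (at 0)"
    by (rule Lim_transform_eventually)
  then show ?thesis by (simp add: tendsto_norm_zero_iff LIM_zero_iff)
qed

context sector_angle
begin

text \<open>The chart \<open>z\<close> maps the real axis to the line through the edge, 0 to the
  edge point, and the upper half-plane to the side of the sector. The number
  \<open>s * sin (2 * \<alpha>)\<close> is the distance of the edge point from the line through the
  other edge, so within this radius the other half-plane condition holds automatically.\<close>

lemma edge_chart_Im:
  fixes s :: real
  assumes \<sigma>: "\<sigma> = 1 \<or> \<sigma> = -1"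
  defines "z \<equiv> \<lambda>w. of_real s * cis (\<sigma> * \<alpha>) + of_real (- \<sigma>) * cis (\<sigma> * \<alpha>) * w"
  shows "\<sigma> = 1 \<Longrightarrow> Im (z w * cis (- \<alpha>)) = - Im w" "\<sigma> = -1 \<Longrightarrow> Im (z w * cis \<alpha>) = Im w"
    and "\<sigma> = 1 \<Longrightarrow> cmod w < s * sin (2 * \<alpha>) \<Longrightarrow> 0 < Im (z w * cis \<alpha>)"
    and "\<sigma> = -1 \<Longrightarrow> cmod w < s * sin (2 * \<alpha>) \<Longrightarrow> Im (z w * cis (- \<alpha>)) < 0"
proof -
  have e: "Im (z w * cis \<phi>) = Im (of_real s * cis (\<sigma> * \<alpha>) * cis \<phi>) + Im (of_real (- \<sigma>) * (cis (\<sigma> * \<alpha>) * cis \<phi>) * w)" for \<phi>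
    unfolding z_def plus_complex.sel(2)[symmetric] by (simp only: algebra_simps)
  have b: "\<bar>Im (of_real (- \<sigma>) * (cis (\<sigma> * \<alpha>) * cis \<phi>) * w)\<bar> \<le> cmod w" for \<phi>
    using abs_Im_le_cmod[of "of_real (- \<sigma>) * (cis (\<sigma> * \<alpha>) * cis \<phi>) * w"] \<sigma> by (auto simp: norm_mult)
  show "Im (z w * cis (- \<alpha>)) = - Im w" if "\<sigma> = 1"
    unfolding e edge_Im[OF \<sigma>] unfolding cis_mult using that by simp
  show "Im (z w * cis \<alpha>) = Im w" if "\<sigma> = -1"
    unfolding e edge_Im[OF \<sigma>] unfolding cis_mult using that by simp
  show "0 < Im (z w * cis \<alpha>)" if "\<sigma> = 1" "cmod w < s * sin (2 * \<alpha>)"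
    unfolding e edge_Im[OF \<sigma>] unfolding if_P[OF that(1)] using b[of \<alpha>] that by linarith
  show "Im (z w * cis (- \<alpha>)) < 0" if "\<sigma> = -1" "cmod w < s * sin (2 * \<alpha>)"
    unfolding e edge_Im[OF \<sigma>] using b[of "- \<alpha>"] that by (subst if_not_P) (simp, linarith)
qed

lemma edge_chart:
  assumes \<sigma>: "\<sigma> = 1 \<or> \<sigma> = -1" and w: "cmod w < s * sin (2 * \<alpha>)"
  defines "z \<equiv> of_real s * cis (\<sigma> * \<alpha>) + of_real (- \<sigma>) * cis (\<sigma> * \<alpha>) * w"
  shows "0 < Im w \<Longrightarrow> z \<in> D" "0 \<le> Im w \<Longrightarrow> z \<in> closure D"
proof -
  have I: "Im (z * cis (- \<alpha>)) = - Im w \<and> 0 < Im (z * cis \<alpha>) \<or> Im (z * cis (- \<alpha>)) < 0 \<and> Im (z * cis \<alpha>) = Im w"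
    using \<sigma> edge_chart_Im[OF \<sigma>, where s = s and w = w] w unfolding z_def by blast
  show "z \<in> D" if "0 < Im w" using I that unfolding in_sector_iff by auto
  show "z \<in> closure D" if "0 \<le> Im w" using I that by (intro in_closure_sector) auto
qed

text \<open>The foot of the perpendicular from the point to the edge has parameter
  \<open>s - \<sigma> * Re w\<close>, positive since \<open>cmod w < s\<close>, hence belongs to the
  frontier. The distance to the frontier is therefore at most \<open>|Im w|\<close>, and the
  approach region becomes a cone in the chart.\<close>

lemma approach_region_cone:
  assumes \<sigma>: "\<sigma> = 1 \<or> \<sigma> = -1" and s: "0 < s" and w: "cmod w < s"
    and z: "of_real s * cis (\<sigma> * \<alpha>) + of_real (- \<sigma>) * cis (\<sigma> * \<alpha>) * w
      \<in> approach_region D (of_real s * cis (\<sigma> * \<alpha>)) M"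
  shows "0 < Im w \<and> cmod w < M * Im w"
proof -
  let ?z = "of_real s * cis (\<sigma> * \<alpha>) + of_real (- \<sigma>) * cis (\<sigma> * \<alpha>) * w"
  let ?y = "of_real (s - \<sigma> * Re w) * cis (\<sigma> * \<alpha>)"
  have ns: "cmod (of_real \<sigma>) = 1" using \<sigma> by auto
  have zD: "?z \<in> D" and d: "cmod w < M * infdist ?z (frontier D)"
    using z \<sigma> by (auto simp: approach_region_def dist_norm norm_mult)
  have "\<bar>\<sigma> * Re w\<bar> < s" using \<sigma> w abs_Re_le_cmod[of w] by auto
  then have "?y \<in> frontier D" using \<sigma> by (intro edge_frontier) auto
  then have "infdist ?z (frontier D) \<le> dist ?z ?y" by (rule infdist_le)
  also have "?z - ?y = of_real (- \<sigma>) * cis (\<sigma> * \<alpha>) * (w - of_real (Re w))"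
    by (simp add: algebra_simps)
  then have "dist ?z ?y = cmod (w - of_real (Re w))"
    using ns by (simp add: dist_norm norm_mult)
  also have "w - of_real (Re w) = \<i> * of_real (Im w)" by (simp add: complex_eq_iff)
  finally have i: "infdist ?z (frontier D) \<le> \<bar>Im w\<bar>" by (simp add: norm_mult)
  have M: "M > 0"
  proof (rule ccontr)
    assume "\<not> M > 0"
    then have "M * infdist ?z (frontier D) \<le> 0" by (intro mult_nonpos_nonneg infdist_nonneg) simp
    then show False using d norm_ge_zero[of w] by linarith
  qed
  have "Im w > 0"
    using \<sigma>
  proof
    assume "\<sigma> = 1"
    from edge_chart_Im(1)[OF \<sigma> this, where s = s and w = w] zD show ?thesis
      unfolding in_sector_iff by linarith
  next
    assume "\<sigma> = -1"
    from edge_chart_Im(2)[OF \<sigma> this, where s = s and w = w] zD show ?thesis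
      unfolding in_sector_iff by linarith
  qed
  moreover have "M * infdist ?z (frontier D) \<le> M * \<bar>Im w\<bar>" using i M by (intro mult_left_mono) auto
  ultimately show ?thesis using d by simp
qed

text \<open>The half-disc result is transported by the chart at the edge point, whose derivative is
  the unit number \<open>e\<close>.\<close>

lemma fatou_edge_point:
  assumes \<sigma>: "\<sigma> = 1 \<or> \<sigma> = -1" and s: "0 < s" and B: "0 \<le> B"
    and F: "\<And>z. z \<in> D \<Longrightarrow> (F has_field_derivative f z) (at z)" and lip: "B-lipschitz_on (closure D) F"
    and der: "((\<lambda>x. F (of_real (max x 0) * cis (\<sigma> * \<alpha>))) has_vector_derivative d) (at s)"
  shows "\<exists>l. has_nontangential_limit D f (of_real s * cis (\<sigma> * \<alpha>)) l"
proof -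
  define \<zeta> where "\<zeta> = of_real s * cis (\<sigma> * \<alpha>)"
  define e where "e = of_real (- \<sigma>) * cis (\<sigma> * \<alpha>)"
  have e1: "cmod e = 1" using \<sigma> by (auto simp: e_def norm_mult)
  then have e0: "e \<noteq> 0" by auto
  have ss: "\<sigma> * \<sigma> = 1" using \<sigma> by auto
  define R where "R = min (s * sin (2 * \<alpha>)) s / 2"
  have R: "0 < R" "R < s * sin (2 * \<alpha>)" "R < s"
  proof -
    have "0 < s * sin (2 * \<alpha>)" using s sin_cos_\<alpha> by simp
    moreover have "0 < min T s / 2 \<and> min T s / 2 < T \<and> min T s / 2 < s" if "0 < T" for T
      using that s by (auto simp: min_def)
    ultimately show "0 < R" "R < s * sin (2 * \<alpha>)" "R < s" unfolding R_def by blast+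
  qed
  define G where "G = (\<lambda>w. F (\<zeta> + e * w))"
  have chart: "0 \<le> Im w \<Longrightarrow> cmod w \<le> R \<Longrightarrow> \<zeta> + e * w \<in> closure D"
    "0 < Im w \<Longrightarrow> cmod w \<le> R \<Longrightarrow> \<zeta> + e * w \<in> D" for w
    using edge_chart[OF \<sigma>, of w s] R by (auto simp: \<zeta>_def e_def)
  have lim: "((\<lambda>w. e * f (\<zeta> + e * w)) \<longlongrightarrow> of_real (- \<sigma>) * d) (at 0 within {w. 0 < Im w \<and> cmod w < M * Im w})" for M
  proof (rule half_disc_fatou[OF R(1)])
    show "continuous_on {z. 0 \<le> Im z \<and> cmod z \<le> R} G"
      unfolding G_def using chart
      by (intro continuous_on_compose2[OF lipschitz_on_continuous_on[OF lip]] continuous_intros) auto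
    show "(G has_field_derivative e * f (\<zeta> + e * w)) (at w)" if "0 < Im w" "cmod w < R" for w
    proof -
      have "((\<lambda>w. \<zeta> + e * w) has_field_derivative e) (at w)" by (auto intro!: derivative_eq_intros)
      from DERIV_chain2[OF F[OF chart(2)[of w]] this] that
      show ?thesis unfolding G_def by (simp add: mult.commute)
    qed
    show "cmod (G w - G 0) \<le> B * cmod w" if "0 \<le> Im w" "cmod w \<le> R" for w
      using lipschitz_onD[OF lip chart(1)[OF that] chart(1)[of 0]] R e1
      by (simp add: G_def dist_norm norm_mult)
    have "((\<lambda>h. (F (of_real (max (s + h) 0) * cis (\<sigma> * \<alpha>)) - F \<zeta>) /\<^sub>R h) \<longlongrightarrow> d) (at 0)"
      using has_vector_derivative_quotient[OF der] s by (simp add: \<zeta>_def)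
    \<comment> \<open>The chart runs along the edge with velocity \<open>- \<sigma>\<close>; the
      substitution of \<open>- \<sigma> * x\<close> for the increment turns the derivative
      \<open>d\<close> along the edge into the derivative \<open>- \<sigma> * d\<close> of
      \<open>G\<close> along the real axis.\<close>
    then have "((\<lambda>x. (F (of_real (max (s + - \<sigma> * x) 0) * cis (\<sigma> * \<alpha>)) - F \<zeta>) /\<^sub>R (- \<sigma> * x)) \<longlongrightarrow> d) (at 0)"
    proof (rule filterlim_compose)
      show "filterlim (\<lambda>x. - \<sigma> * x) (at 0) (at 0)"
        unfolding filterlim_at using \<sigma>
        by (auto intro!: tendsto_eq_intros simp: eventually_at_filter)
    qed
    then have "((\<lambda>x. of_real (- \<sigma>) * ((F (of_real (max (s + - \<sigma> * x) 0) * cis (\<sigma> * \<alpha>)) - F \<zeta>) /\<^sub>R (- \<sigma> * x))) \<longlongrightarrow> of_real (- \<sigma>) * d) (at 0)"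
      by (intro tendsto_intros)
    moreover have "\<forall>\<^sub>F x in at 0. of_real (- \<sigma>) * ((F (of_real (max (s + - \<sigma> * x) 0) * cis (\<sigma> * \<alpha>)) - F \<zeta>) /\<^sub>R (- \<sigma> * x))
        = (G (of_real x) - G 0) / of_real x"
      unfolding eventually_at
    proof (intro exI[of _ s] conjI ballI impI s)
      fix x :: real assume x: "x \<noteq> 0 \<and> dist x 0 < s"
      have "\<bar>- \<sigma> * x\<bar> < s" using \<sigma> x by (auto simp: dist_real_def)
      then have m: "max (s + - \<sigma> * x) 0 = s + - \<sigma> * x" by auto
      have arg: "\<zeta> + e * of_real x = of_real (s + - \<sigma> * x) * cis (\<sigma> * \<alpha>)"
        by (simp add: \<zeta>_def e_def algebra_simps)
      show "of_real (- \<sigma>) * ((F (of_real (max (s + - \<sigma> * x) 0) * cis (\<sigma> * \<alpha>)) - F \<zeta>) /\<^sub>R (- \<sigma> * x))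
        = (G (of_real x) - G 0) / of_real x"
        unfolding m G_def arg using x \<sigma> by (auto simp: scaleR_conv_of_real field_simps)
    qed
    ultimately show "((\<lambda>x. (G (of_real x) - G 0) / of_real x) \<longlongrightarrow> of_real (- \<sigma>) * d) (at 0)"
      by (rule Lim_transform_eventually)
  qed
  \<comment> \<open>Division by \<open>e\<close> removes the chain rule factor. The limit equals
    \<open>d / cis (\<sigma> * \<alpha>)\<close>, as expected for a complex derivative computed
    along the edge.\<close>
  have "has_nontangential_limit D f \<zeta> (of_real (- \<sigma>) * d / e)"
    unfolding has_nontangential_limit_def
  proof
    fix M
    have fl: "filterlim (\<lambda>z. (z - \<zeta>) / e) (at 0 within {w. 0 < Im w \<and> cmod w < M * Im w}) (at \<zeta> within approach_region D \<zeta> M)"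
      unfolding filterlim_at
    proof
      show "\<forall>\<^sub>F z in at \<zeta> within approach_region D \<zeta> M. (z - \<zeta>) / e \<in> {w. 0 < Im w \<and> cmod w < M * Im w} \<and> (z - \<zeta>) / e \<noteq> 0"
        unfolding eventually_at
      proof (intro exI[of _ s] conjI ballI impI s)
        fix z assume z: "z \<in> approach_region D \<zeta> M" "z \<noteq> \<zeta> \<and> dist z \<zeta> < s"
        define w where "w = (z - \<zeta>) / e"
        have zw: "z = \<zeta> + e * w" using e0 by (simp add: w_def)
        have "cmod w < s" using z e1 by (simp add: w_def norm_divide dist_norm)
        then have "0 < Im w \<and> cmod w < M * Im w"
          using approach_region_cone[OF \<sigma> s, of w M] z zw by (simp add: \<zeta>_def e_def)
        then show "(z - \<zeta>) / e \<in> {w. 0 < Im w \<and> cmod w < M * Im w}" by (simp add: w_def)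
        show "(z - \<zeta>) / e \<noteq> 0" using z e0 by simp
      qed
      have "((\<lambda>z. (z - \<zeta>) / e) \<longlongrightarrow> (\<zeta> - \<zeta>) / e) (at \<zeta> within approach_region D \<zeta> M)"
        using e0 by (intro tendsto_intros)
      then show "((\<lambda>z. (z - \<zeta>) / e) \<longlongrightarrow> 0) (at \<zeta> within approach_region D \<zeta> M)" by simp
    qed
    have "((\<lambda>z. e * f (\<zeta> + e * ((z - \<zeta>) / e)) / e) \<longlongrightarrow> of_real (- \<sigma>) * d / e) (at \<zeta> within approach_region D \<zeta> M)"
      using e0 by (intro tendsto_divide tendsto_const filterlim_compose[OF lim fl]) 
    then show "(f \<longlongrightarrow> of_real (- \<sigma>) * d / e) (at \<zeta> within approach_region D \<zeta> M)"
      using e0 by simp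
  qed
  then show ?thesis unfolding \<zeta>_def by blast
qed

lemma fatou_bounded:
  assumes \<sigma>: "\<sigma> = 1 \<or> \<sigma> = -1" and hol: "f holomorphic_on D" and bd: "\<And>z. z \<in> D \<Longrightarrow> cmod (f z) \<le> B"
  shows "AE s in lebesgue. 0 < s \<longrightarrow> (\<exists>l. has_nontangential_limit D f (of_real s * cis (\<sigma> * \<alpha>)) l)"
proof -
  have B: "0 \<le> B" using order_trans[OF norm_ge_zero bd[OF polar_in_sector[of 1 0]]] \<alpha>_pos by simp
  obtain F where "\<And>z. z \<in> D \<Longrightarrow> (F has_field_derivative f z) (at z within D)"
    using holomorphic_convex_primitive'[OF convex_sector open_sector hol] by blast
  then have F: "(F has_field_derivative f z) (at z)" if "z \<in> D" for z
    using that at_within_open[OF _ open_sector] by metis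
  have "B-lipschitz_on D F"
  proof (rule lipschitz_onI[OF _ B])
    fix x y assume "x \<in> D" "y \<in> D"
    then show "dist (F x) (F y) \<le> B * dist x y"
      using field_differentiable_bound[OF convex_sector, of F f B x y] F bd
      by (simp add: dist_norm has_field_derivative_at_within)
  qed
  then obtain H where H: "B-lipschitz_on (closure D) H" "\<And>z. z \<in> D \<Longrightarrow> H z = F z"
    using lipschitz_extend_closure by blast
  have HF: "(H has_field_derivative f z) (at z)" if "z \<in> D" for z
    using has_field_derivative_transform_within_open[OF F[OF that] open_sector that, of H] H(2) by auto
  \<comment> \<open>Truncation at 0 makes the edge function globally defined and Lipschitz: negative
    parameters receive the value at the vertex.\<close>
  have "B-lipschitz_on UNIV (\<lambda>x. H (of_real (max x 0) * cis (\<sigma> * \<alpha>)))"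
  proof (rule lipschitz_onI[OF _ B])
    fix x y :: real
    have "dist (H (of_real (max x 0) * cis (\<sigma> * \<alpha>))) (H (of_real (max y 0) * cis (\<sigma> * \<alpha>)))
       \<le> B * dist (of_real (max x 0) * cis (\<sigma> * \<alpha>)) (of_real (max y 0) * cis (\<sigma> * \<alpha>))"
      by (intro lipschitz_onD[OF H(1)] edge_closure[OF \<sigma>]) auto
    also have "dist (of_real (max x 0) * cis (\<sigma> * \<alpha>)) (of_real (max y 0) * cis (\<sigma> * \<alpha>)) = \<bar>max x 0 - max y 0\<bar>"
      by (simp add: dist_norm left_diff_distrib[symmetric] norm_mult of_real_diff[symmetric] del: of_real_diff)
    also have "B * \<bar>max x 0 - max y 0\<bar> \<le> B * dist x y"
      using B by (intro mult_left_mono) (auto simp: dist_real_def max_def)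
    finally show "dist (H (of_real (max x 0) * cis (\<sigma> * \<alpha>))) (H (of_real (max y 0) * cis (\<sigma> * \<alpha>))) \<le> B * dist x y" .
  qed
  from lipschitz_AE_differentiable_complex[OF this] show ?thesis
  proof (rule AE_mp, intro AE_I2 impI)
    fix s :: real
    assume "\<exists>d. ((\<lambda>x. H (of_real (max x 0) * cis (\<sigma> * \<alpha>))) has_vector_derivative d) (at s)" "0 < s"
    then show "\<exists>l. has_nontangential_limit D f (of_real s * cis (\<sigma> * \<alpha>)) l"
      using fatou_edge_point[OF \<sigma> _ B HF H(1)] by blast
  qed
qed

lemma fatou_exp_type:
  assumes \<sigma>: "\<sigma> = 1 \<or> \<sigma> = -1" and hol: "f holomorphic_on D"
    and bd: "\<And>z. z \<in> D \<Longrightarrow> cmod (f z) \<le> C * exp (k * cmod z)" and C: "0 \<le> C" and k: "0 \<le> k"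
  shows "AE s in lebesgue. 0 < s \<longrightarrow> (\<lambda>n. f (of_real s * cis (\<sigma> * angle_seq n)))
      \<longlonglongrightarrow> boundary_ext D f (of_real s * cis (\<sigma> * \<alpha>))"
proof -
  \<comment> \<open>With this constant \<open>k * cmod z\<close> is at most \<open>c * Re z\<close>,
    so the factor \<open>exp (- c z)\<close> makes the function bounded. It is continuous and has no
    zeros, so non-tangential limits can be transferred back.\<close>
  define c where "c = k / cos \<alpha>"
  have c: "c \<ge> 0" using k sin_cos_\<alpha> by (simp add: c_def)
  have "AE s in lebesgue. 0 < s \<longrightarrow> (\<exists>l. has_nontangential_limit D (\<lambda>z. f z * exp (- of_real c * z)) (of_real s * cis (\<sigma> * \<alpha>)) l)"
  proof (rule fatou_bounded[OF \<sigma>])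
    show "(\<lambda>z. f z * exp (- of_real c * z)) holomorphic_on D"
      using hol by (intro holomorphic_intros)
    fix z assume z: "z \<in> D"
    have "c * (cmod z * cos \<alpha>) \<le> c * Re z" using Re_sector[OF z] c by (intro mult_left_mono)
    then have "k * cmod z \<le> c * Re z" using sin_cos_\<alpha> by (simp add: c_def)
    then have "exp (k * cmod z) * exp (- (c * Re z)) \<le> 1" by (simp add: exp_add[symmetric])
    have "cmod (f z * exp (- of_real c * z)) \<le> (C * exp (k * cmod z)) * exp (- (c * Re z))"
      using bd[OF z] by (simp add: norm_mult mult_right_mono)
    also have "\<dots> \<le> C" using C \<open>exp (k * cmod z) * exp (- (c * Re z)) \<le> 1\<close>
      by (simp add: mult.assoc mult_left_le)
    finally show "cmod (f z * exp (- of_real c * z)) \<le> C" .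
  qed
  then show ?thesis
  proof (rule AE_mp, intro AE_I2 impI)
    fix s :: real let ?\<zeta> = "of_real s * cis (\<sigma> * \<alpha>)"
    assume *: "0 < s \<longrightarrow> (\<exists>l. has_nontangential_limit D (\<lambda>z. f z * exp (- of_real c * z)) ?\<zeta> l)" and s: "0 < s"
    then obtain l where l: "has_nontangential_limit D (\<lambda>z. f z * exp (- of_real c * z)) ?\<zeta> l" by blast
    have "has_nontangential_limit D f ?\<zeta> (l * exp (of_real c * ?\<zeta>))"
      unfolding has_nontangential_limit_def
    proof
      fix M
      have "((\<lambda>z. (f z * exp (- of_real c * z)) * exp (of_real c * z)) \<longlongrightarrow> l * exp (of_real c * ?\<zeta>)) (at ?\<zeta> within approach_region D ?\<zeta> M)"
        using l unfolding has_nontangential_limit_def by (intro tendsto_intros) auto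
      then show "(f \<longlongrightarrow> l * exp (of_real c * ?\<zeta>)) (at ?\<zeta> within approach_region D ?\<zeta> M)"
        by (simp add: mult.assoc exp_add[symmetric])
    qed
    then show "(\<lambda>n. f (of_real s * cis (\<sigma> * angle_seq n))) \<longlonglongrightarrow> boundary_ext D f ?\<zeta>"
      using boundary_ext_eq[OF \<sigma> s, of f] nontangential_limit_seq[OF \<sigma> s, of f] by simp
  qed
qed

end

section \<open>Integrals along rays and Cauchy's formula\<close>

lemma has_vector_derivative_ray:
  "((\<lambda>s. of_real s * c) has_vector_derivative c) (at s within A)" for c :: complex
proof -
  have "((\<lambda>s. of_real s * c) has_vector_derivative of_real 1 * c) (at s within A)"
    by (intro has_vector_derivative_mult_left has_vector_derivative_of_real DERIV_ident)
  then show ?thesis by simp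
qed

lemma FTC_half_line:
  fixes F f :: "real \<Rightarrow> complex"
  assumes "\<And>s. 0 < s \<Longrightarrow> (F has_vector_derivative f s) (at s)" "continuous_on {0<..} f"
    and "set_integrable lborel {0<..} f"
    and "(F \<longlongrightarrow> A) (at_right 0)" "(F \<longlongrightarrow> B) at_top"
  shows "(LINT s:{0<..}|lborel. f s) = B - A"
proof -
  have e: "einterval 0 \<infinity> = {0<..}" by (auto simp: einterval_def)
  have "(LBINT x=0..\<infinity>. f x) = B - A"
  proof (rule interval_integral_FTC_integrable)
    show "isCont f x" if "0 < ereal x" "ereal x < \<infinity>" for x
      using assms(2) that continuous_on_eq_continuous_at[of "{0<..}" f] by auto
    show "((F \<circ> real_of_ereal) \<longlongrightarrow> A) (at_right 0)"
      unfolding zero_ereal_def ereal_tendsto_simps by fact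
    show "((F \<circ> real_of_ereal) \<longlongrightarrow> B) (at_left \<infinity>)"
      unfolding ereal_tendsto_simps by fact
  qed (use assms e in auto)
  then show ?thesis unfolding zero_ereal_def interval_integral_to_infinity_eq .
qed

lemma set_integrable_inverse_square: "set_integrable lborel {0<..} (\<lambda>s::real. C / (1 + s\<^sup>2))"
proof -
  have e: "einterval 0 \<infinity> = {0<..}" by (auto simp: einterval_def)
  have "set_integrable lborel (einterval 0 \<infinity>) (\<lambda>s::real. 1 / (1 + s\<^sup>2))"
  proof (rule interval_integral_FTC_nonneg)
    show "DERIV arctan x :> 1 / (1 + x\<^sup>2)" for x :: real
      using DERIV_arctan[of x] by (simp add: inverse_eq_divide)
    show "isCont (\<lambda>s. 1 / (1 + s\<^sup>2)) x" for x :: real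
      by (intro continuous_intros) (simp add: add_nonneg_eq_0_iff)
    show "((arctan \<circ> real_of_ereal) \<longlongrightarrow> arctan 0) (at_right 0)"
      unfolding zero_ereal_def ereal_tendsto_simps by (intro tendsto_intros)
    show "((arctan \<circ> real_of_ereal) \<longlongrightarrow> pi / 2) (at_left \<infinity>)"
      unfolding ereal_tendsto_simps by (rule tendsto_arctan_at_top)
  qed auto
  then have "set_integrable lborel {0<..} (\<lambda>s::real. C * (1 / (1 + s\<^sup>2)))"
    unfolding e by (intro set_integrable_mult_right) auto
  then show ?thesis by simp
qed

lemma set_integrable_exp:
  assumes "k > (0::real)"
  shows "set_integrable lborel {0<..} (\<lambda>s::real. C * exp (- k * s))"
proof -
  have e: "einterval 0 \<infinity> = {0<..}" by (auto simp: einterval_def)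
  have "set_integrable lborel (einterval 0 \<infinity>) (\<lambda>s::real. exp (- k * s))"
  proof (rule interval_integral_FTC_nonneg)
    show "DERIV (\<lambda>s. - exp (- k * s) / k) x :> exp (- k * x)" for x :: real
      using assms by (auto intro!: derivative_eq_intros)
    show "(((\<lambda>s. - exp (- k * s) / k) \<circ> real_of_ereal) \<longlongrightarrow> - exp (- k * 0) / k) (at_right 0)"
      unfolding zero_ereal_def ereal_tendsto_simps using assms by (intro tendsto_intros) auto
    have "((\<lambda>s. exp (- k * s)) \<longlongrightarrow> 0) at_top"
      using assms by (intro filterlim_compose[OF exp_at_bot] filterlim_tendsto_neg_mult_at_bot[OF tendsto_const]) (auto simp: filterlim_ident)
    then have "((\<lambda>s. - exp (- k * s) / k) \<longlongrightarrow> - 0 / k) at_top"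
      using assms by (intro tendsto_intros) auto
    then show "(((\<lambda>s. - exp (- k * s) / k) \<circ> real_of_ereal) \<longlongrightarrow> 0) (at_left \<infinity>)"
      unfolding ereal_tendsto_simps by simp
  qed auto
  then show ?thesis
    unfolding e by (intro set_integrable_mult_right) auto
qed

lemma set_integrable_continuous_bound:
  fixes f :: "real \<Rightarrow> complex" and W :: "real \<Rightarrow> real"
  assumes "continuous_on {0<..} f" "set_integrable lborel {0<..} W" "\<And>s. 0 < s \<Longrightarrow> cmod (f s) \<le> W s"
  shows "set_integrable lborel {0<..} f"
proof (rule set_integrable_bound[OF assms(2)])
  show "set_borel_measurable lborel {0<..} f"
    using borel_measurable_continuous_on_indicator[OF _ assms(1)] by (simp add: set_borel_measurable_def)
  have "norm (f s) \<le> norm (W s)" if "0 < s" for s using assms(3)[OF that] by simp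
  then show "AE x in lborel. x \<in> {0<..} \<longrightarrow> norm (f x) \<le> norm (W x)" by auto
qed

text \<open>The vertex is excluded since it is not in the sector; a continuous \<open>K\<close> is
  then continuous on the whole range of integration.\<close>

definition ray_int :: "real \<Rightarrow> (complex \<Rightarrow> complex) \<Rightarrow> complex" where
  "ray_int \<theta> K = (LINT s:{0<..}|lborel. K (of_real s * cis \<theta>) * cis \<theta>)"

section \<open>Rotation of rays and Cauchy's formula between two rays\<close>

context sector_angle
begin

lemma continuous_on_ray:
  assumes "continuous_on D K" "\<bar>\<theta>\<bar> < \<alpha>"
  shows "continuous_on {0<..} (\<lambda>s. K (of_real s * cis \<theta>))"
  using polar_in_sector assms(2)
  by (intro continuous_on_compose2[OF assms(1)] continuous_intros) auto

lemma set_integrable_ray: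
  assumes "continuous_on D K" "\<And>z. z \<in> D \<Longrightarrow> cmod (K z) \<le> C / (1 + (cmod z)\<^sup>2)" "\<bar>\<theta>\<bar> < \<alpha>"
  shows "set_integrable lborel {0<..} (\<lambda>s. K (of_real s * cis \<theta>) * cis \<theta>)"
proof (rule set_integrable_continuous_bound[OF _ set_integrable_inverse_square])
  show "continuous_on {0<..} (\<lambda>s. K (of_real s * cis \<theta>) * cis \<theta>)"
    by (intro continuous_intros continuous_on_ray assms)
  show "cmod (K (of_real s * cis \<theta>) * cis \<theta>) \<le> C / (1 + s\<^sup>2)" if "0 < s" for s
    using assms(2)[OF polar_in_sector[OF that assms(3)]] that by (simp add: norm_mult)
qed

text \<open>Cauchy's theorem with chords in place of arcs. The difference of a primitive at the two
  points of radius \<open>s\<close> is at most the chord length, at most \<open>2 * s\<close>, times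
  the maximum of the integrand on the chord. The chord stays to the right of
  \<open>s * cos \<alpha>\<close>, so this product tends to 0 both at the vertex and at
  infinity.\<close>

lemma ray_int_indep:
  assumes hol: "K holomorphic_on D" and bd: "\<And>z. z \<in> D \<Longrightarrow> cmod (K z) \<le> C / (1 + (cmod z)\<^sup>2)"
    and \<theta>: "\<bar>\<theta>\<bar> < \<alpha>" "\<bar>\<theta>'\<bar> < \<alpha>"
  shows "ray_int \<theta> K = ray_int \<theta>' K"
proof -
  have C: "0 \<le> C" using order_trans[OF norm_ge_zero bd[OF polar_in_sector[of 1 0]]] \<alpha>_pos by simp
  obtain P where P: "\<And>z. z \<in> D \<Longrightarrow> (P has_field_derivative K z) (at z within D)"
    using holomorphic_convex_primitive'[OF convex_sector open_sector hol] by blast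
  define F where "F = (\<lambda>s. P (of_real s * cis \<theta>) - P (of_real s * cis \<theta>'))"
  have vd: "((\<lambda>s. P (of_real s * cis \<phi>)) has_vector_derivative K (of_real s * cis \<phi>) * cis \<phi>) (at s)"
    if "0 < s" "\<bar>\<phi>\<bar> < \<alpha>" for s \<phi>
  proof -
    have "(P has_field_derivative K (of_real s * cis \<phi>)) (at (of_real s * cis \<phi>))"
      using P[OF polar_in_sector[OF that]] at_within_open[OF polar_in_sector[OF that] open_sector] by simp
    from field_vector_diff_chain_at[OF has_vector_derivative_ray this]
    show ?thesis by (simp add: o_def mult.commute)
  qed
  have Fbd: "cmod (F s) \<le> 2 * s * (C / (1 + (s * cos \<alpha>)\<^sup>2))" if s: "0 < s" for s
  proof -
    let ?u = "of_real s * cis \<theta>" and ?v = "of_real s * cis \<theta>'"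
    have uv: "?u \<in> D" "?v \<in> D" using polar_in_sector s \<theta> by auto
    then have seg: "closed_segment ?u ?v \<subseteq> D" by (rule closed_segment_subset[OF _ _ convex_sector])
    have "cmod (P ?u - P ?v) \<le> C / (1 + (s * cos \<alpha>)\<^sup>2) * cmod (?u - ?v)"
    proof (rule field_differentiable_bound)
      show "convex (closed_segment ?u ?v)" by simp
      fix w assume w: "w \<in> closed_segment ?u ?v"
      then show "(P has_field_derivative K w) (at w within closed_segment ?u ?v)"
        using P[of w] seg by (blast intro: has_field_derivative_subset)
      have "closed_segment ?u ?v \<subseteq> {w. Re w \<ge> s * cos \<alpha>}"
        using Re_sector[OF uv(1)] Re_sector[OF uv(2)] s
        by (intro closed_segment_subset convex_halfspace_Re_ge) (auto simp: norm_mult)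
      then have "s * cos \<alpha> \<le> cmod w" using w complex_Re_le_cmod[of w] by force
      then have "(s * cos \<alpha>)\<^sup>2 \<le> (cmod w)\<^sup>2" using s sin_cos_\<alpha> by (intro power_mono) auto
      then have "C / (1 + (cmod w)\<^sup>2) \<le> C / (1 + (s * cos \<alpha>)\<^sup>2)"
        using C by (intro divide_left_mono mult_pos_pos add_pos_nonneg) auto
      then show "cmod (K w) \<le> C / (1 + (s * cos \<alpha>)\<^sup>2)" using bd[of w] w seg by force
    qed auto
    also have "\<dots> \<le> C / (1 + (s * cos \<alpha>)\<^sup>2) * (2 * s)"
      using norm_triangle_ineq4[of ?u ?v] s C by (intro mult_left_mono) (auto simp: norm_mult)
    finally show ?thesis unfolding F_def by (simp add: mult.commute)
  qed
  have "(LINT s:{0<..}|lborel. K (of_real s * cis \<theta>) * cis \<theta> - K (of_real s * cis \<theta>') * cis \<theta>') = 0 - 0"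
  proof (rule FTC_half_line)
    show "(F has_vector_derivative K (of_real s * cis \<theta>) * cis \<theta> - K (of_real s * cis \<theta>') * cis \<theta>') (at s)" if "0 < s" for s
      unfolding F_def using vd that \<theta> by (intro has_vector_derivative_diff) auto
    show "continuous_on {0<..} (\<lambda>s. K (of_real s * cis \<theta>) * cis \<theta> - K (of_real s * cis \<theta>') * cis \<theta>')"
      using hol \<theta> by (intro continuous_intros continuous_on_ray) (auto simp: holomorphic_on_imp_continuous_on)
    show "set_integrable lborel {0<..} (\<lambda>s. K (of_real s * cis \<theta>) * cis \<theta> - K (of_real s * cis \<theta>') * cis \<theta>')"
      using hol bd \<theta> by (intro set_integral_diff set_integrable_ray) (auto simp: holomorphic_on_imp_continuous_on)
    have "((\<lambda>s. 2 * s * (C / (1 + (s * cos \<alpha>)\<^sup>2))) \<longlongrightarrow> 2 * 0 * (C / (1 + (0 * cos \<alpha>)\<^sup>2))) (at_right 0)"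
      by (intro tendsto_intros) auto
    then have "((\<lambda>s. 2 * s * (C / (1 + (s * cos \<alpha>)\<^sup>2))) \<longlongrightarrow> 0) (at_right 0)" by simp
    then show "(F \<longlongrightarrow> 0) (at_right 0)"
      by (rule Lim_null_comparison[rotated]) (use Fbd in \<open>auto simp: eventually_at_filter\<close>)
    have "((\<lambda>s. 2 * C / (cos \<alpha>)\<^sup>2 * inverse s) \<longlongrightarrow> 2 * C / (cos \<alpha>)\<^sup>2 * 0) at_top"
      by (intro tendsto_intros tendsto_inverse_0_at_top filterlim_ident)
    then have "((\<lambda>s. 2 * C / (cos \<alpha>)\<^sup>2 * inverse s) \<longlongrightarrow> 0) at_top" by simp
    then show "(F \<longlongrightarrow> 0) at_top"
    proof (rule Lim_null_comparison[rotated])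
      show "\<forall>\<^sub>F s in at_top. norm (F s) \<le> 2 * C / (cos \<alpha>)\<^sup>2 * inverse s"
        using eventually_gt_at_top[of 0]
      proof eventually_elim
        case (elim s)
        have "2 * s * (C / (1 + (s * cos \<alpha>)\<^sup>2)) \<le> 2 * s * (C / (s * cos \<alpha>)\<^sup>2)"
          using elim C sin_cos_\<alpha> by (intro mult_left_mono divide_left_mono) (auto intro!: mult_pos_pos add_pos_nonneg)
        also have "\<dots> = 2 * C / (cos \<alpha>)\<^sup>2 * inverse s" using elim sin_cos_\<alpha> by (simp add: field_simps power2_eq_square)
        finally show ?case using Fbd[OF elim] by simp
      qed
    qed
  qed
  then show ?thesis
    unfolding ray_int_def
    using set_integral_diff(2)[OF set_integrable_ray[OF holomorphic_on_imp_continuous_on[OF hol] bd \<theta>(1)]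
        set_integrable_ray[OF holomorphic_on_imp_continuous_on[OF hol] bd \<theta>(2)]] by simp
qed

text \<open>The distance of either point from the line through 0 and the other one is its modulus
  times the sine of the angle between them.\<close>

lemma dist_polar_ge:
  assumes "0 < r" "0 < s" "0 \<le> sin \<bar>\<theta> - \<phi>\<bar>"
  shows "max r s * sin \<bar>\<theta> - \<phi>\<bar> \<le> cmod (of_real s * cis \<theta> - of_real r * cis \<phi>)"
proof -
  let ?w = "of_real s * cis \<theta> - of_real r * cis \<phi>"
  have a: "\<bar>sin (\<theta> - \<phi>)\<bar> = sin \<bar>\<theta> - \<phi>\<bar>"
    using assms(3) sin_minus[of "\<theta> - \<phi>"] by (cases "\<theta> - \<phi> \<ge> 0") auto
  have "Im (?w * cis (- \<phi>)) = s * sin (\<theta> - \<phi>)" "Im (?w * cis (- \<theta>)) = - r * sin (\<phi> - \<theta>)"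
    by (simp_all only: left_diff_distrib minus_complex.sel Im_polar_cis) auto
  moreover have "\<bar>Im (?w * cis \<psi>)\<bar> \<le> cmod ?w" for \<psi>
    using abs_Im_le_cmod[of "?w * cis \<psi>"] by (simp add: norm_mult)
  ultimately have "\<bar>s * sin (\<theta> - \<phi>)\<bar> \<le> cmod ?w" "\<bar>- r * sin (\<phi> - \<theta>)\<bar> \<le> cmod ?w" by metis+
  moreover have "\<bar>sin (\<phi> - \<theta>)\<bar> = sin \<bar>\<theta> - \<phi>\<bar>" using a sin_minus[of "\<theta> - \<phi>"] by simp
  ultimately have "s * sin \<bar>\<theta> - \<phi>\<bar> \<le> cmod ?w" "r * sin \<bar>\<theta> - \<phi>\<bar> \<le> cmod ?w"
    using assms a by (auto simp: abs_mult)
  then show ?thesis by (simp add: max_def)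
qed

lemma cmod_add_sector_ge:
  assumes "w \<in> D" "z \<in> D"
  shows "(cmod w + cmod z) * cos \<alpha> \<le> cmod (w + z)"
  using Re_sector[OF assms(1)] Re_sector[OF assms(2)] complex_Re_le_cmod[of "w + z"]
  by (simp add: algebra_simps)

text \<open>The function \<open>2z / (w\<^sup>2 - z\<^sup>2)\<close> has residue 1 at \<open>z\<close>, decays like \<open>1 / w\<^sup>2\<close>,
  and its primitive \<open>Ln ((w - z) / (w + z))\<close> stays on one side of the real axis along each ray.\<close>

lemma ray_int_model:
  assumes \<sigma>: "\<sigma> = 1 \<or> \<sigma> = -1" and r: "0 < r" and \<phi>: "\<bar>\<phi>\<bar> < \<theta>" "\<theta> < \<alpha>"
  defines "z \<equiv> of_real r * cis \<phi>"
  shows "set_integrable lborel {0<..} (\<lambda>s. 2 * z / ((of_real s * cis (\<sigma> * \<theta>))\<^sup>2 - z\<^sup>2) * cis (\<sigma> * \<theta>))" (is ?int)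
    and "ray_int (\<sigma> * \<theta>) (\<lambda>w. 2 * z / (w\<^sup>2 - z\<^sup>2)) = - of_real \<sigma> * \<i> * pi"
proof -
  let ?w = "\<lambda>s. complex_of_real s * cis (\<sigma> * \<theta>)"
  let ?f = "\<lambda>s. 2 * z / ((?w s)\<^sup>2 - z\<^sup>2) * cis (\<sigma> * \<theta>)"
  define \<psi> where "\<psi> = \<bar>\<sigma> * \<theta> - \<phi>\<bar>"
  have \<psi>: "sin \<psi> > 0" unfolding \<psi>_def using \<sigma> \<phi> \<alpha>_less by (intro sin_gt_zero) auto
  have zD: "z \<in> D" and wD: "0 < s \<Longrightarrow> ?w s \<in> D" for s
    using \<sigma> r \<phi> by (auto simp: z_def intro!: polar_in_sector)
  have cz: "cmod z = r" using r by (simp add: z_def norm_mult)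
  have cw: "0 < s \<Longrightarrow> cmod (?w s) = s" for s by (simp add: norm_mult)
  have lo1: "max r s * sin \<psi> \<le> cmod (?w s - z)" if "0 < s" for s
    using dist_polar_ge[OF r that, of "\<sigma> * \<theta>" \<phi>] \<psi> by (simp add: z_def \<psi>_def)
  have lo2: "max r s * cos \<alpha> \<le> cmod (?w s + z)" if "0 < s" for s
  proof -
    have "max r s * cos \<alpha> \<le> (s + r) * cos \<alpha>" using sin_cos_\<alpha> r that by (intro mult_right_mono) auto
    then show ?thesis using cmod_add_sector_ge[OF wD[OF that] zD] cw[OF that] cz by simp
  qed
  have nz: "?w s - z \<noteq> 0" "?w s + z \<noteq> 0" if "0 < s" for s
  proof -
    have "0 < max r s * sin \<psi>" "0 < max r s * cos \<alpha>" using r \<psi> sin_cos_\<alpha> that by (auto simp: less_max_iff_disj)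
    then show "?w s - z \<noteq> 0" "?w s + z \<noteq> 0" using lo1[OF that] lo2[OF that] by auto
  qed
  have fac: "(?w s)\<^sup>2 - z\<^sup>2 = (?w s - z) * (?w s + z)" for s by (simp add: power2_eq_square algebra_simps)
  have cont: "continuous_on {0<..} ?f"
    by (intro continuous_intros) (use nz fac in auto)
  \<comment> \<open>The two factors of the denominator are at least \<open>max r s\<close> times
    \<open>sin \<psi>\<close> and \<open>cos \<alpha>\<close>; the factor
    \<open>1 + 1 / r\<^sup>2\<close> serves to replace the square of \<open>max r s\<close> by
    \<open>1 + s\<^sup>2\<close>.\<close>
  define C where "C = 2 * r / (sin \<psi> * cos \<alpha>) * (1 + 1 / r\<^sup>2)"
  show int: ?int
  proof (rule set_integrable_continuous_bound[OF cont set_integrable_inverse_square])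
    fix s :: real assume s: "0 < s"
    let ?m = "max r s"
    have m: "?m > 0" using r by (simp add: less_max_iff_disj)
    have "(?m * sin \<psi>) * (?m * cos \<alpha>) \<le> cmod (?w s - z) * cmod (?w s + z)"
      using lo1[OF s] lo2[OF s] m \<psi> sin_cos_\<alpha> by (intro mult_mono) auto
    then have "2 * r / (cmod (?w s - z) * cmod (?w s + z)) \<le> 2 * r / ((?m * sin \<psi>) * (?m * cos \<alpha>))"
      using r m \<psi> sin_cos_\<alpha> nz[OF s] by (intro divide_left_mono mult_pos_pos) auto
    also have "\<dots> = 2 * r / (sin \<psi> * cos \<alpha>) * (1 / ?m\<^sup>2)"
      by (simp add: power2_eq_square)
    also have "\<dots> \<le> 2 * r / (sin \<psi> * cos \<alpha>) * ((1 + 1 / r\<^sup>2) / (1 + s\<^sup>2))"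
    proof (intro mult_left_mono)
      have "1 + s\<^sup>2 \<le> (1 + 1 / r\<^sup>2) * ?m\<^sup>2"
      proof -
        have "s\<^sup>2 \<le> ?m\<^sup>2" "r\<^sup>2 \<le> ?m\<^sup>2" using r s by (auto intro!: power_mono)
        moreover have "1 \<le> 1 / r\<^sup>2 * ?m\<^sup>2" using r \<open>r\<^sup>2 \<le> ?m\<^sup>2\<close> by (simp add: field_simps)
        ultimately show ?thesis by (simp add: distrib_right)
      qed
      moreover have "0 < 1 + s\<^sup>2" by (simp add: add_pos_nonneg)
      ultimately show "1 / ?m\<^sup>2 \<le> (1 + 1 / r\<^sup>2) / (1 + s\<^sup>2)" 
        using m by (simp add: pos_le_divide_eq pos_divide_le_eq mult.commute)
      show "0 \<le> 2 * r / (sin \<psi> * cos \<alpha>)" using r \<psi> sin_cos_\<alpha> by simp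
    qed
    finally show "cmod (?f s) \<le> C / (1 + s\<^sup>2)"
      unfolding fac using r by (simp add: C_def norm_mult norm_divide cz)
  qed
  let ?q = "\<lambda>s. (?w s - z) / (?w s + z)"
  \<comment> \<open>The factor \<open>- \<sigma> i\<close> rotates the half-plane containing the
    quotient \<open>?q\<close> into the right half-plane, away from the branch cut of
    \<open>Ln\<close>. Along the ray \<open>?q\<close> moves from -1 to 1, so the logarithm changes
    by \<open>- \<sigma> i pi\<close>.\<close>
  let ?F = "\<lambda>s. Ln (- of_real \<sigma> * \<i> * ?q s)"
  have Imq: "\<sigma> * Im (?q s) > 0" if s: "0 < s" for s
  proof -
    have "Im (?q s) = Im ((?w s - z) * cnj (?w s + z)) / (cmod (?w s + z))\<^sup>2"
      by (simp add: complex_div_cnj[of "?w s - z"])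
    moreover have "Im ((?w s - z) * cnj (?w s + z)) = 2 * Im (?w s * cnj z)"
      by (simp add: algebra_simps)
    moreover have "?w s * cnj z = of_real (s * r) * cis (\<sigma> * \<theta>) * cis (- \<phi>)"
      by (simp add: z_def cis_cnj mult_ac)
    then have "Im (?w s * cnj z) = s * r * sin (\<sigma> * \<theta> - \<phi>)"
      by (simp only: Im_polar_cis) simp
    moreover have "\<sigma> * sin (\<sigma> * \<theta> - \<phi>) > 0"
    proof -
      have "0 < sin (\<theta> - \<phi>)" "0 < sin (\<theta> + \<phi>)" using \<phi> \<alpha>_less by (auto intro!: sin_gt_zero)
      then show ?thesis using \<sigma> sin_minus[of "\<theta> + \<phi>"] by auto
    qed
    ultimately have "\<sigma> * Im (?q s) = 2 * (s * r * (\<sigma> * sin (\<sigma> * \<theta> - \<phi>))) / (cmod (?w s + z))\<^sup>2"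
      by simp
    also have "\<dots> > 0"
      using mult_pos_pos[OF mult_pos_pos[OF s r] \<open>\<sigma> * sin (\<sigma> * \<theta> - \<phi>) > 0\<close>] nz[OF s] by (intro divide_pos_pos) auto
    finally show ?thesis .
  qed
  have Re_pos: "Re (- of_real \<sigma> * \<i> * ?q s) > 0" if "0 < s" for s
  proof -
    have "Re (- of_real t * \<i> * q) = t * Im q" for t and q :: complex by simp
    then show ?thesis using Imq[OF that] by (simp only:)
  qed
  have slit: "- of_real \<sigma> * \<i> * ?q s \<notin> \<real>\<^sub>\<le>\<^sub>0" if "0 < s" for s
    using Re_pos[OF that] by (auto simp: complex_nonpos_Reals_iff)
  have \<sigma>0: "complex_of_real \<sigma> \<noteq> 0" using \<sigma> by auto
  have "ray_int (\<sigma> * \<theta>) (\<lambda>w. 2 * z / (w\<^sup>2 - z\<^sup>2)) = Ln (- of_real \<sigma> * \<i> * 1) - Ln (- of_real \<sigma> * \<i> * (-1))"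
    unfolding ray_int_def
  proof (rule FTC_half_line[where F = ?F])
    fix s :: real assume s: "0 < s"
    have "((\<lambda>w. Ln (- of_real \<sigma> * \<i> * ((w - z) / (w + z)))) has_field_derivative 2 * z / ((?w s)\<^sup>2 - z\<^sup>2)) (at (?w s))"
    proof -
      have "((\<lambda>w. - of_real \<sigma> * \<i> * ((w - z) / (w + z))) has_field_derivative - of_real \<sigma> * \<i> * (2 * z / (?w s + z)\<^sup>2)) (at (?w s))"
        using nz[OF s] by (auto intro!: derivative_eq_intros simp: field_simps power2_eq_square)
      from DERIV_chain2[where f = Ln and g = "\<lambda>w. - of_real \<sigma> * \<i> * ((w - z) / (w + z))" and x = "?w s",
          OF has_field_derivative_Ln[OF slit[OF s]] this]
      have "((\<lambda>w. Ln (- of_real \<sigma> * \<i> * ((w - z) / (w + z)))) has_field_derivative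
        inverse (- of_real \<sigma> * \<i> * ?q s) * (- of_real \<sigma> * \<i> * (2 * z / (?w s + z)\<^sup>2))) (at (?w s))" .
      moreover have "inverse (- of_real \<sigma> * \<i> * ?q s) * (- of_real \<sigma> * \<i> * (2 * z / (?w s + z)\<^sup>2)) = 2 * z / ((?w s)\<^sup>2 - z\<^sup>2)"
      proof -
        have "inverse (a * (b / c)) * (a * (d / c\<^sup>2)) = d / (b * c)" if "a \<noteq> 0" "b \<noteq> 0" "c \<noteq> 0" for a b c d :: complex
          using that by (simp add: field_simps power2_eq_square)
        then show ?thesis unfolding fac using nz[OF s] \<sigma>0 by simp
      qed
      ultimately show ?thesis by simp
    qed
    from field_vector_diff_chain_at[OF has_vector_derivative_ray this]
    show "(?F has_vector_derivative ?f s) (at s)" by (simp add: o_def mult.commute)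
  next
    show "continuous_on {0<..} ?f" "set_integrable lborel {0<..} ?f" by fact+
    have "((\<lambda>s. Ln (- of_real \<sigma> * \<i> * ?q s)) \<longlongrightarrow> Ln (- of_real \<sigma> * \<i> * ((of_real 0 * cis (\<sigma> * \<theta>) - z) / (of_real 0 * cis (\<sigma> * \<theta>) + z)))) (at_right 0)"
      using r \<sigma> by (intro tendsto_intros) (auto simp: z_def complex_nonpos_Reals_iff)
    then show "(?F \<longlongrightarrow> Ln (- of_real \<sigma> * \<i> * (-1))) (at_right 0)"
      using r by (simp add: z_def)
    \<comment> \<open>The limit at infinity is read off after dividing numerator and denominator by
      \<open>s\<close>.\<close>
    have i0: "((\<lambda>s. complex_of_real (inverse s)) \<longlongrightarrow> of_real 0) at_top"
      by (intro tendsto_of_real tendsto_inverse_0_at_top filterlim_ident)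
    have "((\<lambda>s. Ln (- of_real \<sigma> * \<i> * ((cis (\<sigma> * \<theta>) - of_real (inverse s) * z) / (cis (\<sigma> * \<theta>) + of_real (inverse s) * z))))
       \<longlongrightarrow> Ln (- of_real \<sigma> * \<i> * ((cis (\<sigma> * \<theta>) - of_real 0 * z) / (cis (\<sigma> * \<theta>) + of_real 0 * z)))) at_top"
      using \<sigma> by (intro tendsto_intros i0) (auto simp: complex_nonpos_Reals_iff)
    then have "((\<lambda>s. Ln (- of_real \<sigma> * \<i> * ((cis (\<sigma> * \<theta>) - of_real (inverse s) * z) / (cis (\<sigma> * \<theta>) + of_real (inverse s) * z))))
       \<longlongrightarrow> Ln (- of_real \<sigma> * \<i> * 1)) at_top" by simp
    then show "(?F \<longlongrightarrow> Ln (- of_real \<sigma> * \<i> * 1)) at_top"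
    proof (rule Lim_transform_eventually)
      show "\<forall>\<^sub>F s in at_top. Ln (- of_real \<sigma> * \<i> * ((cis (\<sigma> * \<theta>) - of_real (inverse s) * z) / (cis (\<sigma> * \<theta>) + of_real (inverse s) * z))) = ?F s"
        using eventually_gt_at_top[of 0]
      proof eventually_elim
        case (elim s)
        have "(cis (\<sigma> * \<theta>) - of_real (inverse s) * z) / (cis (\<sigma> * \<theta>) + of_real (inverse s) * z)
            = (of_real s * (cis (\<sigma> * \<theta>) - of_real (inverse s) * z)) / (of_real s * (cis (\<sigma> * \<theta>) + of_real (inverse s) * z))"
          using elim by (subst mult_divide_mult_cancel_left) auto
        also have "\<dots> = ?q s" using elim by (simp add: algebra_simps)
        finally show ?case by simp
      qed
    qed
  qed
  also have "\<dots> = - of_real \<sigma> * \<i> * pi" using \<sigma> by (auto simp: Ln_ii Ln_minus_ii)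
  finally show "ray_int (\<sigma> * \<theta>) (\<lambda>w. 2 * z / (w\<^sup>2 - z\<^sup>2)) = - of_real \<sigma> * \<i> * pi" .
qed

text \<open>The pole is removed by subtracting a multiple of the model function
  \<open>2 * z / (w + z)\<close>, which equals 1 at \<open>z\<close> and decays. The remaining
  quotient \<open>K\<close> is holomorphic and \<open>O(1 / |w|^2)\<close>, so its integrals over
  the two rays cancel. Each model integral contributes half a residue with opposite sign, which adds
  up to \<open>2 pi i q(z)\<close>.\<close>

lemma sector_cauchy:
  assumes hol: "q holomorphic_on D" and bd: "\<And>w. w \<in> D \<Longrightarrow> cmod (q w) \<le> C / (1 + cmod w)"
    and r: "0 < r" and \<phi>: "\<bar>\<phi>\<bar> < \<theta>" "\<theta> < \<alpha>"
  defines "z \<equiv> of_real r * cis \<phi>"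
  shows "ray_int (- \<theta>) (\<lambda>w. q w / (w - z)) - ray_int \<theta> (\<lambda>w. q w / (w - z)) = 2 * pi * \<i> * q z"
proof -
  have zD: "z \<in> D" using r \<phi> by (auto simp: z_def intro!: polar_in_sector)
  have z0: "z \<noteq> 0" using r by (simp add: z_def)
  have C: "0 \<le> C" using order_trans[OF norm_ge_zero bd[OF zD]] by (simp add: zero_le_divide_iff) (smt (verit) norm_ge_zero)
  have wz: "w + z \<noteq> 0" if "w \<in> D" for w
    using Re_sector[OF that] Re_sector[OF zD] z0 sin_cos_\<alpha>
    by (smt (verit, best) mult_nonneg_nonneg mult_pos_pos norm_ge_zero plus_complex.sel(1) zero_complex.sel(1) zero_less_norm_iff)
  define N where "N = (\<lambda>w. q w - q z * (2 * z / (w + z)))"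
  have holN: "N holomorphic_on D" unfolding N_def using wz by (intro holomorphic_intros hol) auto
  have Nz: "N z = 0" using z0 by (simp add: N_def)
  define K where "K = (\<lambda>w. if w = z then deriv N z else (N w - N z) / (w - z))"
  have holK: "K holomorphic_on D" unfolding K_def
    using zD open_sector by (intro pole_lemma[OF holN]) (simp add: interior_open)
  obtain \<delta> where \<delta>: "\<delta> > 0" "cball z \<delta> \<subseteq> D" using open_contains_cball open_sector zD by blast
  have "compact (K ` cball z \<delta>)"
    using holK \<delta> by (intro compact_continuous_image compact_cball) (blast intro: holomorphic_on_imp_continuous_on continuous_on_subset)
  then obtain B where B: "B > 0" "\<And>w. w \<in> cball z \<delta> \<Longrightarrow> cmod (K w) \<le> B"
    using compact_imp_bounded bounded_pos by (metis image_eqI)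
  \<comment> \<open>\<open>C1\<close> bounds \<open>N\<close> by \<open>C1 / (1 + |w|)\<close>.
    Outside the disc around \<open>z\<close>, dividing by \<open>w - z\<close> gains another factor
    of order \<open>1 / (1 + |w|)\<close>, hence \<open>C2\<close>; inside, compactness bounds
    \<open>K\<close> and yields \<open>C3\<close>.\<close>
  define C1 where "C1 = C + cmod (q z) * (2 * r / cos \<alpha> * (1 + 1 / r))"
  define C2 where "C2 = C1 * ((1 + r) / \<delta> + 1)"
  define C3 where "C3 = B * (1 + (r + \<delta>)\<^sup>2)"
  have cz: "cmod z = r" using r by (simp add: z_def norm_mult)
  have C1: "0 \<le> C1" and C2: "0 \<le> C2" and C3: "0 \<le> C3"
    using C r \<delta> B sin_cos_\<alpha> by (auto simp: C1_def C2_def C3_def intro!: add_nonneg_nonneg mult_nonneg_nonneg divide_nonneg_nonneg)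
  have bdN: "cmod (N w) \<le> C1 / (1 + cmod w)" if w: "w \<in> D" for w
  proof -
    have "(cmod w + r) * cos \<alpha> \<le> cmod (w + z)" using cmod_add_sector_ge[OF w zD] cz by simp
    then have "2 * r / cmod (w + z) \<le> 2 * r / ((cmod w + r) * cos \<alpha>)"
      using r sin_cos_\<alpha> wz[OF w] by (intro divide_left_mono mult_pos_pos add_nonneg_pos) auto
    also have "\<dots> = 2 * r / cos \<alpha> * (1 / (cmod w + r))" by simp
    also have "\<dots> \<le> 2 * r / cos \<alpha> * ((1 + 1 / r) / (1 + cmod w))"
    proof (intro mult_left_mono)
      have "1 + cmod w \<le> (1 + 1 / r) * (cmod w + r)" using r by (simp add: field_simps)
      moreover have "0 < cmod w + r" "0 < 1 + cmod w" using r by (auto intro: add_nonneg_pos add_pos_nonneg)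
      ultimately show "1 / (cmod w + r) \<le> (1 + 1 / r) / (1 + cmod w)"
        by (simp add: pos_le_divide_eq pos_divide_le_eq mult.commute)
    qed (use r sin_cos_\<alpha> in auto)
    finally have "cmod (q z) * (2 * r / cmod (w + z)) \<le> cmod (q z) * (2 * r / cos \<alpha> * ((1 + 1 / r) / (1 + cmod w)))"
      by (rule mult_left_mono) simp
    moreover have "cmod (N w) \<le> cmod (q w) + cmod (q z) * (2 * r / cmod (w + z))"
      unfolding N_def using norm_triangle_ineq4[of "q w" "q z * (2 * z / (w + z))"]
      by (simp add: norm_mult norm_divide cz)
    ultimately have "cmod (N w) \<le> C / (1 + cmod w) + cmod (q z) * (2 * r / cos \<alpha> * ((1 + 1 / r) / (1 + cmod w)))"
      using bd[OF w] by linarith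
    also have "\<dots> = C1 / (1 + cmod w)"
    proof -
      have "C / X + u * (a * (b / X)) = (C + u * (a * b)) / X" for X u a b
        by (simp add: add_divide_distrib)
      then show ?thesis unfolding C1_def .
    qed
    finally show ?thesis .
  qed
  have bdK: "cmod (K w) \<le> max C2 C3 / (1 + (cmod w)\<^sup>2)" if w: "w \<in> D" for w
  proof (cases "w \<in> cball z \<delta>")
    case True
    then have "cmod w \<le> r + \<delta>" using norm_triangle_ineq2[of w z] cz by (simp add: dist_norm norm_minus_commute)
    then have "1 + (cmod w)\<^sup>2 \<le> 1 + (r + \<delta>)\<^sup>2" by (simp add: power_mono)
    then have "B * (1 + (cmod w)\<^sup>2) \<le> C3" unfolding C3_def using B(1) by (intro mult_left_mono) auto
    moreover have "cmod (K w) * (1 + (cmod w)\<^sup>2) \<le> B * (1 + (cmod w)\<^sup>2)"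
      using B(2)[OF True] by (intro mult_right_mono) auto
    ultimately have "cmod (K w) * (1 + (cmod w)\<^sup>2) \<le> C3" by linarith
    moreover have "0 < 1 + (cmod w)\<^sup>2" by (simp add: add_pos_nonneg)
    ultimately show ?thesis by (simp add: pos_le_divide_eq le_max_iff_disj)
  next
    case False
    then have d: "\<delta> < cmod (w - z)" by (simp add: dist_norm norm_minus_commute)
    have "1 + cmod w \<le> (1 + r) + cmod (w - z)" using norm_triangle_ineq2[of w z] cz by simp
    also have "1 + r \<le> (1 + r) / \<delta> * cmod (w - z)"
    proof -
      have "(1 + r) * 1 \<le> (1 + r) * (cmod (w - z) / \<delta>)"
        using d \<delta> r by (intro mult_left_mono) (auto simp: pos_le_divide_eq)
      then show ?thesis by simp
    qed
    finally have *: "1 + cmod w \<le> ((1 + r) / \<delta> + 1) * cmod (w - z)" by (simp add: algebra_simps)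
    have pw: "0 < 1 + cmod w" by (simp add: add_pos_nonneg)
    have "cmod (K w) = cmod (N w) / cmod (w - z)" using d \<delta> Nz by (auto simp: K_def norm_divide)
    also have "\<dots> \<le> (C1 / (1 + cmod w)) / cmod (w - z)" using bdN[OF w] by (intro divide_right_mono) auto
    also have "\<dots> \<le> (C1 / (1 + cmod w)) * (((1 + r) / \<delta> + 1) / (1 + cmod w))"
    proof -
      have "1 / cmod (w - z) \<le> ((1 + r) / \<delta> + 1) / (1 + cmod w)"
      proof -
        have "1 / x \<le> k / X" if "X \<le> k * x" "0 < X" "0 < x" for x k X :: real
          using that by (simp add: field_simps)
        from this[OF * pw] show ?thesis using d \<delta> by linarith
      qed
      then have "(C1 / (1 + cmod w)) * (1 / cmod (w - z)) \<le> (C1 / (1 + cmod w)) * (((1 + r) / \<delta> + 1) / (1 + cmod w))"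
        using C1 pw by (intro mult_left_mono) auto
      then show ?thesis by simp
    qed
    also have "\<dots> = C2 / (1 + cmod w)\<^sup>2" by (simp add: C2_def power2_eq_square)
    also have "\<dots> \<le> C2 / (1 + (cmod w)\<^sup>2)"
      using C2 pw by (intro divide_left_mono mult_pos_pos) (auto simp: power2_eq_square algebra_simps add_pos_nonneg)
    also have "\<dots> \<le> max C2 C3 / (1 + (cmod w)\<^sup>2)" by (intro divide_right_mono) auto
    finally show ?thesis .
  qed
  have split: "ray_int (\<sigma> * \<theta>) (\<lambda>w. q w / (w - z)) = ray_int (\<sigma> * \<theta>) K + q z * (- of_real \<sigma> * \<i> * pi)"
    if \<sigma>: "\<sigma> = 1 \<or> \<sigma> = -1" for \<sigma>
  proof -
    have \<theta>: "\<bar>\<sigma> * \<theta>\<bar> < \<alpha>" using \<sigma> \<phi> by auto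
    let ?w = "\<lambda>s. complex_of_real s * cis (\<sigma> * \<theta>)"
    have eq: "q (?w s) / (?w s - z) * cis (\<sigma> * \<theta>) = K (?w s) * cis (\<sigma> * \<theta>) + q z * (2 * z / ((?w s)\<^sup>2 - z\<^sup>2) * cis (\<sigma> * \<theta>))"
      if s: "s \<in> {0<..}" for s
    proof -
      have wD: "?w s \<in> D" using polar_in_sector[OF _ \<theta>] s by simp
      have "sin \<bar>\<sigma> * \<theta> - \<phi>\<bar> > 0" using \<sigma> \<phi> \<alpha>_less by (intro sin_gt_zero) auto
      then have "0 < max r s * sin \<bar>\<sigma> * \<theta> - \<phi>\<bar>" using r by (simp add: less_max_iff_disj)
      then have nz: "?w s \<noteq> z"
      proof -
        have "0 < cmod (?w s - z)"
          using dist_polar_ge[OF r, of s "\<sigma> * \<theta>" \<phi>] s \<open>sin \<bar>\<sigma> * \<theta> - \<phi>\<bar> > 0\<close>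
            \<open>0 < max r s * sin \<bar>\<sigma> * \<theta> - \<phi>\<bar>\<close> unfolding z_def greaterThan_iff by linarith
        then show ?thesis by auto
      qed
      have "a / (w - z) = (a - b * (2 * z / (w + z)) - 0) / (w - z) + b * (2 * z / (w\<^sup>2 - z\<^sup>2))"
        if "w - z \<noteq> 0" "w + z \<noteq> 0" for a b w
      proof -
        have "w\<^sup>2 - z\<^sup>2 = (w - z) * (w + z)" by (simp add: power2_eq_square algebra_simps)
        then show ?thesis using that by (simp add: diff_divide_distrib)
      qed
      from this[of "?w s" "q (?w s)" "q z"]
      have "q (?w s) / (?w s - z) = K (?w s) + q z * (2 * z / ((?w s)\<^sup>2 - z\<^sup>2))"
        using nz wz[OF wD] unfolding K_def Nz by (simp add: N_def)
      then show ?thesis by (simp add: distrib_right)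
    qed
    have "ray_int (\<sigma> * \<theta>) (\<lambda>w. q w / (w - z)) = (LINT s:{0<..}|lborel. K (?w s) * cis (\<sigma> * \<theta>) + q z * (2 * z / ((?w s)\<^sup>2 - z\<^sup>2) * cis (\<sigma> * \<theta>)))"
      unfolding ray_int_def by (rule set_lebesgue_integral_cong) (use eq in auto)
    also have "\<dots> = (LINT s:{0<..}|lborel. K (?w s) * cis (\<sigma> * \<theta>)) + (LINT s:{0<..}|lborel. q z * (2 * z / ((?w s)\<^sup>2 - z\<^sup>2) * cis (\<sigma> * \<theta>)))"
      using set_integrable_ray[OF holomorphic_on_imp_continuous_on[OF holK] bdK \<theta>] ray_int_model(1)[OF \<sigma> r \<phi>]
      by (intro set_integral_add set_integrable_mult_right) (auto simp: z_def)
    also have "\<dots> = ray_int (\<sigma> * \<theta>) K + q z * ray_int (\<sigma> * \<theta>) (\<lambda>w. 2 * z / (w\<^sup>2 - z\<^sup>2))"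
      by (simp only: ray_int_def set_integral_mult_right)
    also have "ray_int (\<sigma> * \<theta>) (\<lambda>w. 2 * z / (w\<^sup>2 - z\<^sup>2)) = - of_real \<sigma> * \<i> * pi"
      using ray_int_model(2)[OF \<sigma> r \<phi>] by (simp add: z_def)
    finally show ?thesis .
  qed
  have "ray_int (- \<theta>) K = ray_int \<theta> K"
    using \<phi> by (intro ray_int_indep[OF holK bdK]) auto
  then show ?thesis using split[of 1] split[of "-1"] by (simp add: algebra_simps)
qed

end

section \<open>Laplace transforms along rays\<close>

lemma norm_exp_minus_one_le: "cmod (exp u - 1) \<le> cmod u * exp (cmod u)"
proof -
  have "cmod (exp u - exp 0) \<le> exp (cmod u) * cmod (u - 0)"
  proof (rule field_differentiable_bound[where S = "cball 0 (cmod u)" and f' = exp])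
    show "(exp has_field_derivative exp w) (at w within cball 0 (cmod u))" for w
      by (rule has_field_derivative_at_within[OF DERIV_exp])
    show "cmod (exp w) \<le> exp (cmod u)" if "w \<in> cball 0 (cmod u)" for w
      using that order_trans[OF norm_exp, of w "exp (cmod u)"] by auto
  qed auto
  then show ?thesis by (simp add: mult.commute)
qed

lemma Re_mult_ray: "Re (\<omega> * (of_real s * c)) = s * Re (\<omega> * c)"
  by (simp add: algebra_simps)

lemma set_integrable_laplace:
  fixes b :: "real \<Rightarrow> complex"
  assumes [measurable]: "b \<in> borel_measurable borel" and bd: "AE s in lborel. 0 < s \<longrightarrow> cmod (b s) \<le> C * exp (- y * s)"
    and \<omega>: "Re (\<omega> * c) < y"
  shows "set_integrable lborel {0<..} (\<lambda>s. b s * exp (\<omega> * (of_real s * c)) * c)"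
proof (rule set_integrable_bound)
  show "set_integrable lborel {0<..} (\<lambda>s. C * cmod c * exp (- (y - Re (\<omega> * c)) * s))"
    using \<omega> by (intro set_integrable_exp) auto
  show "set_borel_measurable lborel {0<..} (\<lambda>s. b s * exp (\<omega> * (of_real s * c)) * c)"
    unfolding set_borel_measurable_def by measurable
  show "AE s in lborel. s \<in> {0<..} \<longrightarrow> norm (b s * exp (\<omega> * (of_real s * c)) * c)
      \<le> norm (C * cmod c * exp (- (y - Re (\<omega> * c)) * s))"
    using bd
  proof eventually_elim
    case (elim s)
    show ?case
    proof
      assume s: "s \<in> {0<..}"
      have "norm (b s * exp (\<omega> * (of_real s * c)) * c) = cmod (b s) * (exp (s * Re (\<omega> * c)) * cmod c)"
        by (simp only: norm_mult norm_exp_eq_Re Re_mult_ray mult.assoc)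
      also have "\<dots> \<le> (C * exp (- y * s)) * (exp (s * Re (\<omega> * c)) * cmod c)"
        using elim s by (intro mult_right_mono) auto
      also have "\<dots> = C * cmod c * (exp (- y * s) * exp (s * Re (\<omega> * c)))" by simp
      also have "\<dots> = C * cmod c * exp (- (y - Re (\<omega> * c)) * s)"
        by (simp only: exp_add[symmetric]) (simp add: algebra_simps)
      also have "\<dots> \<le> norm \<dots>" by simp
      finally show "norm (b s * exp (\<omega> * (of_real s * c)) * c) \<le> norm (C * cmod c * exp (- (y - Re (\<omega> * c)) * s))" .
    qed
  qed
qed

text \<open>Differentiation under the integral sign, carried out along arbitrary sequences so that
  dominated convergence applies.\<close>

lemma laplace_holomorphic:
  fixes b :: "real \<Rightarrow> complex"
  assumes b[measurable]: "b \<in> borel_measurable borel" and bd: "AE s in lborel. 0 < s \<longrightarrow> cmod (b s) \<le> C * exp (- y * s)"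
    and c: "cmod c = 1"
  shows "(\<lambda>\<omega>. LINT s:{0<..}|lborel. b s * exp (\<omega> * (of_real s * c)) * c) holomorphic_on {\<omega>. Re (\<omega> * c) < y}"
proof -
  let ?g = "\<lambda>\<omega>. LINT s:{0<..}|lborel. b s * exp (\<omega> * (of_real s * c)) * c"
  have int: "set_integrable lborel {0<..} (\<lambda>s. b s * exp (\<omega> * (of_real s * c)) * c)" if "Re (\<omega> * c) < y" for \<omega>
    by (rule set_integrable_laplace[OF b bd that])
  have "(?g has_field_derivative (LINT s:{0<..}|lborel. b s * exp (\<omega> * (of_real s * c)) * (of_real s * c) * c)) (at \<omega>)"
    if \<omega>: "Re (\<omega> * c) < y" for \<omega>
    unfolding has_field_derivative_iff tendsto_at_iff_sequentially
  proof (intro allI impI)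
    fix X :: "nat \<Rightarrow> complex"
    assume X: "\<forall>i. X i \<in> UNIV - {\<omega>}" "X \<longlonglongrightarrow> \<omega>"
    \<comment> \<open>A third of the available decay. The difference quotient of the exponential
      costs one factor \<open>exp (\<delta> * s)\<close>, the estimate of \<open>s\<close> by
      \<open>exp (\<delta> * s) / \<delta>\<close> costs a second one, and
      \<open>exp (- \<delta> * s)\<close> is left as integrable majorant. The shift by
      \<open>N\<close> below puts every increment within \<delta>.\<close>
    define \<delta> where "\<delta> = (y - Re (\<omega> * c)) / 3"
    have \<delta>: "\<delta> > 0" using \<omega> by (simp add: \<delta>_def)
    define C' where "C' = max C 0 / \<delta>"
    obtain N where N: "\<And>n. n \<ge> N \<Longrightarrow> cmod (X n - \<omega>) < \<delta>"
      using X(2) \<delta> unfolding lim_sequentially dist_norm by blast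
    define h where "h = (\<lambda>n. X (n + N) - \<omega>)"
    have h: "h n \<noteq> 0" "cmod (h n) < \<delta>" for n using X(1) N[of "n + N"] by (auto simp: h_def)
    have h0: "h \<longlonglongrightarrow> 0" unfolding h_def using LIMSEQ_ignore_initial_segment[OF X(2), of N] by (simp add: LIM_zero_iff)
    define q where "q = (\<lambda>n s. indicator {0<..} s *\<^sub>R (b s * exp (\<omega> * (of_real s * c)) * ((exp (h n * (of_real s * c)) - 1) / h n) * c))"
    define l where "l = (\<lambda>s. indicator {0<..} s *\<^sub>R (b s * exp (\<omega> * (of_real s * c)) * (of_real s * c) * c))"
    have eq: "(?g (\<omega> + h n) - ?g \<omega>) / h n = (\<integral>s. q n s \<partial>lborel)" for n
    proof -
      have "Re ((\<omega> + h n) * c) \<le> Re (\<omega> * c) + cmod (h n)"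
        using complex_Re_le_cmod[of "h n * c"] by (simp add: norm_mult c algebra_simps)
      then have "Re ((\<omega> + h n) * c) < y" using h(2)[of n] \<delta> by (simp add: \<delta>_def)
      then have "?g (\<omega> + h n) - ?g \<omega> = (LINT s:{0<..}|lborel. b s * exp ((\<omega> + h n) * (of_real s * c)) * c - b s * exp (\<omega> * (of_real s * c)) * c)"
        by (intro set_integral_diff(2)[symmetric] int \<omega>)
      then have "(?g (\<omega> + h n) - ?g \<omega>) / h n = (LINT s:{0<..}|lborel. (b s * exp ((\<omega> + h n) * (of_real s * c)) * c - b s * exp (\<omega> * (of_real s * c)) * c) / h n)"
        by simp
      also have "\<dots> = (\<integral>s. q n s \<partial>lborel)"
        unfolding set_lebesgue_integral_def q_def
        by (intro Bochner_Integration.integral_cong refl arg_cong2[where f = scaleR])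
          (simp add: distrib_right exp_add diff_divide_distrib algebra_simps)
      finally show ?thesis .
    qed
    have "(\<lambda>n. \<integral>s. q n s \<partial>lborel) \<longlonglongrightarrow> (\<integral>s. l s \<partial>lborel)"
    proof (rule integral_dominated_convergence)
      show "l \<in> borel_measurable lborel" "q n \<in> borel_measurable lborel" for n
        unfolding l_def q_def by measurable
      show "integrable lborel (\<lambda>s. indicator {0<..} s *\<^sub>R (C' * exp (- \<delta> * s)))"
        using set_integrable_exp[OF \<delta>, of C'] by (simp add: set_integrable_def)
      show "AE s in lborel. norm (q n s) \<le> indicator {0<..} s *\<^sub>R (C' * exp (- \<delta> * s))" for n
        using bd
      proof eventually_elim
        case (elim s)
        show ?case
        proof (cases "s \<in> {0<..}")
          case True
          then have s: "s > 0" by simp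
          have "cmod ((exp (h n * (of_real s * c)) - 1) / h n) \<le> (cmod (h n) * s * exp (cmod (h n) * s)) / cmod (h n)"
          proof -
            have "cmod (exp (h n * (of_real s * c)) - 1) \<le> cmod (h n) * s * exp (cmod (h n) * s)"
              using norm_exp_minus_one_le[of "h n * (of_real s * c)"] s by (simp add: norm_mult c)
            then show ?thesis unfolding norm_divide by (rule divide_right_mono) simp
          qed
          also have "\<dots> = s * exp (cmod (h n) * s)" using h(1)[of n] by simp
          also have "\<dots> \<le> s * exp (\<delta> * s)" using h(2)[of n] s by (intro mult_left_mono) auto
          also have "\<dots> \<le> (exp (\<delta> * s) / \<delta>) * exp (\<delta> * s)"
          proof (rule mult_right_mono)
            have "\<delta> * s \<le> exp (\<delta> * s)" using exp_ge_add_one_self[of "\<delta> * s"] by linarith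
            then show "s \<le> exp (\<delta> * s) / \<delta>" using \<delta> by (simp add: field_simps)
          qed simp
          finally have Q: "cmod ((exp (h n * (of_real s * c)) - 1) / h n) \<le> exp (\<delta> * s) / \<delta> * exp (\<delta> * s)" .
          have B: "cmod (b s) \<le> max C 0 * exp (- y * s)"
            using elim s by (smt (verit) exp_gt_zero mult_right_mono max.cobounded1)
          have "norm (q n s) = cmod (b s) * exp (s * Re (\<omega> * c)) * cmod ((exp (h n * (of_real s * c)) - 1) / h n)"
            unfolding q_def using s by (simp only: norm_mult norm_scaleR norm_exp_eq_Re Re_mult_ray c) simp
          also have "\<dots> \<le> (max C 0 * exp (- y * s)) * exp (s * Re (\<omega> * c)) * (exp (\<delta> * s) / \<delta> * exp (\<delta> * s))"
            using Q B \<delta> by (intro mult_mono) auto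
          also have "\<dots> = C' * (exp (- y * s) * exp (s * Re (\<omega> * c)) * exp (\<delta> * s) * exp (\<delta> * s))"
            by (simp add: C'_def)
          also have "exp (- y * s) * exp (s * Re (\<omega> * c)) * exp (\<delta> * s) * exp (\<delta> * s) = exp (- \<delta> * s)"
            unfolding exp_add[symmetric] by (rule arg_cong[where f = exp]) (simp add: \<delta>_def field_simps)
          finally show ?thesis using s by simp
        qed (simp add: q_def)
      qed
      show "AE s in lborel. (\<lambda>n. q n s) \<longlonglongrightarrow> l s"
      proof (rule AE_I2)
        fix s :: real
        have "((\<lambda>x. exp (x * (of_real s * c))) has_field_derivative (of_real s * c)) (at 0)"
          by (auto intro!: derivative_eq_intros)
        then have "((\<lambda>x. (exp (x * (of_real s * c)) - 1) / x) \<longlongrightarrow> of_real s * c) (at 0)"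
          by (simp add: has_field_derivative_iff)
        moreover have "filterlim h (at 0) sequentially"
          unfolding filterlim_at using h0 h(1) by auto
        ultimately have "(\<lambda>n. (exp (h n * (of_real s * c)) - 1) / h n) \<longlonglongrightarrow> of_real s * c"
          by (rule filterlim_compose)
        then show "(\<lambda>n. q n s) \<longlonglongrightarrow> l s"
          unfolding q_def l_def by (intro tendsto_intros)
      qed
    qed
    then have "(\<lambda>n. (?g (\<omega> + h n) - ?g \<omega>) / h n) \<longlonglongrightarrow> (LINT s:{0<..}|lborel. b s * exp (\<omega> * (of_real s * c)) * (of_real s * c) * c)"
      unfolding eq unfolding l_def set_lebesgue_integral_def .
    then have "(\<lambda>n. (?g (X (n + N)) - ?g \<omega>) / (X (n + N) - \<omega>)) \<longlonglongrightarrow> (LINT s:{0<..}|lborel. b s * exp (\<omega> * (of_real s * c)) * (of_real s * c) * c)"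
      by (simp add: h_def)
    then show "((\<lambda>y. (?g y - ?g \<omega>) / (y - \<omega>)) \<circ> X) \<longlonglongrightarrow> (LINT s:{0<..}|lborel. b s * exp (\<omega> * (of_real s * c)) * (of_real s * c) * c)"
      unfolding o_def by (rule LIMSEQ_offset)
  qed
  then show ?thesis
    unfolding holomorphic_on_def field_differentiable_def by (blast intro: has_field_derivative_at_within)
qed

section \<open>Borel representatives of the boundary values\<close>

locale exp_type_sector = sector_angle +
  fixes h :: real and f :: "complex \<Rightarrow> complex"
  assumes h: "0 \<le> h" and hol: "f holomorphic_on D" and exp_type: "exp_type_at_most h f D"
begin

lemma f_bound:
  assumes "0 < \<epsilon>"
  obtains C where "0 \<le> C" "\<And>z. z \<in> D \<Longrightarrow> cmod (f z) \<le> C * exp ((h + \<epsilon>) * cmod z)"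
  using exp_type assms unfolding exp_type_at_most_def by blast

text \<open>The operator \<open>lim\<close> applied to a sequence of Borel functions is Borel
  measurable even where the sequence diverges; there the value is arbitrary. Such a representative
  of the boundary values is needed for Fubini's theorem.\<close>

definition edge :: "real \<Rightarrow> real \<Rightarrow> complex" where
  "edge \<sigma> s = lim (\<lambda>n. indicator {0<..} s *\<^sub>R f (of_real s * cis (\<sigma> * angle_seq n)))"

lemma borel_measurable_ray:
  fixes K :: "complex \<Rightarrow> complex"
  assumes "continuous_on D K" "\<bar>\<theta>\<bar> < \<alpha>"
  shows "(\<lambda>s. indicator {0<..} s *\<^sub>R K (of_real s * cis \<theta>)) \<in> borel_measurable borel"
  using borel_measurable_continuous_on_indicator[OF _ continuous_on_ray[OF assms]] by simp

lemma edge_measurable[measurable]: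
  assumes "\<sigma> = 1 \<or> \<sigma> = -1"
  shows "edge \<sigma> \<in> borel_measurable borel"
proof -
  have "\<bar>\<sigma> * angle_seq n\<bar> < \<alpha>" for n using assms angle_seq[of n] by auto
  then have [measurable]: "(\<lambda>s. indicator {0<..} s *\<^sub>R f (of_real s * cis (\<sigma> * angle_seq n))) \<in> borel_measurable borel" for n
    by (intro borel_measurable_ray holomorphic_on_imp_continuous_on[OF hol])
  show ?thesis unfolding edge_def[abs_def] by measurable
qed

lemma edge_AE:
  assumes "\<sigma> = 1 \<or> \<sigma> = -1"
  shows "AE s in lborel. 0 < s \<longrightarrow> (\<lambda>n. f (of_real s * cis (\<sigma> * angle_seq n))) \<longlonglongrightarrow> edge \<sigma> s
    \<and> edge \<sigma> s = boundary_ext D f (of_real s * cis (\<sigma> * \<alpha>))"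
proof -
  obtain C where C: "0 \<le> C" "\<And>z. z \<in> D \<Longrightarrow> cmod (f z) \<le> C * exp ((h + 1) * cmod z)"
    using f_bound[of 1] by auto
  have "AE s in lborel. 0 < s \<longrightarrow> (\<lambda>n. f (of_real s * cis (\<sigma> * angle_seq n)))
      \<longlonglongrightarrow> boundary_ext D f (of_real s * cis (\<sigma> * \<alpha>))"
    using fatou_exp_type[OF assms hol C(2) C(1)] h by (simp add: AE_completion_iff)
  then show ?thesis
  proof eventually_elim
    case (elim s)
    then show ?case using limI by (fastforce simp: edge_def)
  qed
qed

lemma edge_bound_AE:
  assumes "0 < \<epsilon>"
  obtains C where "0 \<le> C"
    "\<And>\<sigma>. \<sigma> = 1 \<or> \<sigma> = -1 \<Longrightarrow> AE s in lborel. 0 < s \<longrightarrow> cmod (edge \<sigma> s) \<le> C * exp ((h + \<epsilon>) * s)"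
proof -
  obtain C where C: "0 \<le> C" "\<And>z. z \<in> D \<Longrightarrow> cmod (f z) \<le> C * exp ((h + \<epsilon>) * cmod z)"
    using f_bound[OF assms] by auto
  have "AE s in lborel. 0 < s \<longrightarrow> cmod (edge \<sigma> s) \<le> C * exp ((h + \<epsilon>) * s)" if \<sigma>: "\<sigma> = 1 \<or> \<sigma> = -1" for \<sigma>
    using edge_AE[OF \<sigma>]
  proof eventually_elim
    case (elim s)
    have "\<bar>\<sigma> * \<alpha>\<bar> \<le> \<alpha>" using \<sigma> \<alpha>_pos by auto
    then show ?case using elim boundary_ext_bound[OF C(2) C(1), of s "\<sigma> * \<alpha>"] by auto
  qed
  then show ?thesis using that C by blast
qed

text \<open>A Borel function agreeing almost everywhere with the boundary values along the ray, which by
  themselves are only Lebesgue measurable.\<close>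

lemma ray_version:
  assumes "\<bar>\<theta>\<bar> \<le> \<alpha>"
  obtains b where "b \<in> borel_measurable borel" "AE s in lborel. 0 < s \<longrightarrow> b s = boundary_ext D f (of_real s * cis \<theta>)"
proof (cases "\<bar>\<theta>\<bar> < \<alpha>")
  case True
  show ?thesis
  proof (rule that)
    show "(\<lambda>s. indicator {0<..} s *\<^sub>R f (of_real s * cis \<theta>)) \<in> borel_measurable borel"
      by (intro borel_measurable_ray holomorphic_on_imp_continuous_on[OF hol] True)
    show "AE s in lborel. 0 < s \<longrightarrow> indicator {0<..} s *\<^sub>R f (of_real s * cis \<theta>) = boundary_ext D f (of_real s * cis \<theta>)"
      using polar_in_sector[OF _ True] by (intro AE_I2) (auto simp: boundary_ext_interior)
  qed
next
  case False
  then have "\<theta> = \<alpha> \<or> \<theta> = - \<alpha>" using assms by linarith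
  then obtain \<sigma> :: real where \<sigma>: "\<sigma> = 1 \<or> \<sigma> = -1" "\<theta> = \<sigma> * \<alpha>"
    using that[of 1] that[of "-1"] by auto
  show ?thesis
  proof (rule that)
    show "edge \<sigma> \<in> borel_measurable borel" by (rule edge_measurable[OF \<sigma>(1)])
    show "AE s in lborel. 0 < s \<longrightarrow> edge \<sigma> s = boundary_ext D f (of_real s * cis \<theta>)"
      unfolding \<sigma>(2) using edge_AE[OF \<sigma>(1)] by eventually_elim auto
  qed
qed

text \<open>Passage from the Lebesgue integral over the closed half-line to a Borel integral over
  the open one. Equality almost everywhere with a measurable function also supplies Lebesgue
  measurability of the original integrand.\<close>

lemma dir_laplace_eq:
  assumes [measurable]: "b \<in> borel_measurable borel" and b: "AE s in lborel. 0 < s \<longrightarrow> b s = boundary_ext D f (of_real s * cis \<theta>)"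
  shows "dir_laplace \<alpha> f \<theta> \<omega> = 1 / (2 * of_real pi * \<i>) * (LINT s:{0<..}|lborel. b s * exp (\<omega> * (of_real s * cis \<theta>)) * cis \<theta>)"
proof -
  let ?L = "\<lambda>t. indicator {0..} t *\<^sub>R (boundary_ext D f (of_real t * cis \<theta>) * exp (\<omega> * (of_real t * cis \<theta>)) * cis \<theta>)"
  let ?R = "\<lambda>t. indicator {0<..} t *\<^sub>R (b t * exp (\<omega> * (of_real t * cis \<theta>)) * cis \<theta>)"
  have vd: "vector_derivative (\<lambda>s. of_real s * cis \<theta>) (at t) = cis \<theta>" for t
    by (rule vector_derivative_at[OF has_vector_derivative_ray])
  have R: "?R \<in> borel_measurable lborel" by measurable
  have "AE t in lborel. t \<noteq> 0" by (rule AE_lborel_singleton)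
  with b have "AE t in lborel. ?R t = ?L t"
    by eventually_elim (auto simp: indicator_def)
  then have ae: "AE t in lebesgue. ?R t = ?L t" by (simp add: AE_completion_iff)
  have R': "?R \<in> borel_measurable lebesgue" using R by (rule measurable_completion)
  have "(\<integral>t. ?L t \<partial>lebesgue) = (\<integral>t. ?R t \<partial>lebesgue)"
    using ae borel_measurable_AE[OF R' ae] R' by (intro integral_cong_AE) auto
  also have "\<dots> = (\<integral>t. ?R t \<partial>lborel)" by (rule integral_completion[OF R])
  finally show ?thesis
    unfolding dir_laplace_def line_integral_def vd set_lebesgue_integral_def by simp
qed

end

text \<open>Taylor bounds for the exponential from below. The two forms fit the decay hypotheses of
  Cauchy's formula and of the rotation of rays, respectively.\<close>

lemma exp_decay_le:
  fixes k x :: real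
  assumes "0 < k" "0 \<le> x"
  shows "exp (- k * x) \<le> 1 / min 1 k / (1 + x)" "exp (- k * x) \<le> 1 / min 1 (k\<^sup>2 / 2) / (1 + x\<^sup>2)"
proof -
  have inv: "exp (- k * x) \<le> 1 / m / X" if "m * X \<le> exp (k * x)" "0 < m" "0 < X" for m X
  proof -
    have "inverse (exp (k * x)) \<le> inverse (m * X)"
      using that by (intro le_imp_inverse_le mult_pos_pos) auto
    then show ?thesis by (simp add: exp_minus divide_inverse)
  qed
  have "min 1 k * (1 + x) \<le> exp (k * x)"
  proof -
    have "min 1 k * x \<le> k * x" "min 1 k \<le> 1" using assms by (auto intro: mult_right_mono)
    then show ?thesis using exp_ge_add_one_self[of "k * x"] unfolding distrib_left by linarith
  qed
  then show "exp (- k * x) \<le> 1 / min 1 k / (1 + x)"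
    using assms by (intro inv) auto
  have "min 1 (k\<^sup>2 / 2) * (1 + x\<^sup>2) \<le> exp (k * x)"
  proof -
    have "min 1 (k\<^sup>2 / 2) * x\<^sup>2 \<le> k\<^sup>2 / 2 * x\<^sup>2" by (intro mult_right_mono) auto
    moreover have "min 1 (k\<^sup>2 / 2) \<le> 1" "0 \<le> k * x" using assms by auto
    moreover have "(k * x)\<^sup>2 / 2 = k\<^sup>2 / 2 * x\<^sup>2" by (simp add: power_mult_distrib)
    ultimately show ?thesis using exp_lower_Taylor_quadratic[of "k * x"] unfolding distrib_left by linarith
  qed
  then show "exp (- k * x) \<le> 1 / min 1 (k\<^sup>2 / 2) / (1 + x\<^sup>2)"
    using assms by (intro inv) (auto simp: add_pos_nonneg)
qed

section \<open>Cauchy's formula on the edges\<close>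

context exp_type_sector
begin

text \<open>Dominated convergence from interior rays to an edge. The bound is required only from
  index \<open>N\<close> on, because a kernel with pole \<open>z\<close> is under control only after
  the rays have moved past \<open>z\<close>.\<close>

lemma edge_limit:
  assumes \<sigma>: "\<sigma> = 1 \<or> \<sigma> = -1" and c: "0 < c"
    and cont: "\<And>n. N \<le> n \<Longrightarrow> continuous_on {0<..} (\<lambda>s. k (of_real s * cis (\<sigma> * angle_seq n)))"
    and contE: "continuous_on {0<..} (\<lambda>s. k (of_real s * cis (\<sigma> * \<alpha>)))"
    and lim: "\<And>s. 0 < s \<Longrightarrow> (\<lambda>n. k (of_real s * cis (\<sigma> * angle_seq n))) \<longlonglongrightarrow> k (of_real s * cis (\<sigma> * \<alpha>))"
    and bd: "\<And>s n. 0 < s \<Longrightarrow> N \<le> n \<Longrightarrow>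
      cmod (f (of_real s * cis (\<sigma> * angle_seq n)) * k (of_real s * cis (\<sigma> * angle_seq n))) \<le> C * exp (- c * s)"
  shows "(\<lambda>n. ray_int (\<sigma> * angle_seq n) (\<lambda>w. f w * k w)) \<longlonglongrightarrow>
     (LINT s:{0<..}|lborel. edge \<sigma> s * k (of_real s * cis (\<sigma> * \<alpha>)) * cis (\<sigma> * \<alpha>))"
proof (rule LIMSEQ_offset[where k = N])
  let ?w = "\<lambda>n s. complex_of_real s * cis (\<sigma> * angle_seq n)"
  have \<theta>: "\<bar>\<sigma> * angle_seq n\<bar> < \<alpha>" for n using \<sigma> angle_seq[of n] by auto
  show "(\<lambda>n. ray_int (\<sigma> * angle_seq (n + N)) (\<lambda>w. f w * k w)) \<longlonglongrightarrow>
     (LINT s:{0<..}|lborel. edge \<sigma> s * k (of_real s * cis (\<sigma> * \<alpha>)) * cis (\<sigma> * \<alpha>))"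
    unfolding ray_int_def set_lebesgue_integral_def
  proof (rule integral_dominated_convergence)
    show "integrable lborel (\<lambda>s. indicator {0<..} s *\<^sub>R (C * exp (- c * s)))"
      using set_integrable_exp[OF c, of C] by (simp add: set_integrable_def)
    show "(\<lambda>s. indicator {0<..} s *\<^sub>R (f (?w (n + N) s) * k (?w (n + N) s) * cis (\<sigma> * angle_seq (n + N)))) \<in> borel_measurable lborel" for n
    proof -
      have "continuous_on {0<..} (\<lambda>s. f (?w (n + N) s) * k (?w (n + N) s) * cis (\<sigma> * angle_seq (n + N)))"
        by (intro continuous_intros cont continuous_on_ray holomorphic_on_imp_continuous_on[OF hol] \<theta>) auto
      from borel_measurable_continuous_on_indicator[OF _ this] show ?thesis by simp
    qed
    have [measurable]: "edge \<sigma> \<in> borel_measurable borel" by (rule edge_measurable[OF \<sigma>])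
    have [measurable]: "(\<lambda>s. indicator {0<..} s *\<^sub>R k (of_real s * cis (\<sigma> * \<alpha>))) \<in> borel_measurable borel"
      using borel_measurable_continuous_on_indicator[OF _ contE] by simp
    have "(\<lambda>s. edge \<sigma> s * (indicator {0<..} s *\<^sub>R k (of_real s * cis (\<sigma> * \<alpha>))) * cis (\<sigma> * \<alpha>)) \<in> borel_measurable lborel"
      by measurable
    then show "(\<lambda>s. indicator {0<..} s *\<^sub>R (edge \<sigma> s * k (of_real s * cis (\<sigma> * \<alpha>)) * cis (\<sigma> * \<alpha>))) \<in> borel_measurable lborel"
      by (simp add: mult.assoc)
    show "AE s in lborel. norm (indicator {0<..} s *\<^sub>R (f (?w (n + N) s) * k (?w (n + N) s) * cis (\<sigma> * angle_seq (n + N))))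
       \<le> indicator {0<..} s *\<^sub>R (C * exp (- c * s))" for n
      using bd[of _ "n + N"] by (intro AE_I2) (auto simp: indicator_def norm_mult)
    show "AE s in lborel. (\<lambda>n. indicator {0<..} s *\<^sub>R (f (?w (n + N) s) * k (?w (n + N) s) * cis (\<sigma> * angle_seq (n + N))))
       \<longlonglongrightarrow> indicator {0<..} s *\<^sub>R (edge \<sigma> s * k (of_real s * cis (\<sigma> * \<alpha>)) * cis (\<sigma> * \<alpha>))"
      using edge_AE[OF \<sigma>]
    proof eventually_elim
      case (elim s)
      show ?case
      proof (cases "0 < s")
        case True
        have "(\<lambda>n. f (?w n s) * k (?w n s) * cis (\<sigma> * angle_seq n)) \<longlonglongrightarrow> edge \<sigma> s * k (of_real s * cis (\<sigma> * \<alpha>)) * cis (\<sigma> * \<alpha>)"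
          using elim True lim[OF True] cis_angle_seq_tendsto[of 1 \<sigma>] by (intro tendsto_mult) auto
        from LIMSEQ_ignore_initial_segment[OF this, of N] True show ?thesis by simp
      qed simp
    qed
  qed
qed

lemma sector_cauchy_edge:
  assumes p: "p * cos \<alpha> < - h" and z: "z \<in> D"
  defines "E \<equiv> \<lambda>\<sigma>. LINT s:{0<..}|lborel. edge \<sigma> s * (exp (of_real p * (of_real s * cis (\<sigma> * \<alpha>) - z)) / (of_real s * cis (\<sigma> * \<alpha>) - z)) * cis (\<sigma> * \<alpha>)"
  shows "E (-1) - E 1 = 2 * pi * \<i> * f z"
proof -
  \<comment> \<open>Half of the margin in the hypothesis on \<open>p\<close>: then
    \<open>h + c + p * cos \<alpha>\<close> equals \<open>- c\<close>, so growth of \<open>f\<close>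
    with the excess \<open>c\<close> still leaves decay at rate \<open>c\<close>.\<close>
  define c where "c = - (p * cos \<alpha> + h) / 2"
  have c: "c > 0" using p by (simp add: c_def)
  obtain C where C: "0 \<le> C" "\<And>z. z \<in> D \<Longrightarrow> cmod (f z) \<le> C * exp ((h + c) * cmod z)"
    using f_bound[OF c] by auto
  have p0: "p < 0"
  proof (rule ccontr)
    assume "\<not> p < 0"
    then have "0 \<le> p * cos \<alpha>" using sin_cos_\<alpha> by simp
    then show False using p h by simp
  qed
  obtain r \<phi> where r: "0 < r" and \<phi>: "\<bar>\<phi>\<bar> < \<alpha>" and zr: "z = of_real r * cis \<phi>" using sector_polarE[OF z] .
  define q where "q = (\<lambda>w. f w * exp (of_real p * (w - z)))"
  define C1 where "C1 = C * exp (- p * Re z)"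
  have C1: "0 \<le> C1" using C by (simp add: C1_def)
  have bq: "cmod (q w) \<le> C1 * exp (- c * cmod w)" if w: "w \<in> D" for w
  proof -
    have "p * Re w \<le> p * (cmod w * cos \<alpha>)" using Re_sector[OF w] p0 by (intro mult_left_mono_neg) auto
    then have e: "(h + c) * cmod w + p * Re w \<le> - c * cmod w" by (simp add: c_def field_simps)
    have "cmod (q w) \<le> (C * exp ((h + c) * cmod w)) * exp (p * Re w - p * Re z)"
      unfolding q_def using C(2)[OF w] by (simp add: norm_mult right_diff_distrib mult_right_mono)
    also have "\<dots> = C1 * exp ((h + c) * cmod w + p * Re w)"
      unfolding C1_def by (simp add: exp_add exp_diff exp_minus field_simps)
    also have "\<dots> \<le> C1 * exp (- c * cmod w)" using e C1 by (intro mult_left_mono) auto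
    finally show ?thesis .
  qed
  have holq: "q holomorphic_on D" unfolding q_def by (intro holomorphic_intros hol)
  have bq': "cmod (q w) \<le> (C1 / min 1 c) / (1 + cmod w)" if w: "w \<in> D" for w
  proof -
    have "C1 * exp (- c * cmod w) \<le> C1 * (1 / min 1 c / (1 + cmod w))"
      using exp_decay_le(1)[OF c, of "cmod w"] C1 by (intro mult_left_mono) auto
    then show ?thesis using bq[OF w] by simp
  qed
  let ?k = "\<lambda>w. exp (of_real p * (w - z)) / (w - z)"
  have lim: "(\<lambda>n. ray_int (\<sigma> * angle_seq n) (\<lambda>w. q w / (w - z))) \<longlonglongrightarrow> E \<sigma>" if \<sigma>: "\<sigma> = 1 \<or> \<sigma> = -1" for \<sigma>
  proof -
    have \<theta>: "\<bar>\<sigma> * angle_seq n\<bar> < \<alpha>" for n using \<sigma> angle_seq[of n] by auto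
    \<comment> \<open>Half of the limiting sine, so that eventually all rays keep distance at least
      \<open>r * c0\<close> from \<open>z\<close>.\<close>
    define c0 where "c0 = sin \<bar>\<sigma> * \<alpha> - \<phi>\<bar> / 2"
    have s0: "sin \<bar>\<sigma> * \<alpha> - \<phi>\<bar> > 0" using \<sigma> \<phi> \<alpha>_less by (intro sin_gt_zero) auto
    then have c0: "c0 > 0" by (simp add: c0_def)
    have "(\<lambda>n. sin \<bar>\<sigma> * angle_seq n - \<phi>\<bar>) \<longlonglongrightarrow> sin \<bar>\<sigma> * \<alpha> - \<phi>\<bar>"
      by (intro tendsto_intros angle_seq_tendsto)
    then have "\<forall>\<^sub>F n in sequentially. c0 < sin \<bar>\<sigma> * angle_seq n - \<phi>\<bar>"
      by (rule order_tendstoD) (use s0 in \<open>simp add: c0_def\<close>)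
    then obtain N where N: "\<And>n. N \<le> n \<Longrightarrow> c0 < sin \<bar>\<sigma> * angle_seq n - \<phi>\<bar>"
      unfolding eventually_sequentially by blast
    have far: "r * c0 \<le> cmod (of_real s * cis (\<sigma> * angle_seq n) - z)" if "0 < s" "N \<le> n" for s n
    proof -
      have "r * c0 \<le> max r s * sin \<bar>\<sigma> * angle_seq n - \<phi>\<bar>" 
        using N[OF that(2)] r c0 by (intro mult_mono) auto
      then show ?thesis using dist_polar_ge[OF r that(1), of "\<sigma> * angle_seq n" \<phi>] N[OF that(2)] c0 by (simp add: zr)
    qed
    have rc: "0 < r * c0" using r c0 by simp
    have nzE: "of_real s * cis (\<sigma> * \<alpha>) - z \<noteq> 0" if "0 < s" for s
      using edge_not_in_sector[OF \<sigma>, of s] z by auto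
    have "(\<lambda>n. ray_int (\<sigma> * angle_seq n) (\<lambda>w. f w * ?k w)) \<longlonglongrightarrow> E \<sigma>"
      unfolding E_def
    proof (rule edge_limit[OF \<sigma> c])
      show "continuous_on {0<..} (\<lambda>s. ?k (of_real s * cis (\<sigma> * angle_seq n)))" if "N \<le> n" for n
      proof -
        have "of_real s * cis (\<sigma> * angle_seq n) - z \<noteq> 0" if "s \<in> {0<..}" for s
        proof
          assume "of_real s * cis (\<sigma> * angle_seq n) - z = 0"
          then show False using far[OF _ \<open>N \<le> n\<close>, of s] that rc by simp
        qed
        then show ?thesis by (intro continuous_intros) blast
      qed
      show "continuous_on {0<..} (\<lambda>s. ?k (of_real s * cis (\<sigma> * \<alpha>)))"
        using nzE by (intro continuous_intros) auto
      show "(\<lambda>n. ?k (of_real s * cis (\<sigma> * angle_seq n))) \<longlonglongrightarrow> ?k (of_real s * cis (\<sigma> * \<alpha>))" if "0 < s" for s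
        using nzE[OF that] by (intro tendsto_intros cis_angle_seq_tendsto)
      fix s :: real and n assume s: "0 < s" and n: "N \<le> n"
      let ?w = "of_real s * cis (\<sigma> * angle_seq n)"
      have "cmod (f ?w * ?k ?w) = cmod (q ?w) / cmod (?w - z)"
        by (simp add: q_def norm_divide norm_mult)
      also have "\<dots> \<le> (C1 * exp (- c * s)) / (r * c0)"
        using bq[OF polar_in_sector[OF s \<theta>[of n]]] far[OF s n] rc s C1
        by (intro frac_le) (auto simp: norm_mult)
      also have "\<dots> = C1 / (r * c0) * exp (- c * s)" by simp
      finally show "cmod (f ?w * ?k ?w) \<le> C1 / (r * c0) * exp (- c * s)" .
    qed
    then show ?thesis by (simp add: q_def)
  qed
  have "(\<lambda>n. ray_int (-1 * angle_seq n) (\<lambda>w. q w / (w - z)) - ray_int (1 * angle_seq n) (\<lambda>w. q w / (w - z))) \<longlonglongrightarrow> E (-1) - E 1"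
    by (intro tendsto_diff lim) auto
  \<comment> \<open>As soon as the angle exceeds that of \<open>z\<close>, the point lies between
    the two rays and the difference no longer depends on \<open>n\<close>.\<close>
  moreover have "\<forall>\<^sub>F n in sequentially. ray_int (-1 * angle_seq n) (\<lambda>w. q w / (w - z)) - ray_int (1 * angle_seq n) (\<lambda>w. q w / (w - z)) = 2 * pi * \<i> * f z"
    using order_tendstoD(1)[OF angle_seq_tendsto \<phi>]
  proof eventually_elim
    case (elim n)
    have "q z = f z" by (simp add: q_def)
    then show ?case
      using sector_cauchy[OF holq bq' r elim angle_seq(2)] by (simp add: zr)
  qed
  then have "(\<lambda>n. ray_int (-1 * angle_seq n) (\<lambda>w. q w / (w - z)) - ray_int (1 * angle_seq n) (\<lambda>w. q w / (w - z))) \<longlonglongrightarrow> 2 * pi * \<i> * f z"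
    by (rule tendsto_eventually)
  ultimately show ?thesis by (rule LIMSEQ_unique)
qed

section \<open>Half-planes and consistency of the directional transforms\<close>

lemma indicator_le:
  assumes \<theta>: "\<bar>\<theta>\<bar> \<le> \<alpha>"
  shows "indicator_fun \<alpha> f \<theta> \<le> ereal h"
proof (rule ereal_le_epsilon2)
  fix \<epsilon> :: real assume \<epsilon>: "0 < \<epsilon>"
  \<comment> \<open>Half of \<epsilon> goes into the growth exponent; the other half absorbs the
    constant, since \<open>ln C\<close> is at most \<open>\<epsilon> / 2 * s\<close> once
    \<open>s\<close> is large.\<close>
  obtain C0 where C0: "0 \<le> C0" "\<And>z. z \<in> D \<Longrightarrow> cmod (f z) \<le> C0 * exp ((h + \<epsilon> / 2) * cmod z)"
    using f_bound[of "\<epsilon> / 2"] \<epsilon> by auto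
  define C where "C = max C0 1"
  have C: "C \<ge> 1" by (simp add: C_def)
  let ?B = "\<lambda>s. cmod (boundary_ext D f (of_real s * cis \<theta>))"
  show "indicator_fun \<alpha> f \<theta> \<le> ereal h + ereal \<epsilon>"
    unfolding indicator_fun_def
  proof (rule Limsup_bounded)
    show "\<forall>\<^sub>F s in at_top. ln_ereal (?B s) / ereal s \<le> ereal h + ereal \<epsilon>"
      using eventually_gt_at_top[of 0] eventually_ge_at_top[of "2 * ln C / \<epsilon>"]
    proof eventually_elim
      case (elim s)
      show ?case
      proof (cases "?B s = 0")
        case True
        then show ?thesis using elim(1) by (simp add: ln_ereal_def)
      next
        case False
        have "?B s \<le> C0 * exp ((h + \<epsilon> / 2) * s)" by (rule boundary_ext_bound[OF C0(2) C0(1) elim(1) \<theta>])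
        also have "\<dots> \<le> C * exp ((h + \<epsilon> / 2) * s)" by (intro mult_right_mono) (auto simp: C_def)
        finally have "ln (?B s) \<le> ln (C * exp ((h + \<epsilon> / 2) * s))"
          using False C by (subst ln_le_cancel_iff) auto
        also have "\<dots> = ln C + (h + \<epsilon> / 2) * s" using C by (simp add: ln_mult)
        also have "ln C \<le> \<epsilon> / 2 * s" using elim \<epsilon> by (simp add: field_simps)
        finally have "ln (?B s) \<le> (h + \<epsilon>) * s" by (simp add: algebra_simps)
        then have "ln (?B s) / s \<le> h + \<epsilon>" using elim(1) by (simp add: field_simps)
        then show ?thesis using False elim(1) by (simp add: ln_ereal_def)
      qed
    qed
  qed
qed

lemma in_halfplaneI:
  assumes "\<bar>\<theta>\<bar> \<le> \<alpha>" "Re (\<omega> * cis \<theta>) < - h"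
  shows "\<omega> \<in> laplace_halfplane \<alpha> f \<theta>"
proof -
  have "ereal (Re (\<omega> * cis \<theta>)) < - ereal h" using assms(2) by simp
  also have "\<dots> \<le> - indicator_fun \<alpha> f \<theta>"
    unfolding ereal_minus_le_minus by (rule indicator_le[OF assms(1)])
  finally show ?thesis by (simp add: laplace_halfplane_def)
qed

text \<open>Any \<open>y\<close> strictly between \<open>Re (\<omega> * cis \<theta>)\<close> and
  the negative of the indicator serves: the limit superior gives the bound for large
  \<open>s\<close>, and exponential type covers the bounded remainder of the ray.\<close>

lemma halfplane_bound:
  assumes \<theta>: "\<bar>\<theta>\<bar> \<le> \<alpha>" and \<omega>: "\<omega> \<in> laplace_halfplane \<alpha> f \<theta>"
  obtains y C where "Re (\<omega> * cis \<theta>) < y"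
    "\<And>s. 0 < s \<Longrightarrow> cmod (boundary_ext D f (of_real s * cis \<theta>)) \<le> C * exp (- y * s)"
proof -
  let ?B = "\<lambda>s. cmod (boundary_ext D f (of_real s * cis \<theta>))"
  have "ereal (Re (\<omega> * cis \<theta>)) < - indicator_fun \<alpha> f \<theta>" using \<omega> by (simp add: laplace_halfplane_def)
  then obtain y where y: "ereal (Re (\<omega> * cis \<theta>)) < ereal y" "ereal y < - indicator_fun \<alpha> f \<theta>"
    using ereal_dense2 by blast
  then have "indicator_fun \<alpha> f \<theta> < - ereal y" using ereal_less_uminus_reorder by blast
  then have "\<forall>\<^sub>F s in at_top. ln_ereal (?B s) / ereal s < - ereal y"
    unfolding indicator_fun_def by (rule Limsup_lessD)
  then obtain s1 where s1: "\<And>s. s \<ge> s1 \<Longrightarrow> ln_ereal (?B s) / ereal s < - ereal y"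
    unfolding eventually_at_top_linorder by blast
  define s0 where "s0 = max s1 1"
  have s0: "s0 > 0" by (simp add: s0_def)
  obtain C0 where C0: "0 \<le> C0" "\<And>z. z \<in> D \<Longrightarrow> cmod (f z) \<le> C0 * exp ((h + 1) * cmod z)"
    using f_bound[of 1] by auto
  \<comment> \<open>The last factor compensates \<open>exp (- y * s)\<close>, which may be small for
    \<open>s\<close> below \<open>s0\<close>.\<close>
  define C1 where "C1 = C0 * exp ((h + 1) * s0) * exp (\<bar>y\<bar> * s0)"
  have bd: "?B s \<le> max 1 C1 * exp (- y * s)" if s: "0 < s" for s
  proof (cases "s \<ge> s0")
    case True
    then have l: "ln_ereal (?B s) / ereal s < - ereal y" using s1 by (simp add: s0_def)
    have "?B s \<le> 1 * exp (- y * s)"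
    proof (cases "?B s = 0")
      case False
      then have "ln (?B s) / s < - y" using l s by (simp add: ln_ereal_def)
      then have "ln (?B s) < - y * s" using s by (simp add: pos_divide_less_eq)
      then show ?thesis using ln_ge_iff[of "?B s" "- y * s"] False norm_ge_zero[of "boundary_ext D f (of_real s * cis \<theta>)"]
        by linarith
    qed simp
    also have "\<dots> \<le> max 1 C1 * exp (- y * s)" by (intro mult_right_mono) auto
    finally show ?thesis .
  next
    case False
    have "?B s \<le> C0 * exp ((h + 1) * s)" by (rule boundary_ext_bound[OF C0(2) C0(1) s \<theta>])
    also have "\<dots> \<le> C0 * (exp ((h + 1) * s0) * (exp (\<bar>y\<bar> * s0) * exp (- y * s)))"
    proof (intro mult_left_mono C0(1))
      have "exp ((h + 1) * s) \<le> exp ((h + 1) * s0)" using False h by (simp add: mult_left_mono)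
      moreover have "1 \<le> exp (\<bar>y\<bar> * s0) * exp (- y * s)"
      proof -
        have "y * s \<le> \<bar>y\<bar> * s0" using False s by (intro mult_mono) auto
        then show ?thesis by (simp add: exp_add[symmetric])
      qed
      ultimately have "exp ((h + 1) * s) * 1 \<le> exp ((h + 1) * s0) * (exp (\<bar>y\<bar> * s0) * exp (- y * s))"
        by (intro mult_mono) auto
      then show "exp ((h + 1) * s) \<le> exp ((h + 1) * s0) * (exp (\<bar>y\<bar> * s0) * exp (- y * s))" by simp
    qed
    also have "\<dots> = C1 * exp (- y * s)" by (simp add: C1_def mult.assoc)
    also have "\<dots> \<le> max 1 C1 * exp (- y * s)" by (intro mult_right_mono) auto
    finally show ?thesis .
  qed
  show ?thesis using that[of y "max 1 C1"] y(1) bd by simp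
qed

lemma halfplane_eq_inner: "{\<omega>. Re (\<omega> * cis \<theta>) < r} = {\<omega>. cis (- \<theta>) \<bullet> \<omega> < r}"
  by (auto simp: inner_complex_def algebra_simps)

text \<open>Convexity makes the intersection of two half-planes connected, as analytic continuation
  requires. Infinite values of the indicator give the whole plane or the empty set.\<close>

lemma open_convex_halfplane: "open (laplace_halfplane \<alpha> f \<theta>)" "convex (laplace_halfplane \<alpha> f \<theta>)"
proof -
  have "open (laplace_halfplane \<alpha> f \<theta>) \<and> convex (laplace_halfplane \<alpha> f \<theta>)"
  proof (cases "- indicator_fun \<alpha> f \<theta>")
    case (real r)
    then have "laplace_halfplane \<alpha> f \<theta> = {\<omega>. cis (- \<theta>) \<bullet> \<omega> < r}"
      unfolding laplace_halfplane_def by (simp only: less_ereal.simps halfplane_eq_inner)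
    then show ?thesis by (simp add: open_halfspace_lt convex_halfspace_lt)
  qed (simp_all add: laplace_halfplane_def)
  then show "open (laplace_halfplane \<alpha> f \<theta>)" "convex (laplace_halfplane \<alpha> f \<theta>)" by auto
qed

text \<open>The decay exponent \<open>y\<close> of the boundary values depends on the chosen point
  \<omega>, so holomorphy is proved on a smaller half-plane that still contains \<omega>.\<close>

lemma dir_laplace_holomorphic:
  assumes \<theta>: "\<bar>\<theta>\<bar> \<le> \<alpha>"
  shows "dir_laplace \<alpha> f \<theta> holomorphic_on laplace_halfplane \<alpha> f \<theta>"
  unfolding holomorphic_on_def
proof
  fix \<omega> assume "\<omega> \<in> laplace_halfplane \<alpha> f \<theta>"
  then obtain y C where y: "Re (\<omega> * cis \<theta>) < y"
    "\<And>s. 0 < s \<Longrightarrow> cmod (boundary_ext D f (of_real s * cis \<theta>)) \<le> C * exp (- y * s)"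
    using halfplane_bound[OF \<theta>] by metis
  obtain b where b: "b \<in> borel_measurable borel" "AE s in lborel. 0 < s \<longrightarrow> b s = boundary_ext D f (of_real s * cis \<theta>)"
    using ray_version[OF \<theta>] .
  have "AE s in lborel. 0 < s \<longrightarrow> cmod (b s) \<le> C * exp (- y * s)"
    using b(2)
  proof eventually_elim
    case (elim s)
    then show ?case using y(2)[of s] by auto
  qed
  then have "(\<lambda>\<omega>. LINT s:{0<..}|lborel. b s * exp (\<omega> * (of_real s * cis \<theta>)) * cis \<theta>) holomorphic_on {\<omega>. Re (\<omega> * cis \<theta>) < y}"
    by (intro laplace_holomorphic b(1)) auto
  then have "(\<lambda>\<omega>. 1 / (2 * of_real pi * \<i>) * (LINT s:{0<..}|lborel. b s * exp (\<omega> * (of_real s * cis \<theta>)) * cis \<theta>)) holomorphic_on {\<omega>. Re (\<omega> * cis \<theta>) < y}"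
    by (rule holomorphic_on_mult[OF holomorphic_on_const])
  then have "dir_laplace \<alpha> f \<theta> holomorphic_on {\<omega>. Re (\<omega> * cis \<theta>) < y}"
    unfolding dir_laplace_eq[OF b, abs_def] .
  moreover have "open {\<omega>. Re (\<omega> * cis \<theta>) < y}"
    unfolding halfplane_eq_inner by (rule open_halfspace_lt)
  ultimately have "dir_laplace \<alpha> f \<theta> field_differentiable at \<omega>"
    using y(1) holomorphic_on_imp_differentiable_at by blast
  then show "dir_laplace \<alpha> f \<theta> field_differentiable at \<omega> within laplace_halfplane \<alpha> f \<theta>"
    by (rule field_differentiable_at_within)
qed

text \<open>For every direction of the closed sector the centre contributes at most
  \<open>- (h + 2)\<close> to the real part and the radius less than 1, leaving less than
  \<open>- (h + 1)\<close>. Against growth of exponent \<open>h + 1 / 2\<close> the integrand decays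
  at rate 1/2 in the whole sector, so the ray may be rotated to the positive real axis. The disc is
  common to all half-planes.\<close>

lemma dir_laplace_far_left:
  assumes \<theta>: "\<bar>\<theta>\<bar> \<le> \<alpha>" and \<omega>: "\<omega> \<in> ball (- of_real ((h + 2) / cos \<alpha>)) 1"
  shows "\<omega> \<in> laplace_halfplane \<alpha> f \<theta>"
    "dir_laplace \<alpha> f \<theta> \<omega> = 1 / (2 * of_real pi * \<i>) * ray_int 0 (\<lambda>w. f w * exp (\<omega> * w))"
proof -
  have left: "Re (\<omega> * cis \<phi>) < - (h + 1)" if "\<bar>\<phi>\<bar> \<le> \<alpha>" for \<phi>
  proof -
    define R where "R = (h + 2) / cos \<alpha>"
    have "cos \<alpha> \<le> cos \<bar>\<phi>\<bar>" using that \<alpha>_less by (intro cos_monotone_0_pi_le) auto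
    then have "R * cos \<alpha> \<le> R * cos \<phi>" using h sin_cos_\<alpha> by (intro mult_left_mono) (auto simp: R_def)
    moreover have "R * cos \<alpha> = h + 2" using sin_cos_\<alpha> by (simp add: R_def)
    moreover have "Re ((\<omega> + of_real R) * cis \<phi>) < 1"
      using \<omega> complex_Re_le_cmod[of "(\<omega> + of_real R) * cis \<phi>"] unfolding R_def[symmetric]
      by (simp add: norm_mult dist_norm norm_minus_commute)
    moreover have "Re ((\<omega> + of_real R) * cis \<phi>) = Re (\<omega> * cis \<phi>) + R * cos \<phi>" by (simp add: algebra_simps)
    ultimately show ?thesis by linarith
  qed
  show "\<omega> \<in> laplace_halfplane \<alpha> f \<theta>" using left[OF \<theta>] by (intro in_halfplaneI \<theta>) linarith
  obtain C where C: "0 \<le> C" "\<And>z. z \<in> D \<Longrightarrow> cmod (f z) \<le> C * exp ((h + 1 / 2) * cmod z)"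
    using f_bound[of "1/2"] by auto
  let ?K = "\<lambda>w. f w * exp (\<omega> * w)"
  have holK: "?K holomorphic_on D" by (intro holomorphic_intros hol)
  have bd: "cmod (?K w) \<le> C * exp (- (1/2) * cmod w)" if w: "w \<in> D" for w
  proof -
    obtain s \<phi> where s: "0 < s" "\<bar>\<phi>\<bar> < \<alpha>" "w = of_real s * cis \<phi>" using sector_polarE[OF w] .
    have cw: "cmod w = s" using s by (simp add: norm_mult)
    have "Re (\<omega> * w) = s * Re (\<omega> * cis \<phi>)" unfolding s(3) by (rule Re_mult_ray)
    also have "\<dots> \<le> s * - (h + 1)" using left[of \<phi>] s by (intro mult_left_mono) auto
    finally have e: "(h + 1 / 2) * s + Re (\<omega> * w) \<le> - (1/2) * s" by (simp add: algebra_simps)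
    have "cmod (?K w) \<le> (C * exp ((h + 1 / 2) * s)) * exp (Re (\<omega> * w))"
      using C(2)[OF w] unfolding cw by (simp add: norm_mult mult_right_mono)
    also have "\<dots> = C * exp ((h + 1 / 2) * s + Re (\<omega> * w))" by (simp add: exp_add mult.assoc)
    also have "\<dots> \<le> C * exp (- (1/2) * s)" using e C(1) by (intro mult_left_mono) auto
    finally show ?thesis unfolding cw .
  qed
  have bd': "cmod (?K w) \<le> (C * (1 / min 1 ((1/2)\<^sup>2 / 2))) / (1 + (cmod w)\<^sup>2)" if w: "w \<in> D" for w
  proof -
    have "C * exp (- (1/2) * cmod w) \<le> C * (1 / min 1 ((1/2)\<^sup>2 / 2) / (1 + (cmod w)\<^sup>2))"
      using C(1) by (intro mult_left_mono exp_decay_le(2)) auto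
    then show ?thesis using bd[OF w] by simp
  qed
  have indep: "ray_int \<phi> ?K = ray_int 0 ?K" if "\<bar>\<phi>\<bar> < \<alpha>" for \<phi>
    using that \<alpha>_pos by (intro ray_int_indep[OF holK bd']) auto
  show "dir_laplace \<alpha> f \<theta> \<omega> = 1 / (2 * of_real pi * \<i>) * ray_int 0 ?K"
  proof (cases "\<bar>\<theta>\<bar> < \<alpha>")
    case True
    let ?b = "\<lambda>s. indicator {0<..} s *\<^sub>R f (of_real s * cis \<theta>)"
    have "?b \<in> borel_measurable borel"
      by (intro borel_measurable_ray holomorphic_on_imp_continuous_on[OF hol] True)
    moreover have "AE s in lborel. 0 < s \<longrightarrow> ?b s = boundary_ext D f (of_real s * cis \<theta>)"
      using polar_in_sector[OF _ True] by (intro AE_I2) (auto simp: boundary_ext_interior)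
    ultimately have "dir_laplace \<alpha> f \<theta> \<omega> = 1 / (2 * of_real pi * \<i>) * (LINT s:{0<..}|lborel. ?b s * exp (\<omega> * (of_real s * cis \<theta>)) * cis \<theta>)"
      by (rule dir_laplace_eq)
    also have "(LINT s:{0<..}|lborel. ?b s * exp (\<omega> * (of_real s * cis \<theta>)) * cis \<theta>) = ray_int \<theta> ?K"
      unfolding ray_int_def by (rule set_lebesgue_integral_cong) auto
    finally show ?thesis using indep[OF True] by simp
  next
    case False
    then have "\<theta> = \<alpha> \<or> \<theta> = - \<alpha>" using \<theta> by linarith
    then obtain \<sigma> :: real where \<sigma>: "\<sigma> = 1 \<or> \<sigma> = -1" "\<theta> = \<sigma> * \<alpha>"
      using that[of 1] that[of "-1"] by auto
    have \<theta>n: "\<bar>\<sigma> * angle_seq n\<bar> < \<alpha>" for n using \<sigma> angle_seq[of n] by auto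
    \<comment> \<open>On an edge the value is the limit of the integrals over interior rays, all of
      which coincide.\<close>
    have "(\<lambda>n. ray_int (\<sigma> * angle_seq n) ?K) \<longlonglongrightarrow>
       (LINT s:{0<..}|lborel. edge \<sigma> s * exp (\<omega> * (of_real s * cis (\<sigma> * \<alpha>))) * cis (\<sigma> * \<alpha>))"
    proof (rule edge_limit[OF \<sigma>(1), where c = "1/2" and C = C and N = 0])
      show "(\<lambda>n. exp (\<omega> * (of_real s * cis (\<sigma> * angle_seq n)))) \<longlonglongrightarrow> exp (\<omega> * (of_real s * cis (\<sigma> * \<alpha>)))" for s
        by (intro tendsto_exp tendsto_mult tendsto_const cis_angle_seq_tendsto)
      show "cmod (?K (of_real s * cis (\<sigma> * angle_seq n))) \<le> C * exp (- (1/2) * s)" if "0 < s" for s n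
        using bd[OF polar_in_sector[OF that \<theta>n[of n]]] that by (simp add: norm_mult)
    qed (auto intro!: continuous_intros)
    then have "(\<lambda>n. ray_int 0 ?K) \<longlonglongrightarrow>
       (LINT s:{0<..}|lborel. edge \<sigma> s * exp (\<omega> * (of_real s * cis (\<sigma> * \<alpha>))) * cis (\<sigma> * \<alpha>))"
      using indep[OF \<theta>n] by simp
    then have "(LINT s:{0<..}|lborel. edge \<sigma> s * exp (\<omega> * (of_real s * cis (\<sigma> * \<alpha>))) * cis (\<sigma> * \<alpha>)) = ray_int 0 ?K"
      by (rule LIMSEQ_unique) simp
    moreover have "AE s in lborel. 0 < s \<longrightarrow> edge \<sigma> s = boundary_ext D f (of_real s * cis (\<sigma> * \<alpha>))"
      using edge_AE[OF \<sigma>(1)] by eventually_elim auto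
    ultimately show ?thesis
      unfolding \<sigma>(2) using dir_laplace_eq[OF edge_measurable[OF \<sigma>(1)]] by simp
  qed
qed

lemma dir_laplace_agree:
  assumes \<theta>: "\<bar>\<theta>1\<bar> \<le> \<alpha>" "\<bar>\<theta>2\<bar> \<le> \<alpha>" and \<omega>: "\<omega> \<in> laplace_halfplane \<alpha> f \<theta>1" "\<omega> \<in> laplace_halfplane \<alpha> f \<theta>2"
  shows "dir_laplace \<alpha> f \<theta>1 \<omega> = dir_laplace \<alpha> f \<theta>2 \<omega>"
proof (rule analytic_continuation_open[where f = "dir_laplace \<alpha> f \<theta>1" and g = "dir_laplace \<alpha> f \<theta>2"])
  let ?U = "laplace_halfplane \<alpha> f \<theta>1 \<inter> laplace_halfplane \<alpha> f \<theta>2"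
  let ?B = "ball (- of_real ((h + 2) / cos \<alpha>)) 1 :: complex set"
  show "open ?B" "?B \<noteq> {}" by auto
  show "open ?U" using open_convex_halfplane by blast
  show "connected ?U" using open_convex_halfplane by (intro convex_connected convex_Int) auto
  show "?B \<subseteq> ?U" using dir_laplace_far_left(1) \<theta> by blast
  show "dir_laplace \<alpha> f \<theta>1 holomorphic_on ?U" "dir_laplace \<alpha> f \<theta>2 holomorphic_on ?U"
    using dir_laplace_holomorphic \<theta> by (blast intro: holomorphic_on_subset)+
  show "dir_laplace \<alpha> f \<theta>1 z = dir_laplace \<alpha> f \<theta>2 z" if "z \<in> ?B" for z
    using dir_laplace_far_left(2)[OF _ that] \<theta> by simp
  show "\<omega> \<in> ?U" using \<omega> by simp
qed

lemma concat_laplace_eq: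
  assumes "\<bar>\<theta>\<bar> \<le> \<alpha>" "\<omega> \<in> laplace_halfplane \<alpha> f \<theta>"
  shows "concat_laplace \<alpha> f \<omega> = dir_laplace \<alpha> f \<theta> \<omega>"
  unfolding concat_laplace_def
proof (rule the_equality)
  show "\<exists>\<theta>'\<in>{- \<alpha>..\<alpha>}. \<omega> \<in> laplace_halfplane \<alpha> f \<theta>' \<and> dir_laplace \<alpha> f \<theta> \<omega> = dir_laplace \<alpha> f \<theta>' \<omega>"
    using assms by (intro bexI[of _ \<theta>]) auto
  fix w assume "\<exists>\<theta>'\<in>{- \<alpha>..\<alpha>}. \<omega> \<in> laplace_halfplane \<alpha> f \<theta>' \<and> w = dir_laplace \<alpha> f \<theta>' \<omega>"
  then obtain \<theta>' where "\<theta>' \<in> {- \<alpha>..\<alpha>}" "\<omega> \<in> laplace_halfplane \<alpha> f \<theta>'" "w = dir_laplace \<alpha> f \<theta>' \<omega>" by blast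
  then show "w = dir_laplace \<alpha> f \<theta> \<omega>" using dir_laplace_agree[of \<theta>' \<theta> \<omega>] assms by (auto simp: abs_le_iff)
qed

end

section \<open>The inversion formula\<close>

lemma exp_half_line:
  fixes a :: complex
  assumes "Re a < 0"
  shows "set_integrable lborel {0<..} (\<lambda>r. exp (of_real r * a))"
    and "(LINT r:{0<..}|lborel. exp (of_real r * a)) = - 1 / a"
proof -
  have a0: "a \<noteq> 0" using assms by auto
  have cont: "continuous_on {0<..} (\<lambda>r. exp (of_real r * a))" by (intro continuous_intros)
  show int: "set_integrable lborel {0<..} (\<lambda>r. exp (of_real r * a))"
    using set_integrable_exp[of "- Re a" 1] assms
    by (intro set_integrable_continuous_bound[OF cont]) (auto simp: mult.commute)
  have "(LINT r:{0<..}|lborel. exp (of_real r * a)) = 0 - exp (of_real 0 * a) / a"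
  proof (rule FTC_half_line[OF _ cont int])
    show "((\<lambda>r. exp (of_real r * a) / a) has_vector_derivative exp (of_real r * a)) (at r)" for r
    proof -
      have "((\<lambda>z. exp (z * a) / a) has_field_derivative exp (of_real r * 1 * a)) (at (of_real r * 1))"
        using a0 by (auto intro!: derivative_eq_intros)
      from field_vector_diff_chain_at[OF has_vector_derivative_ray this] show ?thesis by (simp add: o_def)
    qed
    show "((\<lambda>r. exp (of_real r * a) / a) \<longlongrightarrow> exp (of_real 0 * a) / a) (at_right 0)"
      using a0 by (intro tendsto_intros)
    have "((\<lambda>r. exp (r * Re a)) \<longlongrightarrow> 0) at_top"
      using filterlim_tendsto_neg_mult_at_bot[OF tendsto_const assms filterlim_ident]
      by (intro filterlim_compose[OF exp_at_bot]) (simp add: mult.commute)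
    then have "((\<lambda>r. exp (of_real r * a)) \<longlongrightarrow> 0) at_top"
      by (subst tendsto_norm_zero_iff[symmetric]) simp
    then have "((\<lambda>r. exp (of_real r * a) / a) \<longlongrightarrow> 0 / a) at_top"
      using a0 by (intro tendsto_intros)
    then show "((\<lambda>r. exp (of_real r * a) / a) \<longlongrightarrow> 0) at_top" by simp
  qed
  then show "(LINT r:{0<..}|lborel. exp (of_real r * a)) = - 1 / a" by simp
qed

text \<open>A majorant in product form bounds the inner integral by \<open>u r\<close> times the
  integral of \<open>v\<close>, which reduces Fubini's hypothesis to two one-dimensional
  ones.\<close>

lemma integrable_product_bound:
  fixes H :: "real \<times> real \<Rightarrow> complex"
  assumes H[measurable]: "H \<in> borel_measurable (lborel \<Otimes>\<^sub>M lborel)"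
    and u: "integrable lborel u" and v: "integrable lborel v"
    and bd: "\<And>r s. cmod (H (r, s)) \<le> u r * v s"
  shows "integrable (lborel \<Otimes>\<^sub>M lborel) H"
proof (rule lborel_pair.Fubini_integrable[OF H])
  have int: "integrable lborel (\<lambda>s. H (r, s))" for r
  proof (rule Bochner_Integration.integrable_bound)
    show "integrable lborel (\<lambda>s. u r * v s)" using v by simp
    show "(\<lambda>s. H (r, s)) \<in> borel_measurable lborel" by measurable
    show "AE s in lborel. norm (H (r, s)) \<le> norm (u r * v s)"
      using bd by (intro AE_I2) (simp add: order_trans[OF _ abs_ge_self])
  qed
  then show "AE r in lborel. integrable lborel (\<lambda>s. H (r, s))" by simp
  show "integrable lborel (\<lambda>r. \<integral>s. norm (H (r, s)) \<partial>lborel)"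
  proof (rule Bochner_Integration.integrable_bound)
    show "integrable lborel (\<lambda>r. u r * (\<integral>s. v s \<partial>lborel))" using u by simp
    show "(\<lambda>r. \<integral>s. norm (H (r, s)) \<partial>lborel) \<in> borel_measurable lborel" by measurable
    have "norm (\<integral>s. norm (H (r, s)) \<partial>lborel) \<le> norm (u r * (\<integral>s. v s \<partial>lborel))" for r
    proof -
      have "(\<integral>s. norm (H (r, s)) \<partial>lborel) \<le> (\<integral>s. u r * v s \<partial>lborel)"
        using int v bd by (intro integral_mono) auto
      moreover have "0 \<le> (\<integral>s. norm (H (r, s)) \<partial>lborel)" by (intro integral_nonneg_AE) simp
      ultimately show ?thesis by simp
    qed
    then show "AE r in lborel. norm (\<integral>s. norm (H (r, s)) \<partial>lborel) \<le> norm (u r * (\<integral>s. v s \<partial>lborel))" by simp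
  qed
qed

context exp_type_sector
begin

text \<open>One half of the curve, parametrised by the distance \<open>r\<close> from
  \<open>p\<close>. After the exchange of integrals the inner one is that of
  \<open>exp (r * a s)\<close>, namely \<open>- 1 / a s\<close>; the derivative of the
  parametrisation cancels against \<open>a\<close>, which leaves the Cauchy kernel and the sign
  \<open>- \<sigma>\<close>.\<close>

lemma branch_integral:
  assumes \<sigma>: "\<sigma> = 1 \<or> \<sigma> = -1" and p: "p * cos \<alpha> < - h" and z: "z \<in> D"
  defines "\<omega> \<equiv> \<lambda>r. of_real p + of_real \<sigma> * \<i> * cis (- \<sigma> * \<alpha>) * of_real r"
  defines "\<Phi> \<equiv> \<lambda>r. indicator {0<..} r *\<^sub>R (dir_laplace \<alpha> f (\<sigma> * \<alpha>) (\<omega> r) * exp (- \<omega> r * z) * (\<i> * cis (- \<sigma> * \<alpha>)))"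
  defines "E \<equiv> LINT s:{0<..}|lborel. edge \<sigma> s * (exp (of_real p * (of_real s * cis (\<sigma> * \<alpha>) - z)) / (of_real s * cis (\<sigma> * \<alpha>) - z)) * cis (\<sigma> * \<alpha>)"
  shows "integrable lborel \<Phi>" "(\<integral>r. \<Phi> r \<partial>lborel) = - of_real \<sigma> * (1 / (2 * of_real pi * \<i>)) * E"
proof -
  define c where "c = - (p * cos \<alpha> + h) / 2"
  have c: "c > 0" using p by (simp add: c_def)
  obtain C where C: "0 \<le> C" "\<And>\<sigma>. \<sigma> = 1 \<or> \<sigma> = -1 \<Longrightarrow> AE s in lborel. 0 < s \<longrightarrow> cmod (edge \<sigma> s) \<le> C * exp ((h + c) * s)"
    using edge_bound_AE[OF c] by metis
  let ?e = "cis (\<sigma> * \<alpha>)" and ?e' = "cis (- \<sigma> * \<alpha>)" and ?k = "1 / (2 * of_real pi * \<i>) :: complex"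
  have ee: "?e' * ?e = 1" by (simp add: cis_mult)
  have \<sigma>\<sigma>: "complex_of_real \<sigma> * complex_of_real \<sigma> = 1" using \<sigma> by auto
  have cos\<sigma>: "cos (\<sigma> * \<alpha>) = cos \<alpha>" using \<sigma> by auto
  \<comment> \<open>Cutting off where the growth bound fails changes \<open>edge\<close> only on a
    null set of positive parameters, and makes the bound valid at every point, as the product
    majorant demands.\<close>
  define b where "b = (\<lambda>s. if cmod (edge \<sigma> s) \<le> C * exp ((h + c) * s) then edge \<sigma> s else 0)"
  have [measurable]: "edge \<sigma> \<in> borel_measurable borel" by (rule edge_measurable[OF \<sigma>])
  have bm[measurable]: "b \<in> borel_measurable borel" unfolding b_def by measurable
  have bE: "AE s in lborel. 0 < s \<longrightarrow> b s = edge \<sigma> s" using C(2)[OF \<sigma>] by eventually_elim (simp add: b_def)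
  have bB: "AE s in lborel. 0 < s \<longrightarrow> b s = boundary_ext D f (of_real s * ?e)"
    using bE edge_AE[OF \<sigma>] by eventually_elim auto
  have b_le: "cmod (b s) \<le> C * exp ((h + c) * s)" for s using C(1) by (simp add: b_def)
  define A where "A = (\<lambda>s. b s * exp (of_real p * (of_real s * ?e - z)) * ?e)"
  have [measurable]: "A \<in> borel_measurable borel" unfolding A_def by measurable
  define a where "a = (\<lambda>s. of_real \<sigma> * \<i> * ?e' * (of_real s * ?e - z))"
  have [measurable]: "a \<in> borel_measurable borel" unfolding a_def by measurable
  define \<mu> where "\<mu> = Re (of_real \<sigma> * \<i> * ?e' * z)"
  \<comment> \<open>The part of \<open>a s\<close> depending on \<open>s\<close> is purely
    imaginary, since the half of the curve is perpendicular to the conjugate direction of the edge.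
    Hence the decay rate in \<open>r\<close> does not depend on \<open>s\<close> and the majorant is
    a product; \<mu> is the distance of \<open>z\<close> from the line through the edge.\<close>
  have Re_a: "Re (a s) = - \<mu>" for s
  proof -
    have "a s = of_real \<sigma> * \<i> * of_real s * (?e' * ?e) - of_real \<sigma> * \<i> * ?e' * z"
      by (simp add: a_def algebra_simps)
    then have "a s = \<i> * of_real (\<sigma> * s) - of_real \<sigma> * \<i> * ?e' * z" unfolding ee by simp
    then show ?thesis by (simp add: \<mu>_def)
  qed
  have \<mu>: "\<mu> > 0"
  proof -
    have "\<mu> = - \<sigma> * Im (z * ?e')" unfolding \<mu>_def by (simp add: algebra_simps)
    then show ?thesis using \<sigma> z in_sector_iff[of z] by auto
  qed
  define C1 where "C1 = C * exp (- p * Re z)"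
  have A_le: "cmod (A s) \<le> C1 * exp (- c * s)" for s
  proof -
    have "cmod (A s) \<le> (C * exp ((h + c) * s)) * exp (p * (s * cos \<alpha>) - p * Re z)"
      unfolding A_def using b_le[of s] cos\<sigma> by (simp add: norm_mult right_diff_distrib mult_right_mono)
    also have "\<dots> = C * exp (- p * Re z) * exp ((h + c) * s + p * (s * cos \<alpha>))"
      by (simp add: exp_add exp_diff exp_minus field_simps)
    also have "(h + c) * s + p * (s * cos \<alpha>) = - c * s" by (simp add: c_def field_simps)
    finally show ?thesis by (simp add: C1_def)
  qed
  define H where "H = (\<lambda>(r, s). (indicator {0<..} r * indicator {0<..} s) *\<^sub>R (A s * exp (of_real r * a s) * (\<i> * ?e')))"
  have Hint: "integrable (lborel \<Otimes>\<^sub>M lborel) H"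
  proof (rule integrable_product_bound)
    show "H \<in> borel_measurable (lborel \<Otimes>\<^sub>M lborel)" unfolding H_def by measurable
    show "integrable lborel (\<lambda>r. indicator {0<..} r *\<^sub>R (1 * exp (- \<mu> * r)))" "integrable lborel (\<lambda>s. indicator {0<..} s *\<^sub>R (C1 * exp (- c * s)))"
      using set_integrable_exp[OF \<mu>, of 1] set_integrable_exp[OF c, of C1] unfolding set_integrable_def by auto
    fix r s
    have "cmod (A s * exp (of_real r * a s) * (\<i> * ?e')) \<le> (1 * exp (- \<mu> * r)) * (C1 * exp (- c * s))"
      using mult_left_mono[OF A_le[of s], of "exp (- \<mu> * r)"] by (simp add: norm_mult Re_a mult.commute)
    then show "cmod (H (r, s)) \<le> (indicator {0<..} r *\<^sub>R (1 * exp (- \<mu> * r))) * (indicator {0<..} s *\<^sub>R (C1 * exp (- c * s)))"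
      by (simp add: H_def indicator_def)
  qed
  have \<Phi>_eq: "\<Phi> r = ?k * (\<integral>s. H (r, s) \<partial>lborel)" for r
  proof (cases "0 < r")
    case True
    have "?k * (\<integral>s. H (r, s) \<partial>lborel) = ?k * (LINT s:{0<..}|lborel. (b s * exp (\<omega> r * (of_real s * ?e)) * ?e) * (exp (- \<omega> r * z) * (\<i> * ?e')))"
    proof -
      \<comment> \<open>Both exponents equal \<open>\<omega> r\<close> times the difference of the
        edge point and \<open>z\<close>: \<omega> was split into \<open>p\<close> and the part
        linear in \<open>r\<close>.\<close>
      have *: "A s * exp (of_real r * a s) * (\<i> * ?e') = (b s * exp (\<omega> r * (of_real s * ?e)) * ?e) * (exp (- \<omega> r * z) * (\<i> * ?e'))" for s
      proof -
        have "exp (of_real p * (of_real s * ?e - z)) * exp (of_real r * a s) = exp (\<omega> r * (of_real s * ?e)) * exp (- \<omega> r * z)"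
          unfolding exp_add[symmetric] by (rule arg_cong[where f = exp]) (simp add: a_def \<omega>_def algebra_simps)
        then show ?thesis by (simp add: A_def mult_ac)
      qed
      have "H (r, s) = indicator {0<..} s *\<^sub>R ((b s * exp (\<omega> r * (of_real s * ?e)) * ?e) * (exp (- \<omega> r * z) * (\<i> * ?e')))" for s
        unfolding H_def prod.case * using True by simp
      then show ?thesis by (simp only: set_lebesgue_integral_def)
    qed
    also have "\<dots> = (?k * (LINT s:{0<..}|lborel. b s * exp (\<omega> r * (of_real s * ?e)) * ?e)) * (exp (- \<omega> r * z) * (\<i> * ?e'))"
      unfolding set_integral_mult_left by (simp only: mult.assoc)
    also have "\<dots> = \<Phi> r"
      unfolding \<Phi>_def dir_laplace_eq[OF bm bB] using True by (simp add: mult.assoc)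
    finally show ?thesis ..
  qed (simp add: \<Phi>_def H_def)
  have \<Phi>_eq': "\<Phi> = (\<lambda>r. ?k * (\<integral>s. H (r, s) \<partial>lborel))" using \<Phi>_eq by auto
  show "integrable lborel \<Phi>"
    unfolding \<Phi>_eq' by (intro integrable_mult_right lborel_pair.integrable_fst'[OF Hint])
  have "(\<integral>r. \<Phi> r \<partial>lborel) = ?k * (\<integral>r. (\<integral>s. H (r, s) \<partial>lborel) \<partial>lborel)"
    unfolding \<Phi>_eq by simp
  also have "(\<integral>r. (\<integral>s. H (r, s) \<partial>lborel) \<partial>lborel) = (\<integral>s. (\<integral>r. H (r, s) \<partial>lborel) \<partial>lborel)"
    using lborel_pair.Fubini_integral[of "\<lambda>r s. H (r, s)"] Hint by simp
  also have "\<dots> = (\<integral>s. - of_real \<sigma> * (indicator {0<..} s *\<^sub>R (b s * (exp (of_real p * (of_real s * ?e - z)) / (of_real s * ?e - z)) * ?e)) \<partial>lborel)"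
  proof (intro Bochner_Integration.integral_cong refl)
    fix s :: real
    show "(\<integral>r. H (r, s) \<partial>lborel) = - of_real \<sigma> * (indicator {0<..} s *\<^sub>R (b s * (exp (of_real p * (of_real s * ?e - z)) / (of_real s * ?e - z)) * ?e))"
    proof (cases "0 < s")
      case True
      have nz: "of_real s * ?e - z \<noteq> 0" using edge_not_in_sector[OF \<sigma>, of s] z by auto
      have "(\<integral>r. H (r, s) \<partial>lborel) = (LINT r:{0<..}|lborel. exp (of_real r * a s) * (A s * (\<i> * ?e')))"
      proof -
        have *: "A s * exp (of_real r * a s) * (\<i> * ?e') = exp (of_real r * a s) * (A s * (\<i> * ?e'))" for r
          by (simp only: mult_ac)
        have "H (r, s) = indicator {0<..} r *\<^sub>R (exp (of_real r * a s) * (A s * (\<i> * ?e')))" for r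
          unfolding H_def prod.case * using True by simp
        then show ?thesis by (simp only: set_lebesgue_integral_def)
      qed
      also have "\<dots> = (- 1 / a s) * (A s * (\<i> * ?e'))"
        unfolding set_integral_mult_left using exp_half_line(2)[of "a s"] Re_a[of s] \<mu> by simp
      also have "\<dots> = - of_real \<sigma> * (b s * (exp (of_real p * (of_real s * ?e - z)) / (of_real s * ?e - z)) * ?e)"
      proof -
        have "(- 1 / (t * \<i> * y * x)) * ((B * X * w) * (\<i> * y)) = - t * (B * (X / x) * w)"
          if "t * t = 1" "x \<noteq> 0" "y \<noteq> 0" for t x y B X w :: complex
        proof -
          have "t \<noteq> 0" using that by auto
          have "(- 1 / (t * \<i> * y * x)) * ((B * X * w) * (\<i> * y)) = - (1 / t) * (B * (X / x) * w)"
            using that \<open>t \<noteq> 0\<close> by (simp add: field_simps)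
          moreover have "1 / t = t" using that \<open>t \<noteq> 0\<close> by (simp add: field_simps)
          ultimately show ?thesis by simp
        qed
        from this[OF \<sigma>\<sigma> nz cis_neq_zero] show ?thesis unfolding a_def A_def .
      qed
      finally show ?thesis using True by simp
    qed (simp add: H_def)
  qed
  also have "\<dots> = - of_real \<sigma> * (LINT s:{0<..}|lborel. b s * (exp (of_real p * (of_real s * ?e - z)) / (of_real s * ?e - z)) * ?e)"
    by (simp only: set_lebesgue_integral_def integral_mult_right_zero)
  also have "(LINT s:{0<..}|lborel. b s * (exp (of_real p * (of_real s * ?e - z)) / (of_real s * ?e - z)) * ?e) = E"
    unfolding E_def set_lebesgue_integral_def
  proof (rule integral_cong_AE)
    show "AE s in lborel. indicator {0<..} s *\<^sub>R (b s * (exp (of_real p * (of_real s * ?e - z)) / (of_real s * ?e - z)) * ?e)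
      = indicator {0<..} s *\<^sub>R (edge \<sigma> s * (exp (of_real p * (of_real s * ?e - z)) / (of_real s * ?e - z)) * ?e)"
      using bE by eventually_elim (auto simp: indicator_def)
  qed measurable
  finally show "(\<integral>r. \<Phi> r \<partial>lborel) = - of_real \<sigma> * ?k * E" by simp
qed

text \<open>Multiplication by the unit vector of the edge makes the part linear in \<open>r\<close>
  purely imaginary, so the half-line runs parallel to the boundary of the half-plane, at real part
  \<open>p * cos \<alpha>\<close>.\<close>

lemma edge_line_in_halfplane:
  assumes \<sigma>: "\<sigma> = 1 \<or> \<sigma> = -1" and p: "p * cos \<alpha> < - h"
  shows "of_real p + of_real \<sigma> * \<i> * cis (- \<sigma> * \<alpha>) * of_real r \<in> laplace_halfplane \<alpha> f (\<sigma> * \<alpha>)"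
proof (rule in_halfplaneI)
  show "\<bar>\<sigma> * \<alpha>\<bar> \<le> \<alpha>" using \<sigma> \<alpha>_pos by auto
  have "(of_real p + of_real \<sigma> * \<i> * cis (- \<sigma> * \<alpha>) * of_real r) * cis (\<sigma> * \<alpha>)
      = of_real p * cis (\<sigma> * \<alpha>) + of_real \<sigma> * \<i> * of_real r * (cis (- \<sigma> * \<alpha>) * cis (\<sigma> * \<alpha>))"
    by (simp add: algebra_simps)
  also have "\<dots> = of_real p * cis (\<sigma> * \<alpha>) + \<i> * of_real (\<sigma> * r)" unfolding cis_mult by simp
  finally show "Re ((of_real p + of_real \<sigma> * \<i> * cis (- \<sigma> * \<alpha>) * of_real r) * cis (\<sigma> * \<alpha>)) < - h"
    using p \<sigma> by auto
qed

lemma inversion_curve_branch: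
  "0 < t \<Longrightarrow> inversion_curve \<alpha> p t = of_real p + of_real 1 * \<i> * cis (- 1 * \<alpha>) * of_real t"
  "t \<le> 0 \<Longrightarrow> inversion_curve \<alpha> p t = of_real p + of_real (-1) * \<i> * cis (- (-1) * \<alpha>) * of_real (- t)"
  by (simp_all add: inversion_curve_def)

lemma vector_derivative_inversion_curve:
  "0 < t \<Longrightarrow> vector_derivative (inversion_curve \<alpha> p) (at t) = \<i> * cis (- 1 * \<alpha>)"
  "t < 0 \<Longrightarrow> vector_derivative (inversion_curve \<alpha> p) (at t) = \<i> * cis (- (-1) * \<alpha>)"
proof -
  have aff: "((\<lambda>t. of_real p + of_real t * d) has_vector_derivative d) (at t)" for d :: complex and t
    using has_vector_derivative_add[OF has_vector_derivative_const has_vector_derivative_ray[of d t UNIV], of "of_real p"] by simp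
  show "vector_derivative (inversion_curve \<alpha> p) (at t) = \<i> * cis (- 1 * \<alpha>)" if "0 < t"
  proof (rule vector_derivative_at, rule has_vector_derivative_transform_within_open[OF aff])
    show "open {0::real<..}" "t \<in> {0<..}" using that by auto
  qed (simp add: inversion_curve_def)
  show "vector_derivative (inversion_curve \<alpha> p) (at t) = \<i> * cis (- (-1) * \<alpha>)" if "t < 0"
  proof (rule vector_derivative_at, rule has_vector_derivative_transform_within_open[OF aff])
    show "open {..<0::real}" "t \<in> {..<0}" using that by auto
  qed (simp add: inversion_curve_def)
qed

theorem inversion:
  assumes p: "p * cos \<alpha> < - h"
  shows "range (inversion_curve \<alpha> p) \<subseteq> laplace_domain \<alpha> f"
    and "z \<in> D \<Longrightarrow> line_integrable UNIV (inversion_curve \<alpha> p) (\<lambda>\<omega>. concat_laplace \<alpha> f \<omega> * exp (- \<omega> * z))"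
    and "z \<in> D \<Longrightarrow> f z = line_integral UNIV (inversion_curve \<alpha> p) (\<lambda>\<omega>. concat_laplace \<alpha> f \<omega> * exp (- \<omega> * z))"
proof -
  let ?\<gamma> = "inversion_curve \<alpha> p"
  have half: "0 < t \<Longrightarrow> ?\<gamma> t \<in> laplace_halfplane \<alpha> f (1 * \<alpha>)" "t \<le> 0 \<Longrightarrow> ?\<gamma> t \<in> laplace_halfplane \<alpha> f (-1 * \<alpha>)" for t
    using edge_line_in_halfplane[of 1 p t] edge_line_in_halfplane[of "-1" p "- t"] p
    by (simp_all add: inversion_curve_branch)
  show "range ?\<gamma> \<subseteq> laplace_domain \<alpha> f"
  proof
    fix w assume "w \<in> range ?\<gamma>"
    then obtain t where t: "w = ?\<gamma> t" by blast
    show "w \<in> laplace_domain \<alpha> f"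
      unfolding laplace_domain_def using half[of t] \<alpha>_pos
      by (cases "0 < t") (auto simp: t intro: bexI[of _ \<alpha>] bexI[of _ "- \<alpha>"])
  qed
  assume z: "z \<in> D"
  define \<omega> where "\<omega> = (\<lambda>\<sigma> r. of_real p + of_real \<sigma> * \<i> * cis (- \<sigma> * \<alpha>) * complex_of_real r)"
  define \<Phi> where "\<Phi> = (\<lambda>\<sigma> r. indicator {0<..} r *\<^sub>R (dir_laplace \<alpha> f (\<sigma> * \<alpha>) (\<omega> \<sigma> r) * exp (- \<omega> \<sigma> r * z) * (\<i> * cis (- \<sigma> * \<alpha>))))"
  define E where "E = (\<lambda>\<sigma>. LINT s:{0<..}|lborel. edge \<sigma> s * (exp (of_real p * (of_real s * cis (\<sigma> * \<alpha>) - z)) / (of_real s * cis (\<sigma> * \<alpha>) - z)) * cis (\<sigma> * \<alpha>))"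
  let ?F = "\<lambda>t. concat_laplace \<alpha> f (?\<gamma> t) * exp (- ?\<gamma> t * z) * vector_derivative ?\<gamma> (at t)"
  have \<Phi>: "integrable lborel (\<Phi> \<sigma>)" "(\<integral>r. \<Phi> \<sigma> r \<partial>lborel) = - of_real \<sigma> * (1 / (2 * of_real pi * \<i>)) * E \<sigma>" if "\<sigma> = 1 \<or> \<sigma> = -1" for \<sigma>
    using branch_integral[OF that p z] unfolding \<Phi>_def \<omega>_def E_def by auto
  \<comment> \<open>The lower-edge branch belongs to negative parameters of the curve, so it is
    reflected before the two branches are added.\<close>
  have \<Phi>m: "integrable lborel (\<lambda>t. \<Phi> (-1) (- t))"
    using lborel_integrable_real_affine[OF \<Phi>(1)[of "-1"], of "-1" 0] by simp
  have \<Phi>mi: "(\<integral>t. \<Phi> (-1) (- t) \<partial>lborel) = (\<integral>t. \<Phi> (-1) t \<partial>lborel)"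
    using lborel_integral_real_affine[of "-1" "\<Phi> (-1)" 0] by simp
  let ?G = "\<lambda>t. \<Phi> 1 t + \<Phi> (-1) (- t)"
  have G: "integrable lborel ?G" using \<Phi>(1)[of 1] \<Phi>m by simp
  have FG: "?G t = ?F t" if "t \<noteq> 0" for t
  proof (cases "0 < t")
    case True
    have "\<omega> 1 t = ?\<gamma> t" unfolding \<omega>_def inversion_curve_branch(1)[OF True] ..
    moreover have "concat_laplace \<alpha> f (?\<gamma> t) = dir_laplace \<alpha> f (1 * \<alpha>) (?\<gamma> t)"
      using half(1)[OF True] \<alpha>_pos by (intro concat_laplace_eq) auto
    ultimately show ?thesis using True by (simp add: \<Phi>_def vector_derivative_inversion_curve)
  next
    case False
    then have t: "t < 0" using that by simp
    have "\<omega> (-1) (- t) = ?\<gamma> t" unfolding \<omega>_def using inversion_curve_branch(2)[of t] t by simp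
    moreover have "concat_laplace \<alpha> f (?\<gamma> t) = dir_laplace \<alpha> f (-1 * \<alpha>) (?\<gamma> t)"
      using half(2)[of t] t \<alpha>_pos by (intro concat_laplace_eq) auto
    ultimately show ?thesis using t by (simp add: \<Phi>_def vector_derivative_inversion_curve)
  qed
  \<comment> \<open>The corner of the curve at parameter 0 is a null set.\<close>
  have "AE t in lborel. t \<noteq> (0::real)" by (rule AE_lborel_singleton)
  then have "AE t in lborel. ?G t = ?F t" by eventually_elim (rule FG)
  then have ae: "AE t in lebesgue. ?G t = ?F t" by (simp add: AE_completion_iff)
  have Gm: "?G \<in> borel_measurable lborel" using G by (rule borel_measurable_integrable)
  have Gm': "?G \<in> borel_measurable lebesgue" using Gm by (rule measurable_completion)
  have Fm: "?F \<in> borel_measurable lebesgue" by (rule borel_measurable_AE[OF Gm' ae])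
  have "integrable lebesgue ?G" using G integrable_completion[OF Gm] by simp
  then have "integrable lebesgue ?F" using integrable_cong_AE[OF Gm' Fm ae] by simp
  then show "line_integrable UNIV ?\<gamma> (\<lambda>\<omega>. concat_laplace \<alpha> f \<omega> * exp (- \<omega> * z))"
    unfolding line_integrable_def set_integrable_def by simp
  have "line_integral UNIV ?\<gamma> (\<lambda>\<omega>. concat_laplace \<alpha> f \<omega> * exp (- \<omega> * z)) = (\<integral>t. ?F t \<partial>lebesgue)"
    unfolding line_integral_def set_lebesgue_integral_def by simp
  also have "\<dots> = (\<integral>t. ?G t \<partial>lebesgue)" using integral_cong_AE[OF Gm' Fm ae] by simp
  also have "\<dots> = (\<integral>t. ?G t \<partial>lborel)" by (rule integral_completion[OF Gm])
  also have "\<dots> = (\<integral>t. \<Phi> 1 t \<partial>lborel) + (\<integral>t. \<Phi> (-1) t \<partial>lborel)"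
    using \<Phi>(1)[of 1] \<Phi>m \<Phi>mi by simp
  \<comment> \<open>The sign \<open>- \<sigma>\<close> of each branch produces the boundary
    orientation of the sector: outward along the lower edge, inward along the upper one.\<close>
  also have "\<dots> = 1 / (2 * of_real pi * \<i>) * (E (-1) - E 1)"
    unfolding \<Phi>(2)[of 1, simplified] \<Phi>(2)[of "-1", simplified] by (simp add: algebra_simps diff_divide_distrib)
  also have "E (-1) - E 1 = 2 * pi * \<i> * f z"
    unfolding E_def by (rule sector_cauchy_edge[OF p z])
  finally show "f z = line_integral UNIV ?\<gamma> (\<lambda>\<omega>. concat_laplace \<alpha> f \<omega> * exp (- \<omega> * z))" by simp
qed

end

theorem theorem1p2:
  fixes \<alpha> h p :: real and f :: "complex \<Rightarrow> complex"
  assumes "0 < \<alpha>" and "\<alpha> < pi / 2" and "0 \<le> h"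
    and "f analytic_on sector \<alpha>"
    and "exp_type_at_most h f (sector \<alpha>)"
    and "p * cos \<alpha> < - h"
  shows "range (inversion_curve \<alpha> p) \<subseteq> laplace_domain \<alpha> f \<and>
    (\<forall>z\<in>sector \<alpha>.
       line_integrable UNIV (inversion_curve \<alpha> p) (\<lambda>\<omega>. concat_laplace \<alpha> f \<omega> * exp (- \<omega> * z)) \<and>
       f z = line_integral UNIV (inversion_curve \<alpha> p) (\<lambda>\<omega>. concat_laplace \<alpha> f \<omega> * exp (- \<omega> * z)))"
proof -
  interpret exp_type_sector \<alpha> h f
    by unfold_locales (use assms in \<open>auto intro: analytic_imp_holomorphic\<close>)
  show ?thesis using inversion[OF assms(6)] by blast
qed

end
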